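(* Let $\Omega\subset\mathbb{R}^d$ ($d\ge1$) be a bounded domain, let $k\ge1$ be an integer, and let $\mathcal A,\mathcal B,\mathcal L$ satisfy assumptions (A1)–(A4) of the context. Let $(\mathcal D_m)_{m\in\mathbb{N}}$, $\mathcal D_m=(X_{\mathcal D_m,0},\Pi_{\mathcal D_m},\nabla_{\mathcal D_m},\mathcal H_{\mathcal D_m})$, be a sequence of Hessian discretisations that is coercive, consistent, limit-conforming and compact. Then, for every $m\in\mathbb{N}$, there exists at least one $\Psi_{\mathcal D_m}\in X_{\mathcal D_m,0}^k$ solution of the Hessian scheme $$\mathcal{A}(\mathcal H_{\mathcal D_m}\Psi_{\mathcal D_m},\mathcal H_{\mathcal D_m}\Phi)+\mathcal{B}(\mathcal H_{\mathcal D_m}\Psi_{\mathcal D_m},\nabla_{\mathcal D_m}\Psi_{\mathcal D_m},\nabla_{\mathcal D_m}\Phi)=\mathcal{L}(\Pi_{\mathcal D_m}\Phi)\qquad\forall\,\Phi\in X_{\mathcal D_m,0}^k .$$ Moreover, as $m\to\infty$, there exist a subsequence of $(\mathcal D_m)_{m\in\mathbb{N}}$ (still denoted $(\mathcal D_m)_{m\in\mathbb N}$) and a solution $\Psi\in H^2_0(\Omega)^k$ of $$\mathcal{A}(\mathcal H\Psi,\mathcal H\Phi)+\mathcal{B}(\mathcal H\Psi,\nabla\Psi,\nabla\Phi)=\mathcal{L}(\Phi)\qquad\forall\,\Phi\in H^2_0(\Omega)^k$$ such that, along this subsequence, $\Pi_{\mathcal D_m}\Psi_{\mathcal D_m}\to\Psi$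 in $L^2(\Omega)^k$, $\nabla_{\mathcal D_m}\Psi_{\mathcal D_m}\to\nabla\Psi$ in $L^4(\Omega;\mathbb{R}^d)^k$ and $\mathcal H_{\mathcal D_m}\Psi_{\mathcal D_m}\to\mathcal H\Psi$ in $L^2(\Omega;\mathbb{R}^{d\times d})^k$.
   Context: $\|\cdot\|$ denotes the $L^2(\Omega)$-norm (of scalar, vector or matrix valued functions), $\|\cdot\|_{L^4}$ the $L^4(\Omega)$-norm. $\mathcal H$ is the Hessian operator; for a matrix-valued $\xi$, $\mathcal H:\xi=\sum_{i,j}\partial_{ij}\xi_{ij}$ (in the sense of distributions), and $\xi:\chi=\sum_{i,j}\xi_{ij}\chi_{ij}$. All operators act component-wise on $k$-component vectors. Assumptions on the forms: (A1) $\mathcal{A}$ is a continuous and coercive bilinear form on $L^2(\Omega;\mathbb{R}^{d\times d})^k\times L^2(\Omega;\mathbb{R}^{d\times d})^k$ (coercive: there is $\alpha>0$ with $\mathcal A(\Xi,\Xi)\ge\alpha\|\Xi\|^2$ for all $\Xi$). (A2) $\mathcal{B}$ is a continuous trilinear form on $L^2(\Omega;\mathbb{R}^{d\times d})^k\times L^4(\Omega;\mathbb{R}^d)^k\times L^4(\Omega;\mathbb{R}^d)^k$. (A3) $\mathcal{B}(\Xi,\Theta,\Theta)=0$ for all $\Xi\in L^2(\Omega;\mathbb{R}^{d\times d})^k$ and $\Theta\in L^4(\Omega;\mathbb{R}^d)^k$. (A4) $\mathcal{L}$ is a continuous linear form on $L^2(\Omega)^k$. A Hessian discretisation (HD) is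 a quadruplet $\mathcal D=(X_{\mathcal D,0},\Pi_{\mathcal D},\nabla_{\mathcal D},\mathcal H_{\mathcal D})$ where $X_{\mathcal D,0}$ is a finite-dimensional real vector space and $\Pi_{\mathcal D}:X_{\mathcal D,0}\to L^2(\Omega)$, $\nabla_{\mathcal D}:X_{\mathcal D,0}\to L^4(\Omega;\mathbb{R}^d)$, $\mathcal H_{\mathcal D}:X_{\mathcal D,0}\to L^2(\Omega;\mathbb{R}^{d\times d})$ are linear maps such that $\|\cdot\|_{\mathcal D}:=\|\mathcal H_{\mathcal D}\,\cdot\|$ is a norm on $X_{\mathcal D,0}$. Quantities attached to $\mathcal D$: $$C_{\mathcal D}=\max_{w\in X_{\mathcal D,0}\setminus\{0\}}\max\left(\frac{\|\Pi_{\mathcal D}w\|}{\|\mathcal H_{\mathcal D}w\|},\frac{\|\nabla_{\mathcal D}w\|_{L^4}}{\|\mathcal H_{\mathcal D}w\|}\right);$$ for $\varphi\in H^2_0(\Omega)$, $$S_{\mathcal D}(\varphi)=\min_{w\in X_{\mathcal D,0}}\big(\|\Pi_{\mathcal D}w-\varphi\|+\|\nabla_{\mathcal D}w-\nabla\varphi\|_{L^4}+\|\mathcal H_{\mathcal D}w-\mathcal H\varphi\|\big);$$ for $\xi\in H(\Omega):=\{\xi\in L^2(\Omega;\mathbb{R}^{d\times d}):\mathcal H:\xi\in L^2(\Omega)\}$ and $\phi\in H_{\rm div}(\Omega):=\{\phi\in L^2(\Omega;\mathbb{R}^d):\mathrm{div}\,\phi\in L^2(\Omega)\}$, $$W_{\mathcal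 D}(\xi)=\max_{w\in X_{\mathcal D,0}\setminus\{0\}}\frac{1}{\|\mathcal H_{\mathcal D}w\|}\left|\int_\Omega\big((\mathcal H:\xi)\Pi_{\mathcal D}w-\xi:\mathcal H_{\mathcal D}w\big)\,dx\right|,$$ $$\widehat W_{\mathcal D}(\phi)=\max_{w\in X_{\mathcal D,0}\setminus\{0\}}\frac{1}{\|\mathcal H_{\mathcal D}w\|}\left|\int_\Omega\big(\nabla_{\mathcal D}w\cdot\phi+\Pi_{\mathcal D}w\,\mathrm{div}\,\phi\big)\,dx\right|.$$ A sequence $(\mathcal D_m)_{m\in\mathbb N}$ of HDs is: coercive if $\sup_m C_{\mathcal D_m}<\infty$; consistent if $\lim_{m\to\infty}S_{\mathcal D_m}(\varphi)=0$ for all $\varphi\in H^2_0(\Omega)$; limit-conforming if $\lim_{m\to\infty}\big(W_{\mathcal D_m}(\xi)+\widehat W_{\mathcal D_m}(\phi)\big)=0$ for all $\xi\in H(\Omega)$ and $\phi\in H_{\rm div}(\Omega)$; compact if, for any sequence $u_m\in X_{\mathcal D_m,0}$ such that $(\|\mathcal H_{\mathcal D_m}u_m\|)_{m}$ is bounded, $(\Pi_{\mathcal D_m}u_m)_m$ is relatively compact in $L^2(\Omega)$ and $(\nabla_{\mathcal D_m}u_m)_m$ is relatively compact in $L^4(\Omega;\mathbb{R}^d)$. *)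

theory Defs
  imports "HOL-Analysis.Analysis"
begin

text \<open>
  Elements of Lebesgue spaces are represented by functions on the whole space, of which only the
  values almost everywhere on \<^term>\<open>\<Omega>\<close> matter.  A space \<open>L\<^sup>p(\<Omega>; V)\<^sup>k\<close> is identified with
  \<open>L\<^sup>p(\<Omega>; V\<^sup>k)\<close>, where \<open>k\<close> is the cardinality of the index type \<open>'k\<close>.  On
  \<open>real ^ 'n ^ 'n\<close> the inner product is \<open>\<xi> : \<chi> = \<Sum>\<^sub>i\<^sub>,\<^sub>j \<xi>\<^sub>i\<^sub>j \<chi>\<^sub>i\<^sub>j\<close> and the
  norm is the Frobenius norm.
\<close>

subsection \<open>Lebesgue spaces\<close>

definition Lp :: "nat \<Rightarrow> (real ^ 'n::finite) set \<Rightarrow> (real ^ 'n \<Rightarrow> 'v::euclidean_space) set" where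
  "Lp p \<Omega> = {f \<in> borel_measurable (lebesgue_on \<Omega>). integrable (lebesgue_on \<Omega>) (\<lambda>x. norm (f x) ^ p)}"

definition Lp_norm :: "nat \<Rightarrow> (real ^ 'n::finite) set \<Rightarrow> (real ^ 'n \<Rightarrow> 'v::euclidean_space) \<Rightarrow> real" where
  "Lp_norm p \<Omega> f = root p (\<integral>x. norm (f x) ^ p \<partial>lebesgue_on \<Omega>)"

text \<open>\<^const>\<open>Lp_norm\<close> is only meaningful on \<^const>\<open>Lp\<close>; the extended norm is infinite elsewhere.
  This matters for gradients of \<open>H\<^sup>2\<^sub>0\<close> functions, which need not be in \<open>L\<^sup>4\<close> in dimension
  greater than four.\<close>

definition Lp_enorm :: "nat \<Rightarrow> (real ^ 'n::finite) set \<Rightarrow> (real ^ 'n \<Rightarrow> 'v::euclidean_space) \<Rightarrow> ennreal" where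
  "Lp_enorm p \<Omega> f = (if f \<in> Lp p \<Omega> then ennreal (Lp_norm p \<Omega> f) else \<infinity>)"

definition Lp_tendsto ::
  "nat \<Rightarrow> (real ^ 'n::finite) set \<Rightarrow> (nat \<Rightarrow> real ^ 'n \<Rightarrow> 'v::euclidean_space) \<Rightarrow> (real ^ 'n \<Rightarrow> 'v) \<Rightarrow> bool" where
  "Lp_tendsto p \<Omega> f g \<longleftrightarrow>
     (\<forall>m. f m \<in> Lp p \<Omega>) \<and> g \<in> Lp p \<Omega> \<and> (\<lambda>m. Lp_norm p \<Omega> (\<lambda>x. f m x - g x)) \<longlonglongrightarrow> 0"

definition Lp_relatively_compact ::
  "nat \<Rightarrow> (real ^ 'n::finite) set \<Rightarrow> (real ^ 'n \<Rightarrow> 'v::euclidean_space) set \<Rightarrow> bool" where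
  "Lp_relatively_compact p \<Omega> F \<longleftrightarrow> F \<subseteq> Lp p \<Omega> \<and>
     (\<forall>s. (\<forall>n. s n \<in> F) \<longrightarrow>
        (\<exists>r g. strict_mono (r :: nat \<Rightarrow> nat) \<and> Lp_tendsto p \<Omega> (s \<circ> r) g))"

definition Lp_linear ::
  "nat \<Rightarrow> (real ^ 'n::finite) set \<Rightarrow> ((real ^ 'n \<Rightarrow> 'v::euclidean_space) \<Rightarrow> real) \<Rightarrow> bool" where
  "Lp_linear p \<Omega> F \<longleftrightarrow> (\<forall>f\<in>Lp p \<Omega>. \<forall>g\<in>Lp p \<Omega>. \<forall>a b.
     F (\<lambda>x. a *\<^sub>R f x + b *\<^sub>R g x) = a * F f + b * F g)"


subsection \<open>Test functions, weak derivatives and Sobolev spaces\<close>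

definition partial_deriv :: "'n \<Rightarrow> (real ^ 'n::finite \<Rightarrow> real) \<Rightarrow> real ^ 'n \<Rightarrow> real" where
  "partial_deriv i f x = frechet_derivative f (at x) (axis i 1)"

fun Ck :: "nat \<Rightarrow> (real ^ 'n::finite \<Rightarrow> real) \<Rightarrow> bool" where
  "Ck 0 f \<longleftrightarrow> continuous_on UNIV f"
| "Ck (Suc m) f \<longleftrightarrow> (\<forall>x. f differentiable (at x)) \<and> (\<forall>i. Ck m (partial_deriv i f))"

definition test_functions :: "(real ^ 'n::finite) set \<Rightarrow> (real ^ 'n \<Rightarrow> real) set" where
  "test_functions \<Omega> = {\<psi>. (\<forall>m. Ck m \<psi>) \<and> (\<exists>K. compact K \<and> K \<subseteq> \<Omega> \<and> (\<forall>x. x \<notin> K \<longrightarrow> \<psi> x = 0))}"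

definition is_weak_gradient ::
  "(real ^ 'n::finite) set \<Rightarrow> (real ^ 'n \<Rightarrow> real) \<Rightarrow> (real ^ 'n \<Rightarrow> real ^ 'n) \<Rightarrow> bool" where
  "is_weak_gradient \<Omega> u g \<longleftrightarrow> (\<forall>\<psi>\<in>test_functions \<Omega>. \<forall>i.
     (\<integral>x. u x * partial_deriv i \<psi> x \<partial>lebesgue_on \<Omega>) = - (\<integral>x. g x $ i * \<psi> x \<partial>lebesgue_on \<Omega>))"

definition is_weak_hessian ::
  "(real ^ 'n::finite) set \<Rightarrow> (real ^ 'n \<Rightarrow> real) \<Rightarrow> (real ^ 'n \<Rightarrow> real ^ 'n ^ 'n) \<Rightarrow> bool" where
  "is_weak_hessian \<Omega> u h \<longleftrightarrow> (\<forall>\<psi>\<in>test_functions \<Omega>. \<forall>i j.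
     (\<integral>x. u x * partial_deriv i (partial_deriv j \<psi>) x \<partial>lebesgue_on \<Omega>)
       = (\<integral>x. h x $ i $ j * \<psi> x \<partial>lebesgue_on \<Omega>))"

definition is_weak_div ::
  "(real ^ 'n::finite) set \<Rightarrow> (real ^ 'n \<Rightarrow> real ^ 'n) \<Rightarrow> (real ^ 'n \<Rightarrow> real) \<Rightarrow> bool" where
  "is_weak_div \<Omega> \<phi> f \<longleftrightarrow> (\<forall>\<psi>\<in>test_functions \<Omega>.
     (\<integral>x. (\<Sum>i\<in>UNIV. \<phi> x $ i * partial_deriv i \<psi> x) \<partial>lebesgue_on \<Omega>)
       = - (\<integral>x. f x * \<psi> x \<partial>lebesgue_on \<Omega>))"

text \<open>The distribution \<open>\<H> : \<xi> = \<Sum>\<^sub>i\<^sub>,\<^sub>j \<partial>\<^sub>i\<^sub>j \<xi>\<^sub>i\<^sub>j\<close> is represented by \<open>f\<close>.\<close>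

definition is_weak_hess_contr ::
  "(real ^ 'n::finite) set \<Rightarrow> (real ^ 'n \<Rightarrow> real ^ 'n ^ 'n) \<Rightarrow> (real ^ 'n \<Rightarrow> real) \<Rightarrow> bool" where
  "is_weak_hess_contr \<Omega> \<xi> f \<longleftrightarrow> (\<forall>\<psi>\<in>test_functions \<Omega>.
     (\<integral>x. (\<Sum>i\<in>UNIV. \<Sum>j\<in>UNIV. \<xi> x $ i $ j * partial_deriv i (partial_deriv j \<psi>) x) \<partial>lebesgue_on \<Omega>)
       = (\<integral>x. f x * \<psi> x \<partial>lebesgue_on \<Omega>))"

text \<open>Square-integrable weak derivatives on an open set are unique up to null sets, so the following
  choices only fix a representative.\<close>

definition weak_gradient :: "(real ^ 'n::finite) set \<Rightarrow> (real ^ 'n \<Rightarrow> real) \<Rightarrow> real ^ 'n \<Rightarrow> real ^ 'n" where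
  "weak_gradient \<Omega> u = (SOME g. g \<in> Lp 2 \<Omega> \<and> is_weak_gradient \<Omega> u g)"

definition weak_hessian :: "(real ^ 'n::finite) set \<Rightarrow> (real ^ 'n \<Rightarrow> real) \<Rightarrow> real ^ 'n \<Rightarrow> real ^ 'n ^ 'n" where
  "weak_hessian \<Omega> u = (SOME h. h \<in> Lp 2 \<Omega> \<and> is_weak_hessian \<Omega> u h)"

definition weak_div :: "(real ^ 'n::finite) set \<Rightarrow> (real ^ 'n \<Rightarrow> real ^ 'n) \<Rightarrow> real ^ 'n \<Rightarrow> real" where
  "weak_div \<Omega> \<phi> = (SOME f. f \<in> Lp 2 \<Omega> \<and> is_weak_div \<Omega> \<phi> f)"

definition weak_hess_contr :: "(real ^ 'n::finite) set \<Rightarrow> (real ^ 'n \<Rightarrow> real ^ 'n ^ 'n) \<Rightarrow> real ^ 'n \<Rightarrow> real" where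
  "weak_hess_contr \<Omega> \<xi> = (SOME f. f \<in> Lp 2 \<Omega> \<and> is_weak_hess_contr \<Omega> \<xi> f)"

definition H2 :: "(real ^ 'n::finite) set \<Rightarrow> (real ^ 'n \<Rightarrow> real) set" where
  "H2 \<Omega> = {u \<in> Lp 2 \<Omega>. (\<exists>g \<in> Lp 2 \<Omega>. is_weak_gradient \<Omega> u g) \<and> (\<exists>h \<in> Lp 2 \<Omega>. is_weak_hessian \<Omega> u h)}"

definition H2_norm :: "(real ^ 'n::finite) set \<Rightarrow> (real ^ 'n \<Rightarrow> real) \<Rightarrow> real" where
  "H2_norm \<Omega> u =
     sqrt ((Lp_norm 2 \<Omega> u)\<^sup>2 + (Lp_norm 2 \<Omega> (weak_gradient \<Omega> u))\<^sup>2 + (Lp_norm 2 \<Omega> (weak_hessian \<Omega> u))\<^sup>2)"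

text \<open>\<open>H\<^sup>2\<^sub>0(\<Omega>)\<close> is the closure of the test functions in \<open>H\<^sup>2(\<Omega>)\<close>.\<close>

definition H20 :: "(real ^ 'n::finite) set \<Rightarrow> (real ^ 'n \<Rightarrow> real) set" where
  "H20 \<Omega> = {u \<in> H2 \<Omega>. \<forall>\<epsilon>>0. \<exists>\<psi>\<in>test_functions \<Omega>. H2_norm \<Omega> (\<lambda>x. u x - \<psi> x) < \<epsilon>}"

definition Hdiv :: "(real ^ 'n::finite) set \<Rightarrow> (real ^ 'n \<Rightarrow> real ^ 'n) set" where
  "Hdiv \<Omega> = {\<phi> \<in> Lp 2 \<Omega>. \<exists>f \<in> Lp 2 \<Omega>. is_weak_div \<Omega> \<phi> f}"

definition Hhess :: "(real ^ 'n::finite) set \<Rightarrow> (real ^ 'n \<Rightarrow> real ^ 'n ^ 'n) set" where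
  "Hhess \<Omega> = {\<xi> \<in> Lp 2 \<Omega>. \<exists>f \<in> Lp 2 \<Omega>. is_weak_hess_contr \<Omega> \<xi> f}"


subsection \<open>Hessian discretisations\<close>

text \<open>The space \<open>X\<^sub>\<D>\<^sub>,\<^sub>0\<close> is a finite-dimensional subspace of an arbitrary real vector space,
  so that it can vary along a sequence of discretisations.\<close>

record ('x, 'n::finite) hess_disc =
  hd_space :: "'x set"
  hd_Pi :: "'x \<Rightarrow> real ^ 'n \<Rightarrow> real"
  hd_grad :: "'x \<Rightarrow> real ^ 'n \<Rightarrow> real ^ 'n"
  hd_hess :: "'x \<Rightarrow> real ^ 'n \<Rightarrow> real ^ 'n ^ 'n"

definition linear_into_Lp ::
  "nat \<Rightarrow> (real ^ 'n::finite) set \<Rightarrow> 'x::real_vector set \<Rightarrow> ('x \<Rightarrow> real ^ 'n \<Rightarrow> 'v::euclidean_space) \<Rightarrow> bool" where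
  "linear_into_Lp p \<Omega> X F \<longleftrightarrow> (\<forall>u\<in>X. F u \<in> Lp p \<Omega>) \<and>
     (\<forall>u\<in>X. \<forall>v\<in>X. \<forall>a b. AE x in lebesgue_on \<Omega>.
        F (a *\<^sub>R u + b *\<^sub>R v) x = a *\<^sub>R F u x + b *\<^sub>R F v x)"

definition is_norm_on :: "'x::real_vector set \<Rightarrow> ('x \<Rightarrow> real) \<Rightarrow> bool" where
  "is_norm_on X N \<longleftrightarrow>
     (\<forall>u\<in>X. 0 \<le> N u) \<and> (\<forall>u\<in>X. N u = 0 \<longleftrightarrow> u = 0) \<and>
     (\<forall>u\<in>X. \<forall>a. N (a *\<^sub>R u) = \<bar>a\<bar> * N u) \<and> (\<forall>u\<in>X. \<forall>v\<in>X. N (u + v) \<le> N u + N v)"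

definition hd_norm :: "(real ^ 'n::finite) set \<Rightarrow> ('x, 'n) hess_disc \<Rightarrow> 'x \<Rightarrow> real" where
  "hd_norm \<Omega> D w = Lp_norm 2 \<Omega> (hd_hess D w)"

definition hessian_discretisation ::
  "(real ^ 'n::finite) set \<Rightarrow> ('x::real_vector, 'n) hess_disc \<Rightarrow> bool" where
  "hessian_discretisation \<Omega> D \<longleftrightarrow>
     subspace (hd_space D) \<and> (\<exists>b. finite b \<and> span b = hd_space D) \<and>
     linear_into_Lp 2 \<Omega> (hd_space D) (hd_Pi D) \<and>
     linear_into_Lp 4 \<Omega> (hd_space D) (hd_grad D) \<and>
     linear_into_Lp 2 \<Omega> (hd_space D) (hd_hess D) \<and>
     is_norm_on (hd_space D) (hd_norm \<Omega> D)"

text \<open>The suprema and the infimum are taken in \<^typ>\<open>ennreal\<close>; in particular the suprema are \<open>0\<close>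
  when the discrete space is trivial.\<close>

definition hd_C :: "(real ^ 'n::finite) set \<Rightarrow> ('x::real_vector, 'n) hess_disc \<Rightarrow> ennreal" where
  "hd_C \<Omega> D = (SUP w \<in> hd_space D - {0}. ennreal
     (max (Lp_norm 2 \<Omega> (hd_Pi D w) / hd_norm \<Omega> D w) (Lp_norm 4 \<Omega> (hd_grad D w) / hd_norm \<Omega> D w)))"

definition hd_S :: "(real ^ 'n::finite) set \<Rightarrow> ('x, 'n) hess_disc \<Rightarrow> (real ^ 'n \<Rightarrow> real) \<Rightarrow> ennreal" where
  "hd_S \<Omega> D \<phi> = (INF w \<in> hd_space D.
     Lp_enorm 2 \<Omega> (\<lambda>x. hd_Pi D w x - \<phi> x)
     + Lp_enorm 4 \<Omega> (\<lambda>x. hd_grad D w x - weak_gradient \<Omega> \<phi> x)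
     + Lp_enorm 2 \<Omega> (\<lambda>x. hd_hess D w x - weak_hessian \<Omega> \<phi> x))"

definition hd_W ::
  "(real ^ 'n::finite) set \<Rightarrow> ('x::real_vector, 'n) hess_disc \<Rightarrow> (real ^ 'n \<Rightarrow> real ^ 'n ^ 'n) \<Rightarrow> ennreal" where
  "hd_W \<Omega> D \<xi> = (SUP w \<in> hd_space D - {0}. ennreal (1 / hd_norm \<Omega> D w *
     \<bar>\<integral>x. weak_hess_contr \<Omega> \<xi> x * hd_Pi D w x - \<xi> x \<bullet> hd_hess D w x \<partial>lebesgue_on \<Omega>\<bar>))"

definition hd_W_hat ::
  "(real ^ 'n::finite) set \<Rightarrow> ('x::real_vector, 'n) hess_disc \<Rightarrow> (real ^ 'n \<Rightarrow> real ^ 'n) \<Rightarrow> ennreal" where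
  "hd_W_hat \<Omega> D \<phi> = (SUP w \<in> hd_space D - {0}. ennreal (1 / hd_norm \<Omega> D w *
     \<bar>\<integral>x. hd_grad D w x \<bullet> \<phi> x + hd_Pi D w x * weak_div \<Omega> \<phi> x \<partial>lebesgue_on \<Omega>\<bar>))"

definition hd_coercive :: "(real ^ 'n::finite) set \<Rightarrow> (nat \<Rightarrow> ('x::real_vector, 'n) hess_disc) \<Rightarrow> bool" where
  "hd_coercive \<Omega> D \<longleftrightarrow> (SUP m. hd_C \<Omega> (D m)) < \<infinity>"

definition hd_consistent :: "(real ^ 'n::finite) set \<Rightarrow> (nat \<Rightarrow> ('x, 'n) hess_disc) \<Rightarrow> bool" where
  "hd_consistent \<Omega> D \<longleftrightarrow> (\<forall>\<phi>\<in>H20 \<Omega>. (\<lambda>m. hd_S \<Omega> (D m) \<phi>) \<longlonglongrightarrow> 0)"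

definition hd_limit_conforming :: "(real ^ 'n::finite) set \<Rightarrow> (nat \<Rightarrow> ('x::real_vector, 'n) hess_disc) \<Rightarrow> bool" where
  "hd_limit_conforming \<Omega> D \<longleftrightarrow>
     (\<forall>\<xi>\<in>Hhess \<Omega>. \<forall>\<phi>\<in>Hdiv \<Omega>. (\<lambda>m. hd_W \<Omega> (D m) \<xi> + hd_W_hat \<Omega> (D m) \<phi>) \<longlonglongrightarrow> 0)"

definition hd_compact :: "(real ^ 'n::finite) set \<Rightarrow> (nat \<Rightarrow> ('x, 'n) hess_disc) \<Rightarrow> bool" where
  "hd_compact \<Omega> D \<longleftrightarrow>
     (\<forall>u. (\<forall>m. u m \<in> hd_space (D m)) \<and> bounded (range (\<lambda>m. hd_norm \<Omega> (D m) (u m))) \<longrightarrow>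
        Lp_relatively_compact 2 \<Omega> (range (\<lambda>m. hd_Pi (D m) (u m))) \<and>
        Lp_relatively_compact 4 \<Omega> (range (\<lambda>m. hd_grad (D m) (u m))))"


subsection \<open>The forms\<close>

text \<open>Linearity together with the bound makes each form independent of the chosen representatives.\<close>

definition form_A1 ::
  "(real ^ 'n::finite) set
    \<Rightarrow> ((real ^ 'n \<Rightarrow> real ^ 'n ^ 'n ^ 'k::finite) \<Rightarrow> (real ^ 'n \<Rightarrow> real ^ 'n ^ 'n ^ 'k) \<Rightarrow> real) \<Rightarrow> bool" where
  "form_A1 \<Omega> A \<longleftrightarrow>
     (\<forall>\<Xi>\<in>Lp 2 \<Omega>. Lp_linear 2 \<Omega> (\<lambda>X. A \<Xi> X)) \<and>
     (\<forall>X\<in>Lp 2 \<Omega>. Lp_linear 2 \<Omega> (\<lambda>\<Xi>. A \<Xi> X)) \<and>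
     (\<exists>C. \<forall>\<Xi>\<in>Lp 2 \<Omega>. \<forall>X\<in>Lp 2 \<Omega>. \<bar>A \<Xi> X\<bar> \<le> C * Lp_norm 2 \<Omega> \<Xi> * Lp_norm 2 \<Omega> X) \<and>
     (\<exists>\<alpha>>0. \<forall>\<Xi>\<in>Lp 2 \<Omega>. A \<Xi> \<Xi> \<ge> \<alpha> * (Lp_norm 2 \<Omega> \<Xi>)\<^sup>2)"

definition form_A2 ::
  "(real ^ 'n::finite) set
    \<Rightarrow> ((real ^ 'n \<Rightarrow> real ^ 'n ^ 'n ^ 'k::finite) \<Rightarrow> (real ^ 'n \<Rightarrow> real ^ 'n ^ 'k)
         \<Rightarrow> (real ^ 'n \<Rightarrow> real ^ 'n ^ 'k) \<Rightarrow> real) \<Rightarrow> bool" where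
  "form_A2 \<Omega> B \<longleftrightarrow>
     (\<forall>\<Theta>\<in>Lp 4 \<Omega>. \<forall>T\<in>Lp 4 \<Omega>. Lp_linear 2 \<Omega> (\<lambda>\<Xi>. B \<Xi> \<Theta> T)) \<and>
     (\<forall>\<Xi>\<in>Lp 2 \<Omega>. \<forall>T\<in>Lp 4 \<Omega>. Lp_linear 4 \<Omega> (\<lambda>\<Theta>. B \<Xi> \<Theta> T)) \<and>
     (\<forall>\<Xi>\<in>Lp 2 \<Omega>. \<forall>\<Theta>\<in>Lp 4 \<Omega>. Lp_linear 4 \<Omega> (\<lambda>T. B \<Xi> \<Theta> T)) \<and>
     (\<exists>C. \<forall>\<Xi>\<in>Lp 2 \<Omega>. \<forall>\<Theta>\<in>Lp 4 \<Omega>. \<forall>T\<in>Lp 4 \<Omega>.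
        \<bar>B \<Xi> \<Theta> T\<bar> \<le> C * Lp_norm 2 \<Omega> \<Xi> * Lp_norm 4 \<Omega> \<Theta> * Lp_norm 4 \<Omega> T)"

definition form_A3 ::
  "(real ^ 'n::finite) set
    \<Rightarrow> ((real ^ 'n \<Rightarrow> real ^ 'n ^ 'n ^ 'k::finite) \<Rightarrow> (real ^ 'n \<Rightarrow> real ^ 'n ^ 'k)
         \<Rightarrow> (real ^ 'n \<Rightarrow> real ^ 'n ^ 'k) \<Rightarrow> real) \<Rightarrow> bool" where
  "form_A3 \<Omega> B \<longleftrightarrow> (\<forall>\<Xi>\<in>Lp 2 \<Omega>. \<forall>\<Theta>\<in>Lp 4 \<Omega>. B \<Xi> \<Theta> \<Theta> = 0)"

definition form_A4 :: "(real ^ 'n::finite) set \<Rightarrow> ((real ^ 'n \<Rightarrow> real ^ 'k::finite) \<Rightarrow> real) \<Rightarrow> bool" where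
  "form_A4 \<Omega> L \<longleftrightarrow> Lp_linear 2 \<Omega> L \<and> (\<exists>C. \<forall>f\<in>Lp 2 \<Omega>. \<bar>L f\<bar> \<le> C * Lp_norm 2 \<Omega> f)"


subsection \<open>The Hessian scheme and the weak problem\<close>

text \<open>Component-wise action of an operator on a \<open>k\<close>-tuple, as a \<open>V\<^sup>k\<close>-valued function.\<close>

definition cwise :: "('u \<Rightarrow> 'a \<Rightarrow> 'v) \<Rightarrow> 'u ^ 'k::finite \<Rightarrow> 'a \<Rightarrow> 'v ^ 'k" where
  "cwise F \<Psi> = (\<lambda>x. \<chi> i. F (\<Psi> $ i) x)"

definition tuples :: "'u set \<Rightarrow> ('u ^ 'k::finite) set" where
  "tuples X = {\<Psi>. \<forall>i. \<Psi> $ i \<in> X}"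

definition hessian_scheme_solution ::
  "((real ^ 'n \<Rightarrow> real ^ 'n ^ 'n ^ 'k) \<Rightarrow> (real ^ 'n \<Rightarrow> real ^ 'n ^ 'n ^ 'k) \<Rightarrow> real)
    \<Rightarrow> ((real ^ 'n \<Rightarrow> real ^ 'n ^ 'n ^ 'k) \<Rightarrow> (real ^ 'n \<Rightarrow> real ^ 'n ^ 'k) \<Rightarrow> (real ^ 'n \<Rightarrow> real ^ 'n ^ 'k) \<Rightarrow> real)
    \<Rightarrow> ((real ^ 'n \<Rightarrow> real ^ 'k) \<Rightarrow> real)
    \<Rightarrow> ('x, 'n::finite) hess_disc \<Rightarrow> 'x ^ 'k::finite \<Rightarrow> bool" where
  "hessian_scheme_solution A B L D \<Psi> \<longleftrightarrow> \<Psi> \<in> tuples (hd_space D) \<and>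
     (\<forall>\<Phi>\<in>tuples (hd_space D).
        A (cwise (hd_hess D) \<Psi>) (cwise (hd_hess D) \<Phi>)
        + B (cwise (hd_hess D) \<Psi>) (cwise (hd_grad D) \<Psi>) (cwise (hd_grad D) \<Phi>)
        = L (cwise (hd_Pi D) \<Phi>))"

definition weak_solution ::
  "(real ^ 'n::finite) set
    \<Rightarrow> ((real ^ 'n \<Rightarrow> real ^ 'n ^ 'n ^ 'k) \<Rightarrow> (real ^ 'n \<Rightarrow> real ^ 'n ^ 'n ^ 'k) \<Rightarrow> real)
    \<Rightarrow> ((real ^ 'n \<Rightarrow> real ^ 'n ^ 'n ^ 'k) \<Rightarrow> (real ^ 'n \<Rightarrow> real ^ 'n ^ 'k) \<Rightarrow> (real ^ 'n \<Rightarrow> real ^ 'n ^ 'k) \<Rightarrow> real)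
    \<Rightarrow> ((real ^ 'n \<Rightarrow> real ^ 'k) \<Rightarrow> real)
    \<Rightarrow> (real ^ 'n \<Rightarrow> real) ^ 'k::finite \<Rightarrow> bool" where
  "weak_solution \<Omega> A B L \<Psi> \<longleftrightarrow> \<Psi> \<in> tuples (H20 \<Omega>) \<and>
     (\<forall>\<Phi>\<in>tuples (H20 \<Omega>).
        A (cwise (weak_hessian \<Omega>) \<Psi>) (cwise (weak_hessian \<Omega>) \<Phi>)
        + B (cwise (weak_hessian \<Omega>) \<Psi>) (cwise (weak_gradient \<Omega>) \<Psi>) (cwise (weak_gradient \<Omega>) \<Phi>)
        = L (cwise (\<lambda>u. u) \<Phi>))"

end

theory Submission
  imports Defs "HOL-Homology.Homology"
begin

text \<open>
  Coercivity and the skew-symmetry (A3) turn each discrete problem into the search for a zero of a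
  continuous vector field that points outwards on a large sphere of a finite-dimensional space; such a zero
  exists because spheres are not contractible.  The dimension of the discrete space varies, so the argument
  uses the spheres \<open>nsphere n\<close> of singular homology rather than Brouwer's theorem, whose dimension is a type.

  The a priori bound gives strong limits of the reconstructed functions and gradients by compactness, and a
  weak limit of the discrete Hessians: limit-conformity makes their integrals against matrix-valued test
  functions converge, and these are dense.  Limit-conformity then says that the pair of the limits \<open>(u, h)\<close>
  is orthogonal to the orthogonal complement of \<open>{(\<psi>, \<H> \<psi>)}\<close> in \<open>L\<^sup>2\<close>, so \<open>u\<close> is a limit of test functions in
  \<open>H\<^sup>2\<close>, on an arbitrary bounded open set.  Passing to the limit in the scheme combines weak convergence of
  the Hessians with strong convergence of the rest, and coercivity upgrades it to strong convergence by
  convergence of the energies.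
\<close>

subsection \<open>Zeros of outward pointing vector fields\<close>

text \<open>\<open>A\<close> is not assumed symmetric, so the discrete problem is no minimisation
  problem and existence has to come from topology. In the trilinear term only the first argument
  converges weakly: once the two gradient arguments are replaced by their strong limits, what
  remains is a bounded linear functional of the Hessian. Two features of the setting shape the rest.
  In dimension above four the gradient of an \<open>H20\<close> function may fail to lie in
  \<open>Lp 4\<close>. For the limit it does, being an L4 limit of discrete gradients, and this
  permits (A3) to be applied to the limit itself, which is the key to the convergence of the
  energies. Moreover, the discrete operators are linear only almost everywhere while the forms act
  on functions, so the bounds on the forms are also what makes them insensitive to representatives.
  Extraction concerns only the reconstructed functions and gradients; the Hessians then converge
  weakly along the whole extracted sequence.\<close>

definition zsphere :: "nat \<Rightarrow> (nat \<Rightarrow> real) set" where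
  "zsphere n = {x. (\<Sum>i\<le>n. x i ^ 2) = 1 \<and> (\<forall>i>n. x i = 0)}"

text \<open>Radial projection onto \<open>zsphere n\<close>. Coordinates above \<open>n\<close> are
  set to 0, because the fields normalised below are unconstrained there.\<close>

definition znormalize :: "nat \<Rightarrow> (nat \<Rightarrow> real) \<Rightarrow> nat \<Rightarrow> real" where
  "znormalize n v = (\<lambda>i. if i \<le> n then v i / sqrt (\<Sum>i\<le>n. v i ^ 2) else 0)"

text \<open>Homology gives the result for the abstract space \<open>nsphere n\<close>. Its product
  topology is the type class topology of \<open>nat \<Rightarrow> real\<close>, so the two notions
  of contractibility agree.\<close>

lemma not_contractible_zsphere: "\<not> contractible (zsphere n)"
proof -
  have "nsphere n = top_of_set (zsphere n)"
    by (simp add: nsphere zsphere_def euclidean_product_topology)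
  then show ?thesis
    using non_contractible_space_nsphere [of n] by simp
qed

lemma sum_squares_pos:
  fixes v :: "nat \<Rightarrow> real"
  assumes "i \<le> n" "v i \<noteq> 0"
  shows "(\<Sum>i\<le>n. v i ^ 2) > 0"
  using assms by (intro sum_pos2 [of _ i]) auto

text \<open>A family of fields without zeros on the sphere becomes, after radial projection, a
  homotopy of self-maps of the sphere: the denominator is positive because some coordinate up to
  \<open>n\<close> is nonzero.\<close>

lemma znormalize_homotopy:
  fixes F :: "real \<times> (nat \<Rightarrow> real) \<Rightarrow> nat \<Rightarrow> real"
  assumes cont: "\<And>i. i \<le> n \<Longrightarrow> continuous_on ({0..1::real} \<times> zsphere n) (\<lambda>z. F z i)"
    and nz: "\<And>z. z \<in> {0..1::real} \<times> zsphere n \<Longrightarrow> \<exists>i\<le>n. F z i \<noteq> 0"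
  shows "homotopic_with_canon (\<lambda>_. True) (zsphere n) (zsphere n)
           (\<lambda>x. znormalize n (F (0, x))) (\<lambda>x. znormalize n (F (1, x)))"
proof -
  have pos: "(\<Sum>i\<le>n. F z i ^ 2) > 0" if z: "z \<in> {0..1::real} \<times> zsphere n" for z
    using nz [OF z] sum_squares_pos by blast
  have "continuous_on ({0..1::real} \<times> zsphere n) (\<lambda>z. znormalize n (F z))"
  proof (rule continuous_on_coordinatewise_then_product)
    fix i
    have "sqrt (\<Sum>i\<le>n. (F z i)\<^sup>2) \<noteq> 0" if "z \<in> {0..1::real} \<times> zsphere n" for z
      using pos [OF that] by simp
    then show "continuous_on ({0..1::real} \<times> zsphere n) (\<lambda>z. znormalize n (F z) i)"
      unfolding znormalize_def
      by (cases "i \<le> n") (auto intro!: continuous_intros cont)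
  qed
  moreover have "znormalize n (F z) \<in> zsphere n" if z: "z \<in> {0..1::real} \<times> zsphere n" for z
  proof -
    have "(\<Sum>i\<le>n. (F z i / sqrt (\<Sum>i\<le>n. F z i ^ 2))\<^sup>2) = (\<Sum>i\<le>n. F z i ^ 2) / (\<Sum>i\<le>n. F z i ^ 2)"
      using pos [OF z] by (subst sum_divide_distrib) (simp add: power_divide)
    with pos [OF z] show ?thesis
      by (simp add: zsphere_def znormalize_def)
  qed
  ultimately show ?thesis
    unfolding homotopic_with_def prod_topology_subtopology_eu
    by (intro exI [of _ "\<lambda>z. znormalize n (F z)"]) auto
qed

text \<open>If \<open>G\<close> had no zero, the identity of the sphere would be null-homotopic: on
  the ellipsoid \<open>q x = R\<close> the position vector can be deformed linearly into
  \<open>G\<close>, and then the ellipsoid can be shrunk to the origin, ending in the constant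
  direction of \<open>G\<close> at 0. A level set of a quadratic form replaces the round sphere so
  that the energy of the problem can serve as \<open>q\<close>, with no comparison of norms.\<close>

proposition zero_of_coercive_vector_field:
  fixes G :: "(nat \<Rightarrow> real) \<Rightarrow> nat \<Rightarrow> real"
  assumes cont: "\<And>i. i \<le> n \<Longrightarrow> continuous_on UNIV (\<lambda>x. G x i)"
    and q_cont: "continuous_on UNIV q"
    and q_hom: "\<And>t x. q (\<lambda>i. t * x i) = t\<^sup>2 * q x"
    and q_pos: "\<And>x i. \<forall>i>n. x i = 0 \<Longrightarrow> x i \<noteq> 0 \<Longrightarrow> q x > 0"
    and R: "R > 0"
    and pos: "\<And>x. \<forall>i>n. x i = 0 \<Longrightarrow> q x = R \<Longrightarrow> (\<Sum>i\<le>n. G x i * x i) > 0"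
  shows "\<exists>x. (\<forall>i>n. x i = 0) \<and> (\<forall>i\<le>n. G x i = 0)"
proof (rule ccontr)
  assume "\<not> ?thesis"
  then have nz: "\<exists>i\<le>n. G x i \<noteq> 0" if "\<forall>i>n. x i = 0" for x
    using that by blast
  \<comment> \<open>\<open>\<rho> x\<close> rescales a point of the round sphere to the level set
    \<open>q = R\<close>; the square root reflects the homogeneity of degree two.\<close>
  define \<rho> where "\<rho> x = sqrt (R / q x)" for x
  have qS: "q x > 0" if x: "x \<in> zsphere n" for x
  proof -
    have "\<exists>i. x i \<noteq> 0"
    proof (rule ccontr)
      assume "\<not> (\<exists>i. x i \<noteq> 0)"
      then have "(\<Sum>i\<le>n. x i ^ 2) = 0" by simp
      with x show False by (simp add: zsphere_def)
    qed
    with x q_pos show ?thesis by (auto simp: zsphere_def)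
  qed
  have \<rho>: "\<rho> x > 0" if "x \<in> zsphere n" for x
    using qS [OF that] R by (simp add: \<rho>_def)
  have q\<rho>: "q (\<lambda>i. \<rho> x * x i) = R" if "x \<in> zsphere n" for x
    using qS [OF that] R by (simp add: \<rho>_def q_hom)
  have coord: "continuous_on T (\<lambda>x. x i)" for T :: "(nat \<Rightarrow> real) set" and i
    by (intro continuous_on_product_coordinates continuous_on_subset [OF continuous_on_product_coordinates]) auto
  have c\<rho>: "continuous_on (zsphere n) \<rho>"
    unfolding \<rho>_def
    by (intro continuous_intros continuous_on_subset [OF q_cont]) (use qS in fastforce)+
  have c\<rho>2: "continuous_on ({0..1::real} \<times> zsphere n) (\<lambda>z. \<rho> (snd z))"
    by (rule continuous_on_compose2 [OF c\<rho>]) (auto intro: continuous_on_snd continuous_on_id)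
  have csnd: "continuous_on ({0..1::real} \<times> zsphere n) (\<lambda>z. snd z i)" for i :: nat
    by (rule continuous_on_compose2 [OF coord]) (auto intro: continuous_on_snd continuous_on_id)
  have cG: "continuous_on ({0..1::real} \<times> zsphere n) (\<lambda>z. G (\<lambda>j. s z * (\<rho> (snd z) * snd z j)) i)"
    if "i \<le> n" "continuous_on ({0..1::real} \<times> zsphere n) s" for i and s :: "real \<times> (nat \<Rightarrow> real) \<Rightarrow> real"
    by (rule continuous_on_compose2 [OF cont [OF \<open>i \<le> n\<close>]])
      (auto intro!: continuous_on_coordinatewise_then_product continuous_intros c\<rho>2 csnd that)
  define F1 where "F1 = (\<lambda>z i. (1 - fst z) * (\<rho> (snd z) * snd z i) + fst z * G (\<lambda>j. \<rho> (snd z) * snd z j) i)"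
  define F2 where "F2 = (\<lambda>z. G (\<lambda>j. (1 - fst z) * (\<rho> (snd z) * snd z j)))"
  have h1: "homotopic_with_canon (\<lambda>_. True) (zsphere n) (zsphere n)
           (\<lambda>x. znormalize n (F1 (0, x))) (\<lambda>x. znormalize n (F1 (1, x)))"
  proof (rule znormalize_homotopy)
    show "continuous_on ({0..1::real} \<times> zsphere n) (\<lambda>z. F1 z i)" if "i \<le> n" for i
      unfolding F1_def using cG [OF that, of "\<lambda>_. 1"]
      by (auto intro!: continuous_intros c\<rho>2 csnd)
    fix z assume "z \<in> {0..1::real} \<times> zsphere n"
    then obtain t x where z: "z = (t, x)" and t: "0 \<le> t" "t \<le> 1" and x: "x \<in> zsphere n" by auto
    let ?y = "\<lambda>j. \<rho> x * x j"
    have G: "(\<Sum>i\<le>n. G ?y i * ?y i) > 0"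
      using x by (intro pos q\<rho>) (auto simp: zsphere_def)
    have y: "(\<Sum>i\<le>n. ?y i * ?y i) > 0"
    proof -
      have "(\<Sum>i\<le>n. ?y i * ?y i) = \<rho> x ^ 2 * (\<Sum>i\<le>n. x i ^ 2)"
        by (simp add: sum_distrib_left power2_eq_square mult_ac)
      then show ?thesis using x \<rho> [OF x] by (simp add: zsphere_def)
    qed
    \<comment> \<open>Pairing with the position vector separates the segment from 0: both of its
      endpoints have positive product with \<open>?y\<close>.\<close>
    have "(\<Sum>i\<le>n. F1 z i * ?y i) = (1 - t) * (\<Sum>i\<le>n. ?y i * ?y i) + t * (\<Sum>i\<le>n. G ?y i * ?y i)"
      by (simp add: F1_def z sum_distrib_left algebra_simps flip: sum.distrib)
    also have "\<dots> > 0"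
      using t G y by (cases "t = 0") (auto intro: add_nonneg_pos)
    finally show "\<exists>i\<le>n. F1 z i \<noteq> 0"
      by (metis (no_types, lifting) atMost_iff less_irrefl mult_zero_left sum.neutral)
  qed
  have h2: "homotopic_with_canon (\<lambda>_. True) (zsphere n) (zsphere n)
           (\<lambda>x. znormalize n (F2 (0, x))) (\<lambda>x. znormalize n (F2 (1, x)))"
  proof (rule znormalize_homotopy)
    show "continuous_on ({0..1::real} \<times> zsphere n) (\<lambda>z. F2 z i)" if "i \<le> n" for i
      unfolding F2_def by (intro cG that continuous_intros)
    \<comment> \<open>The second deformation sweeps the inside of the ellipsoid; it is here that
      \<open>G\<close> is assumed to have no zero at all.\<close>
    show "\<exists>i\<le>n. F2 z i \<noteq> 0" if "z \<in> {0..1::real} \<times> zsphere n" for z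
      unfolding F2_def using that by (intro nz) (auto simp: zsphere_def)
  qed
  have "znormalize n (F1 (0, x)) = x" if x: "x \<in> zsphere n" for x
  proof -
    have "(\<Sum>i\<le>n. (\<rho> x * x i)\<^sup>2) = (\<rho> x)\<^sup>2"
      using x by (simp add: power_mult_distrib flip: sum_distrib_left) (simp add: zsphere_def)
    then show ?thesis
      using x \<rho> [OF x] by (auto simp: znormalize_def F1_def zsphere_def fun_eq_iff)
  qed
  then have "homotopic_with_canon (\<lambda>_. True) (zsphere n) (zsphere n)
           id (\<lambda>x. znormalize n (F1 (1, x)))"
    by (intro homotopic_with_eq [OF h1]) auto
  moreover have "(\<lambda>x. znormalize n (F1 (1, x))) = (\<lambda>x. znormalize n (F2 (0, x)))"
    by (simp add: F1_def F2_def)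
  ultimately have "homotopic_with_canon (\<lambda>_. True) (zsphere n) (zsphere n)
           id (\<lambda>x. znormalize n (F2 (1, x)))"
    using h2 homotopic_with_trans by metis
  moreover have "(\<lambda>x. znormalize n (F2 (1, x))) = (\<lambda>x. znormalize n (G (\<lambda>_. 0)))"
    by (simp add: F2_def)
  ultimately show False
    using not_contractible_zsphere [of n] by (auto simp: contractible_def)
qed

subsection \<open>Galerkin problems\<close>

text \<open>Linearity relative to \<open>T\<close>: the forms will be composed with discrete
  operators, which are controlled only on the discrete space.\<close>

definition lin_on :: "'v::real_vector set \<Rightarrow> ('v \<Rightarrow> real) \<Rightarrow> bool" where
  "lin_on T f \<longleftrightarrow> (\<forall>u\<in>T. \<forall>v\<in>T. \<forall>s t. f (s *\<^sub>R u + t *\<^sub>R v) = s * f u + t * f v)"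

lemma lin_on_0:
  assumes "lin_on T f" "subspace T"
  shows "f 0 = 0"
  using assms(1) [unfolded lin_on_def, rule_format, of 0 0 0 0] subspace_0 [OF assms(2)] by simp

lemma lin_on_sum:
  assumes f: "lin_on T f" and T: "subspace T" and "finite I" "\<And>i. i \<in> I \<Longrightarrow> e i \<in> T"
  shows "f (\<Sum>i\<in>I. x i *\<^sub>R e i) = (\<Sum>i\<in>I. x i * f (e i))"
  using assms(3,4)
proof (induction I)
  case empty
  show ?case by (simp add: lin_on_0 [OF f T])
next
  case (insert i I)
  have "(\<Sum>i\<in>I. x i *\<^sub>R e i) \<in> T"
    using insert.prems by (intro subspace_sum T subspace_scale) auto
  with f insert.prems have "f (x i *\<^sub>R e i + 1 *\<^sub>R (\<Sum>i\<in>I. x i *\<^sub>R e i)) = x i * f (e i) + 1 * f (\<Sum>i\<in>I. x i *\<^sub>R e i)"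
    unfolding lin_on_def by blast
  with insert show ?case by simp
qed

text \<open>The vector field is the residual tested against a basis, and its pairing with the
  coordinates of \<open>u\<close> is \<open>a u u + b u u u - l u\<close>, where the middle term
  vanishes by \<open>b_0\<close>. The control of \<open>l\<close> is stated through the energy
  \<open>a u u\<close>, which also plays the part of the radius, so the abstract space carries no
  norm.\<close>

proposition galerkin_existence:
  fixes a :: "'v::real_vector \<Rightarrow> 'v \<Rightarrow> real"
  assumes T: "subspace T" and S: "finite S" "span S = T"
    and a: "\<And>w. w \<in> T \<Longrightarrow> lin_on T (\<lambda>u. a u w)" "\<And>u. u \<in> T \<Longrightarrow> lin_on T (a u)"
    and b: "\<And>v w. v \<in> T \<Longrightarrow> w \<in> T \<Longrightarrow> lin_on T (\<lambda>u. b u v w)"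
      "\<And>u w. u \<in> T \<Longrightarrow> w \<in> T \<Longrightarrow> lin_on T (\<lambda>v. b u v w)"
      "\<And>u v. u \<in> T \<Longrightarrow> v \<in> T \<Longrightarrow> lin_on T (b u v)"
    and l: "lin_on T l"
    and a_pos: "\<And>u. u \<in> T \<Longrightarrow> u \<noteq> 0 \<Longrightarrow> a u u > 0"
    and b_0: "\<And>u. u \<in> T \<Longrightarrow> b u u u = 0"
    and l_le: "\<And>u. u \<in> T \<Longrightarrow> (l u)\<^sup>2 \<le> K * a u u" and K: "K \<ge> 0"
  shows "\<exists>u\<in>T. \<forall>w\<in>T. a u w + b u u w = l w"
proof -
  obtain E where E: "E \<subseteq> T" "independent E" "T \<subseteq> span E"
    using maximal_independent_subset [of T] by force
  have finE: "finite E"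
    using real_vector.independent_span_bound [OF S(1) E(2)] E(1) S(2) by auto
  have spanE: "span E = T"
    using E T by (simp add: span_minimal subset_antisym)
  show ?thesis
  proof (cases "E = {}")
    case True
    then have "T = {0}" using spanE by simp
    then show ?thesis
      using lin_on_0 [OF a(2) T] lin_on_0 [OF b(3) T] lin_on_0 [OF l T] by auto
  next
    case False
    \<comment> \<open>\<open>zsphere n\<close> sits in a space of dimension \<open>n + 1\<close>,
      hence the shift by one; the trivial space has been treated apart.\<close>
    then obtain n where n: "card E = Suc n"
      using finE by (metis card_eq_0_iff not0_implies_Suc)
    have "{0..<card E} = {..n}" by (auto simp: n)
    then obtain e where e: "bij_betw e {..n} E"
      using ex_bij_betw_nat_finite [OF finE] by auto
    have eT: "e i \<in> T" if "i \<le> n" for i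
      using e E(1) that by (auto simp: bij_betw_def)
    define u where "u x = (\<Sum>i\<le>n. x i *\<^sub>R e i)" for x :: "nat \<Rightarrow> real"
    have uT: "u x \<in> T" for x
      unfolding u_def by (intro subspace_sum T subspace_scale eT) auto
    have lin: "f (u x) = (\<Sum>i\<le>n. x i * f (e i))" if "lin_on T f" for f x
      unfolding u_def by (rule lin_on_sum [OF that T]) (auto intro: eT)
    have nz: "u x \<noteq> 0" if x: "\<forall>i>n. x i = 0" "x i \<noteq> 0" for x i
    proof
      assume 0: "u x = 0"
      have i: "i \<le> n" using x by (meson not_le)
      \<comment> \<open>Coordinates are transported from indices to basis vectors, so that linear
        independence of \<open>E\<close> applies.\<close>
      define c where "c v = x (inv_into {..n} e v)" for v
      have "(\<Sum>v\<in>E. c v *\<^sub>R v) = (\<Sum>i\<le>n. c (e i) *\<^sub>R e i)"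
        by (rule sum.reindex_bij_betw [OF e, symmetric])
      also have "\<dots> = u x"
        unfolding u_def c_def using e by (intro sum.cong) (auto simp: bij_betw_def)
      finally have "c (e i) = 0"
        using independentD [OF E(2) finE order_refl, of c "e i"] 0 e i by (auto simp: bij_betw_def)
      with x e i show False by (auto simp: c_def bij_betw_def)
    qed
    define G where "G x i = a (u x) (e i) + b (u x) (u x) (e i) - l (e i)" for x i
    define q where "q x = a (u x) (u x)" for x
    have coord: "continuous_on UNIV (\<lambda>x::nat \<Rightarrow> real. x i)" for i
      by (intro continuous_on_product_coordinates)
    have G_eq: "G x i = (\<Sum>j\<le>n. x j * a (e j) (e i)) + (\<Sum>j\<le>n. x j * (\<Sum>k\<le>n. x k * b (e j) (e k) (e i))) - l (e i)"
      if i: "i \<le> n" for x i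
    proof -
      have "b (u x) (u x) (e i) = (\<Sum>j\<le>n. x j * b (e j) (u x) (e i))"
        by (intro lin b uT eT i)
      also have "\<dots> = (\<Sum>j\<le>n. x j * (\<Sum>k\<le>n. x k * b (e j) (e k) (e i)))"
        using lin [OF b(2) [OF eT eT [OF i]]] by simp
      finally show ?thesis
        using lin [OF a(1) [OF eT [OF i]]] by (simp add: G_def)
    qed
    have q_eq: "q x = (\<Sum>j\<le>n. x j * (\<Sum>k\<le>n. x k * a (e j) (e k)))" for x
      unfolding q_def using lin [OF a(1) [OF uT]] lin [OF a(2) [OF eT]] by simp
    have sum_G: "(\<Sum>i\<le>n. G x i * y i) = a (u x) (u y) + b (u x) (u x) (u y) - l (u y)" for x y
      unfolding lin [OF a(2) [OF uT]] lin [OF b(3) [OF uT uT]] lin [OF l] G_def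
      by (simp add: algebra_simps flip: sum.distrib sum_subtractf)
    have "\<exists>x. (\<forall>i>n. x i = 0) \<and> (\<forall>i\<le>n. G x i = 0)"
    \<comment> \<open>On the level \<open>K + 1\<close> the square of \<open>l\<close> is at most
      \<open>K * (K + 1) < (K + 1)\<^sup>2\<close>, so the energy beats \<open>l\<close>. Adding 1
      keeps the level positive when \<open>K = 0\<close>.\<close>
    proof (rule zero_of_coercive_vector_field [where q = q and R = "K + 1"])
      show "continuous_on UNIV (\<lambda>x. G x i)" if "i \<le> n" for i
        unfolding G_eq [OF that] by (intro continuous_intros coord)
      show "continuous_on UNIV q"
        unfolding q_eq [abs_def] by (intro continuous_intros coord)
      show "q (\<lambda>i. t * x i) = t\<^sup>2 * q x" for t x
        by (simp add: q_eq sum_distrib_left power2_eq_square mult_ac)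
      show "q x > 0" if "\<forall>i>n. x i = 0" "x i \<noteq> 0" for x i
        unfolding q_def using nz [OF that] uT by (intro a_pos)
      show "K + 1 > 0" using K by simp
      show "(\<Sum>i\<le>n. G x i * x i) > 0" if q: "q x = K + 1" for x
      proof -
        have "(l (u x))\<^sup>2 \<le> K * (K + 1)" using l_le [OF uT [of x]] q by (simp add: q_def)
        also have "\<dots> < (K + 1)\<^sup>2" using K by (simp add: power2_eq_square)
        finally have "\<bar>l (u x)\<bar> < K + 1"
          using K by (intro power2_less_imp_less [of "\<bar>l (u x)\<bar>"]) auto
        then show ?thesis using q b_0 [OF uT [of x]] by (simp add: sum_G q_def)
      qed
    qed
    then obtain x where x: "\<And>i. i \<le> n \<Longrightarrow> G x i = 0" by blast
    have "a (u x) w + b (u x) (u x) w = l w" if w: "w \<in> T" for w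
    proof -
      obtain c where "w = (\<Sum>v\<in>E. c v *\<^sub>R v)"
        using w spanE real_vector.span_finite [OF finE] by auto
      also have "\<dots> = u (\<lambda>i. c (e i))"
        unfolding u_def by (rule sum.reindex_bij_betw [OF e, symmetric])
      finally have "w = u (\<lambda>i. c (e i))" .
      with sum_G [of x "\<lambda>i. c (e i)"] x show ?thesis by simp
    qed
    with uT show ?thesis by blast
  qed
qed

subsection \<open>Test functions\<close>

lemma partial_deriv_eq:
  assumes "(f has_derivative f') (at x)"
  shows "partial_deriv i f x = f' (axis i 1)"
  using frechet_derivative_at [OF assms] by (simp add: partial_deriv_def)

lemma partial_deriv_lincomb:
  fixes f g :: "real ^ 'n::finite \<Rightarrow> real"
  assumes "f differentiable (at x)" "g differentiable (at x)"
  shows "partial_deriv i (\<lambda>x. a * f x + b * g x) x = a * partial_deriv i f x + b * partial_deriv i g x"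
proof -
  have "((\<lambda>x. a * f x + b * g x) has_derivative
     (\<lambda>h. a * frechet_derivative f (at x) h + b * frechet_derivative g (at x) h)) (at x)"
    using assms by (auto intro!: derivative_eq_intros simp: frechet_derivative_works)
  from partial_deriv_eq [OF this] show ?thesis by (simp add: partial_deriv_def)
qed

lemma partial_deriv_mult:
  fixes f g :: "real ^ 'n::finite \<Rightarrow> real"
  assumes "f differentiable (at x)" "g differentiable (at x)"
  shows "partial_deriv i (\<lambda>x. f x * g x) x = f x * partial_deriv i g x + partial_deriv i f x * g x"
proof -
  have "((\<lambda>x. f x * g x) has_derivative
     (\<lambda>h. f x * frechet_derivative g (at x) h + frechet_derivative f (at x) h * g x)) (at x)"
    using assms by (auto intro!: derivative_eq_intros simp: frechet_derivative_works)
  from partial_deriv_eq [OF this] show ?thesis by (simp add: partial_deriv_def)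
qed

lemma partial_deriv_shift:
  fixes f :: "real ^ 'n::finite \<Rightarrow> real"
  assumes "f differentiable (at (x + v))"
  shows "partial_deriv i (\<lambda>x. f (x + v)) x = partial_deriv i f (x + v)"
proof -
  have "(f has_derivative frechet_derivative f (at (x + v))) (at (x + v))"
    using assms by (simp add: frechet_derivative_works)
  from has_derivative_compose [OF has_derivative_add_const [OF has_derivative_ident, of v] this]
  have "((\<lambda>x. f (x + v)) has_derivative frechet_derivative f (at (x + v))) (at x)"
    by simp
  from partial_deriv_eq [OF this] show ?thesis by (simp add: partial_deriv_def)
qed

lemma Ck_SucD: "Ck (Suc m) f \<Longrightarrow> Ck m f"
proof (induction m arbitrary: f)
  case 0
  then show ?case
    by (auto intro!: differentiable_imp_continuous_on simp: differentiable_on_def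
        intro: differentiable_at_withinI)
next
  case (Suc m)
  then show ?case by (metis Ck.simps(2))
qed

lemma Ck_lincomb: "Ck m f \<Longrightarrow> Ck m g \<Longrightarrow> Ck m (\<lambda>x. a * f x + b * g x)"
proof (induction m arbitrary: f g)
  case (Suc m)
  then have "partial_deriv i (\<lambda>x. a * f x + b * g x)
      = (\<lambda>x. a * partial_deriv i f x + b * partial_deriv i g x)" for i
    by (auto simp: partial_deriv_lincomb)
  with Suc show ?case by auto
qed (auto intro!: continuous_intros)

text \<open>Each term of the product rule keeps one factor undifferentiated; \<open>Ck_SucD\<close>
  lowers its order from \<open>Suc m\<close> to \<open>m\<close> so that the induction hypothesis
  applies.\<close>

lemma Ck_mult: "Ck m f \<Longrightarrow> Ck m g \<Longrightarrow> Ck m (\<lambda>x. f x * g x)"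
proof (induction m arbitrary: f g)
  case (Suc m)
  \<comment> \<open>The factors 1 bring the product rule into the shape of
    \<open>Ck_lincomb\<close>.\<close>
  then have eq: "partial_deriv i (\<lambda>x. f x * g x)
      = (\<lambda>x. 1 * (f x * partial_deriv i g x) + 1 * (partial_deriv i f x * g x))" for i
    by (auto simp: partial_deriv_mult)
  have "Ck m (\<lambda>x. f x * partial_deriv i g x)" "Ck m (\<lambda>x. partial_deriv i f x * g x)" for i
    using Suc.prems Suc.prems [THEN Ck_SucD] by (auto intro: Suc.IH)
  then have "Ck m (partial_deriv i (\<lambda>x. f x * g x))" for i
    unfolding eq by (intro Ck_lincomb)
  with Suc.prems show ?case by auto
qed (auto intro!: continuous_intros)

lemma Ck_const: "Ck m (\<lambda>_. c)"
proof (induction m arbitrary: c)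
  case (Suc m)
  have "partial_deriv i (\<lambda>_. c) = (\<lambda>_. 0)" for i :: 'a
    by (auto simp: fun_eq_iff intro!: partial_deriv_eq)
  with Suc show ?case by simp
qed auto

lemma Ck_prod:
  assumes "finite I" "\<And>i. i \<in> I \<Longrightarrow> Ck m (f i)"
  shows "Ck m (\<lambda>x. \<Prod>i\<in>I. f i x)"
  using assms by (induction I) (auto intro: Ck_const Ck_mult)

lemma Ck_shift: "Ck m f \<Longrightarrow> Ck m (\<lambda>x. f (x + v))"
proof (induction m arbitrary: f)
  case 0
  then show ?case by (auto intro!: continuous_on_compose2 [of UNIV f] continuous_intros)
next
  case (Suc m)
  then have "partial_deriv i (\<lambda>x. f (x + v)) = (\<lambda>x. partial_deriv i f (x + v))" for i
    by (auto simp: partial_deriv_shift)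
  moreover have "(\<lambda>x. f (x + v)) differentiable (at x)" for x
    using Suc.prems differentiable_compose [of f "\<lambda>x. x + v" x UNIV] by simp
  moreover have "Ck m (\<lambda>x. partial_deriv i f (x + v))" for i
    using Suc.prems by (intro Suc.IH) simp
  ultimately show ?case by simp
qed

section \<open>Smooth bump functions on boxes\<close>

definition flat_exp :: "real poly \<Rightarrow> real \<Rightarrow> real" where
  "flat_exp p t = (if t > 0 then poly p (1 / t) * exp (- (1 / t)) else 0)"

lemma poly_exp_tendsto_0: "((\<lambda>y. poly p y * exp (- y)) \<longlongrightarrow> (0::real)) at_top"
proof -
  have "((\<lambda>y. \<Sum>i\<le>degree p. Polynomial.coeff p i * (y ^ i / exp y)) \<longlongrightarrow> (\<Sum>i\<le>degree p. Polynomial.coeff p i * 0)) at_top"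
    by (intro tendsto_sum tendsto_mult tendsto_const tendsto_power_div_exp_0)
  then show ?thesis
    by (simp add: poly_altdef sum_distrib_right exp_minus divide_inverse mult.assoc)
qed

text \<open>The functions \<open>poly p (1 / t) * exp (- (1 / t))\<close>, extended by 0, form a
  family closed under differentiation, which is why \<open>flat_exp\<close> carries an arbitrary
  polynomial. The inner derivative contributes \<open>1 / t\<^sup>2\<close>, encoded as
  \<open>[:0, 0, 1:]\<close>, and \<open>p - pderiv p\<close> collects the derivatives of the
  exponential and of \<open>p\<close>.\<close>

lemma has_real_derivative_flat_exp:
  "(flat_exp p has_real_derivative flat_exp ((p - pderiv p) * [:0, 0, 1:]) t) (at t)"
proof -
  consider "t > 0" | "t < 0" | "t = 0" by linarith
  then show ?thesis
  proof cases
    case 1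
    have "((\<lambda>t. poly p (1 / t) * exp (- (1 / t))) has_real_derivative
        flat_exp ((p - pderiv p) * [:0, 0, 1:]) t) (at t)"
      using 1 by (auto intro!: derivative_eq_intros DERIV_chain' [OF _ poly_DERIV]
        simp: flat_exp_def power2_eq_square field_simps)
    then show ?thesis
      by (rule has_field_derivative_transform_within_open [of _ _ _ "{0<..}"])
        (use 1 in \<open>auto simp: flat_exp_def\<close>)
  next
    case 2
    have "((\<lambda>t. 0) has_real_derivative flat_exp ((p - pderiv p) * [:0, 0, 1:]) t) (at t)"
      using 2 by (simp add: flat_exp_def)
    then show ?thesis
      by (rule has_field_derivative_transform_within_open [of _ _ _ "{..<0}"])
        (use 2 in \<open>auto simp: flat_exp_def\<close>)
  next
    case 3
    \<comment> \<open>For \<open>h > 0\<close> the difference quotient at 0 is of the same kind,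
      with \<open>p\<close> multiplied by the variable: this is \<open>pCons 0 p\<close>.\<close>
    have "((\<lambda>h. poly (pCons 0 p) (inverse h) * exp (- (inverse h))) \<longlongrightarrow> 0) (at_right 0)"
      by (rule filterlim_compose [OF poly_exp_tendsto_0 filterlim_inverse_at_top_right])
    then have "((\<lambda>h. flat_exp p h / h) \<longlongrightarrow> 0) (at_right 0)"
      by (rule Lim_transform_eventually)
        (auto simp: eventually_at_filter flat_exp_def field_simps)
    moreover have "((\<lambda>h. flat_exp p h / h) \<longlongrightarrow> 0) (at_left 0)"
      by (rule tendsto_eventually) (auto simp: eventually_at_filter flat_exp_def)
    ultimately have "((\<lambda>h. flat_exp p h / h) \<longlongrightarrow> 0) (at 0)"
      by (simp add: filterlim_split_at)
    then show ?thesis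
      using 3 by (simp add: has_field_derivative_iff flat_exp_def)
  qed
qed

lemma Ck_flat_exp: "Ck m (\<lambda>x::real ^ 'n::finite. flat_exp p (c * x $ i + d))"
proof (induction m arbitrary: p)
  case 0
  have "continuous_on UNIV (flat_exp p)"
    using has_real_derivative_flat_exp by (meson DERIV_continuous_on has_field_derivative_at_within)
  then show ?case
    by (auto intro!: continuous_on_compose2 [of UNIV "flat_exp p"] continuous_intros)
next
  case (Suc m)
  let ?q = "(p - pderiv p) * [:0, 0, 1:]"
  have "((\<lambda>x::real ^ 'n. c * x $ i + d) has_derivative (\<lambda>h. c * h $ i)) (at x)" for x
    by (intro has_derivative_add_const has_derivative_mult_right bounded_linear_imp_has_derivative
        bounded_linear_vec_nth)
  from has_derivative_compose [OF this has_real_derivative_flat_exp [unfolded has_field_derivative_def]]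
  have d: "((\<lambda>x::real ^ 'n. flat_exp p (c * x $ i + d)) has_derivative
      (\<lambda>h. flat_exp ?q (c * x $ i + d) * (c * h $ i))) (at x)" for x .
  \<comment> \<open>The summand \<open>0 * 0\<close> again produces the shape of
    \<open>Ck_lincomb\<close>, with the zero function as second argument.\<close>
  have "partial_deriv j (\<lambda>x::real ^ 'n. flat_exp p (c * x $ i + d))
     = (\<lambda>x. (if i = j then c else 0) * flat_exp ?q (c * x $ i + d) + 0 * 0)" for j
    by (auto simp: fun_eq_iff axis_def partial_deriv_eq [OF d])
  moreover have "Ck m (\<lambda>x::real ^ 'n. (if i = j then c else 0) * flat_exp ?q (c * x $ i + d) + 0 * 0)" for j
    by (intro Ck_lincomb Suc.IH Ck_const)
  ultimately show ?case
    using d by (auto simp: differentiable_def simp del: mult_zero_left)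
qed

text \<open>The two factors per coordinate vanish up to the face at \<open>a\<close> and from the
  face at \<open>b\<close> on. The parameter \<open>s\<close> is a steepness: as it grows, every
  factor tends to 1 inside the box. The affine arguments are spelled out in the form that
  \<open>Ck_flat_exp\<close> expects.\<close>

definition box_bump :: "real ^ 'n::finite \<Rightarrow> real ^ 'n \<Rightarrow> real \<Rightarrow> real ^ 'n \<Rightarrow> real" where
  "box_bump a b s x = (\<Prod>i\<in>UNIV. flat_exp 1 (s * x $ i + - (s * a $ i)) * flat_exp 1 (- s * x $ i + s * b $ i))"

lemma flat_exp_1_bounds: "0 \<le> flat_exp 1 t" "flat_exp 1 t \<le> 1"
  by (auto simp: flat_exp_def)

lemma box_bump_bounds: "0 \<le> box_bump a b s x" "box_bump a b s x \<le> 1"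
  unfolding box_bump_def
  by (auto intro!: prod_nonneg prod_le_1 mult_nonneg_nonneg mult_le_one flat_exp_1_bounds)

lemma box_bump_outside:
  assumes "s > 0" "x \<notin> box a b"
  shows "box_bump a b s x = 0"
proof -
  obtain i where "x $ i \<le> a $ i \<or> b $ i \<le> x $ i"
    using assms by (auto simp: mem_box_cart not_less)
  then have "s * x $ i + - (s * a $ i) \<le> 0 \<or> - s * x $ i + s * b $ i \<le> 0"
    using assms by auto
  then have "\<exists>i\<in>UNIV. flat_exp 1 (s * x $ i + - (s * a $ i)) * flat_exp 1 (- s * x $ i + s * b $ i) = 0"
    by (intro bexI [of _ i]) (auto simp: flat_exp_def)
  then show ?thesis
    unfolding box_bump_def by (subst prod_zero_iff) auto
qed

lemma box_bump_test:
  assumes "s > 0" "cbox a b \<subseteq> \<Omega>"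
  shows "box_bump a b s \<in> test_functions \<Omega>"
proof -
  have "Ck m (box_bump a b s)" for m
    unfolding box_bump_def [abs_def] by (intro Ck_prod Ck_mult Ck_flat_exp) auto
  moreover have "x \<notin> cbox a b \<Longrightarrow> box_bump a b s x = 0" for x
    using assms box_subset_cbox [of a b] by (intro box_bump_outside) auto
  ultimately show ?thesis
    using assms unfolding test_functions_def by (blast intro: compact_cbox)
qed

lemma box_bump_tendsto: "(\<lambda>n. box_bump a b (real (Suc n)) x) \<longlonglongrightarrow> indicator (box a b) x"
proof (cases "x \<in> box a b")
  case True
  have e: "(\<lambda>n. flat_exp 1 (real (Suc n) * c)) \<longlonglongrightarrow> 1" if "c > 0" for c
  proof -
    have "(\<lambda>n. exp (- (1 / c * (1 / real (Suc n))))) \<longlonglongrightarrow> exp (- (1 / c * 0))"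
      by (intro tendsto_intros LIMSEQ_Suc [OF lim_1_over_n])
    moreover have "flat_exp 1 (real (Suc n) * c) = exp (- (1 / c * (1 / real (Suc n))))" for n
      using that by (simp add: flat_exp_def zero_less_mult_iff mult.commute del: of_nat_Suc)
    ultimately show ?thesis by simp
  qed
  have *: "box_bump a b s x = (\<Prod>i\<in>UNIV. flat_exp 1 (s * (x $ i - a $ i)) * flat_exp 1 (s * (b $ i - x $ i)))" for s
    by (simp add: box_bump_def algebra_simps)
  have "(\<lambda>n. box_bump a b (real (Suc n)) x) \<longlonglongrightarrow> (\<Prod>i\<in>(UNIV::'a set). 1 * 1)"
    unfolding * using True by (intro tendsto_prod tendsto_mult e) (auto simp: mem_box_cart)
  with True show ?thesis by simp
next
  case False
  then show ?thesis by (simp add: box_bump_outside)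
qed

subsection \<open>Integration by parts for test functions\<close>

lemma test_functionsD:
  assumes "\<psi> \<in> test_functions \<Omega>"
  shows "Ck m \<psi>" "\<psi> differentiable (at x)" "continuous_on UNIV \<psi>"
proof -
  have C: "Ck m \<psi>" for m
    using assms by (auto simp: test_functions_def)
  show "Ck m \<psi>" "\<psi> differentiable (at x)" "continuous_on UNIV \<psi>"
    using C [of m] C [of 0] C [of "Suc 0"] by auto
qed

lemma test_functions_support:
  assumes "\<psi> \<in> test_functions \<Omega>"
  shows "\<exists>K. compact K \<and> K \<subseteq> \<Omega> \<and> (\<forall>x. x \<notin> K \<longrightarrow> \<psi> x = 0)"
  using assms unfolding test_functions_def by blast

lemma test_functions_mono: "\<Omega> \<subseteq> \<Omega>' \<Longrightarrow> test_functions \<Omega> \<subseteq> test_functions \<Omega>'"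
  by (auto simp: test_functions_def)

lemma test_functions_lincomb:
  assumes "\<psi> \<in> test_functions \<Omega>" "\<eta> \<in> test_functions \<Omega>"
  shows "(\<lambda>x. a * \<psi> x + b * \<eta> x) \<in> test_functions \<Omega>"
proof -
  from assms obtain K K' where "compact K" "K \<subseteq> \<Omega>" "\<forall>x. x \<notin> K \<longrightarrow> \<psi> x = 0"
    "compact K'" "K' \<subseteq> \<Omega>" "\<forall>x. x \<notin> K' \<longrightarrow> \<eta> x = 0" "\<forall>m. Ck m \<psi>" "\<forall>m. Ck m \<eta>"
    by (auto simp: test_functions_def)
  then show ?thesis
    by (auto simp: test_functions_def intro!: Ck_lincomb exI [of _ "K \<union> K'"] compact_Un)
qed

lemma test_functions_mult:
  assumes "\<psi> \<in> test_functions \<Omega>" "\<eta> \<in> test_functions \<Omega>"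
  shows "(\<lambda>x. \<psi> x * \<eta> x) \<in> test_functions \<Omega>"
  using assms by (auto simp: test_functions_def intro!: Ck_mult)

lemma test_functions_zero: "(\<lambda>_. 0) \<in> test_functions \<Omega>"
  by (auto simp: test_functions_def intro!: Ck_const exI [of _ "{}"])

lemma test_functions_shift:
  assumes "\<psi> \<in> test_functions UNIV"
  shows "(\<lambda>x. \<psi> (x + v)) \<in> test_functions UNIV"
proof -
  from assms obtain K where K: "compact K" "\<forall>x. x \<notin> K \<longrightarrow> \<psi> x = 0" "\<forall>m. Ck m \<psi>"
    by (auto simp: test_functions_def)
  have "compact ((\<lambda>x. - v + x) ` K)"
    using K by (rule_tac compact_translation)
  moreover have "x \<notin> (\<lambda>x. - v + x) ` K \<longrightarrow> \<psi> (x + v) = 0" for x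
    using K by (auto simp: image_iff) (metis add.commute add_diff_cancel uminus_add_conv_diff)
  ultimately show ?thesis
    using K by (auto simp: test_functions_def intro: Ck_shift)
qed

text \<open>\<open>K\<close> is closed, so off \<open>K\<close> the function vanishes in a whole
  neighbourhood and so does its derivative: the same \<open>K\<close> serves.\<close>

lemma test_functions_partial_deriv:
  assumes "\<psi> \<in> test_functions \<Omega>"
  shows "partial_deriv i \<psi> \<in> test_functions \<Omega>"
proof -
  obtain K where K: "compact K" "K \<subseteq> \<Omega>" "\<forall>x. x \<notin> K \<longrightarrow> \<psi> x = 0"
    using test_functions_support [OF assms] by blast
  have "partial_deriv i \<psi> x = 0" if "x \<notin> K" for x
  proof -
    have "((\<lambda>_. 0) has_derivative (\<lambda>_. 0)) (at x)" by simp
    then have "(\<psi> has_derivative (\<lambda>_. 0)) (at x)"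
      by (rule has_derivative_transform_within_open [of _ _ _ _ "- K"])
        (use K that in \<open>auto intro: open_Compl compact_imp_closed\<close>)
    then show ?thesis by (rule partial_deriv_eq)
  qed
  moreover have "Ck m (partial_deriv i \<psi>)" for m
    using test_functionsD(1) [OF assms, of "Suc m"] by simp
  ultimately show ?thesis
    using K unfolding test_functions_def by blast
qed

lemma test_function_bounded:
  assumes "\<psi> \<in> test_functions \<Omega>"
  obtains M where "\<And>x. \<bar>\<psi> x\<bar> \<le> M"
proof -
  obtain K where K: "compact K" "K \<subseteq> \<Omega>" "\<forall>x. x \<notin> K \<longrightarrow> \<psi> x = 0"
    using test_functions_support [OF assms] by blast
  have "bounded (\<psi> ` K)"
    by (intro compact_imp_bounded compact_continuous_image K continuous_on_subset [OF test_functionsD(3) [OF assms]]) simp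
  then obtain M where "\<forall>x\<in>K. norm (\<psi> x) \<le> M" by (auto simp: bounded_iff)
  then have "\<bar>\<psi> x\<bar> \<le> \<bar>M\<bar>" for x
    using K(3) abs_ge_self [of M] by (cases "x \<in> K") (fastforce, simp)
  then show ?thesis by (rule that)
qed

lemma test_function_measurable:
  "\<psi> \<in> test_functions \<Omega> \<Longrightarrow> \<psi> \<in> borel_measurable borel"
  by (intro borel_measurable_continuous_onI test_functionsD)

lemma test_function_integrable:
  assumes "\<psi> \<in> test_functions \<Omega>"
  shows "integrable lborel \<psi>"
proof -
  obtain K where K: "compact K" "K \<subseteq> \<Omega>" "\<forall>x. x \<notin> K \<longrightarrow> \<psi> x = 0"
    using test_functions_support [OF assms] by blast
  have "integrable lborel (\<lambda>x. indicator K x *\<^sub>R \<psi> x)"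
    by (intro borel_integrable_compact K continuous_on_subset [OF test_functionsD(3) [OF assms]]) simp
  also have "(\<lambda>x. indicator K x *\<^sub>R \<psi> x) = \<psi>"
    using K by (auto simp: fun_eq_iff indicator_def)
  finally show ?thesis .
qed

text \<open>Extension by zero moves the integral to \<open>lborel\<close>, where translation
  invariance is available.\<close>

lemma test_function_integral:
  assumes "\<psi> \<in> test_functions \<Omega>" "open \<Omega>"
  shows "(\<integral>x. \<psi> x \<partial>lebesgue_on \<Omega>) = (\<integral>x. \<psi> x \<partial>lborel)"
proof -
  have "(\<integral>x. \<psi> x \<partial>lebesgue_on \<Omega>) = (\<integral>x. indicator \<Omega> x *\<^sub>R \<psi> x \<partial>lebesgue)"
    using assms by (intro integral_restrict_space) auto
  also have "(\<lambda>x. indicator \<Omega> x *\<^sub>R \<psi> x) = \<psi>"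
    using assms by (auto simp: test_functions_def fun_eq_iff indicator_def)
  also have "(\<integral>x. \<psi> x \<partial>lebesgue) = (\<integral>x. \<psi> x \<partial>lborel)"
    using test_function_measurable [OF assms(1)] by (intro integral_completion) auto
  finally show ?thesis .
qed

lemma integral_lborel_shift:
  fixes f :: "'a::euclidean_space \<Rightarrow> real"
  assumes "f \<in> borel_measurable borel"
  shows "(\<integral>x. f (x + v) \<partial>lborel) = (\<integral>x. f x \<partial>lborel)"
proof -
  have "(\<integral>x. f x \<partial>lborel) = (\<integral>x. f x \<partial>distr lborel borel ((+) v))"
    by (simp add: lborel_distr_plus)
  also have "\<dots> = (\<integral>x. f (v + x) \<partial>lborel)"
    using assms by (intro integral_distr) auto
  finally show ?thesis by (simp add: add.commute)
qed

section \<open>Difference quotients and integration by parts\<close>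

definition diff_quot :: "'n \<Rightarrow> nat \<Rightarrow> (real ^ 'n::finite \<Rightarrow> real) \<Rightarrow> real ^ 'n \<Rightarrow> real" where
  "diff_quot i n \<psi> x = real (Suc n) * \<psi> (x + (1 / real (Suc n)) *\<^sub>R axis i 1) + (- real (Suc n)) * \<psi> x"

lemma diff_quot_test: "\<psi> \<in> test_functions UNIV \<Longrightarrow> diff_quot i n \<psi> \<in> test_functions UNIV"
  unfolding diff_quot_def [abs_def] by (rule test_functions_lincomb [OF test_functions_shift])

lemma partial_deriv_diff_quot:
  assumes "\<psi> \<in> test_functions UNIV"
  shows "partial_deriv j (diff_quot i n \<psi>) x = diff_quot i n (partial_deriv j \<psi>) x"
  unfolding diff_quot_def [abs_def]
  using test_functionsD(2) [OF assms] test_functionsD(2) [OF test_functions_shift [OF assms]]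
  by (simp add: partial_deriv_lincomb partial_deriv_shift)

lemma partial_deriv_line:
  assumes "\<psi> differentiable (at (x + s *\<^sub>R axis i 1))"
  shows "((\<lambda>s. \<psi> (x + s *\<^sub>R axis i 1)) has_real_derivative partial_deriv i \<psi> (x + s *\<^sub>R axis i 1)) (at s)"
proof -
  let ?D = "frechet_derivative \<psi> (at (x + s *\<^sub>R axis i 1))"
  have D: "(\<psi> has_derivative ?D) (at (x + s *\<^sub>R axis i 1))"
    using assms by (simp add: frechet_derivative_works)
  have "((\<lambda>s. x + s *\<^sub>R axis i 1) has_derivative (\<lambda>h. h *\<^sub>R axis i 1)) (at s)"
    by (auto intro!: derivative_eq_intros)
  from has_derivative_compose [OF this D]
  have "((\<lambda>s. \<psi> (x + s *\<^sub>R axis i 1)) has_derivative (\<lambda>h. ?D (h *\<^sub>R axis i 1))) (at s)" .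
  moreover have "(\<lambda>h. ?D (h *\<^sub>R axis i 1)) = (*) (partial_deriv i \<psi> (x + s *\<^sub>R axis i 1))"
    using linear_frechet_derivative [OF assms]
    by (auto simp: fun_eq_iff partial_deriv_def linear_cmul)
  ultimately show ?thesis
    by (simp add: has_field_derivative_def)
qed

lemma diff_quot_tendsto:
  assumes "\<psi> \<in> test_functions UNIV"
  shows "(\<lambda>n. diff_quot i n \<psi> x) \<longlonglongrightarrow> partial_deriv i \<psi> x"
proof -
  have "((\<lambda>s. \<psi> (x + s *\<^sub>R axis i 1)) has_real_derivative partial_deriv i \<psi> x) (at 0)"
    using partial_deriv_line [of \<psi> x 0 i] test_functionsD(2) [OF assms] by simp
  then have "((\<lambda>h. (\<psi> (x + h *\<^sub>R axis i 1) - \<psi> x) / h) \<longlongrightarrow> partial_deriv i \<psi> x) (at 0)"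
    by (simp add: has_field_derivative_iff)
  moreover have "filterlim (\<lambda>n. 1 / real (Suc n)) (at 0) sequentially"
    by (intro filterlim_atI LIMSEQ_Suc [OF lim_1_over_n]) auto
  ultimately have "(\<lambda>n. (\<psi> (x + (1 / real (Suc n)) *\<^sub>R axis i 1) - \<psi> x) / (1 / real (Suc n)))
      \<longlonglongrightarrow> partial_deriv i \<psi> x"
    by (rule filterlim_compose)
  then show ?thesis
    by (simp add: diff_quot_def algebra_simps)
qed

text \<open>The mean value theorem along the line through \<open>x\<close> in direction
  \<open>i\<close>. What matters is that the bound does not depend on \<open>n\<close>, as dominated
  convergence requires.\<close>

lemma diff_quot_bounded:
  assumes "\<psi> \<in> test_functions UNIV" "\<And>y. \<bar>partial_deriv i \<psi> y\<bar> \<le> M"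
  shows "\<bar>diff_quot i n \<psi> x\<bar> \<le> M"
proof -
  let ?h = "1 / real (Suc n)"
  have "\<exists>z>0. z < ?h \<and> \<psi> (x + ?h *\<^sub>R axis i 1) - \<psi> (x + 0 *\<^sub>R axis i 1)
      = (?h - 0) * partial_deriv i \<psi> (x + z *\<^sub>R axis i 1)"
    by (intro MVT2 partial_deriv_line test_functionsD(2) [OF assms(1)]) auto
  then obtain z where "\<psi> (x + ?h *\<^sub>R axis i 1) - \<psi> x = ?h * partial_deriv i \<psi> (x + z *\<^sub>R axis i 1)"
    by auto
  then have "diff_quot i n \<psi> x = partial_deriv i \<psi> (x + z *\<^sub>R axis i 1)"
    by (simp add: diff_quot_def field_simps)
  with assms(2) show ?thesis by simp
qed

text \<open>\<open>\<eta>\<close> is only continuous so that the constant 1 is admissible, which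
  turns the limit into a statement on the integral of a single derivative.\<close>

lemma integral_diff_quot_tendsto:
  fixes \<eta> :: "real ^ 'n::finite \<Rightarrow> real"
  assumes \<psi>: "\<psi> \<in> test_functions UNIV" and \<eta>: "continuous_on UNIV \<eta>"
  shows "(\<lambda>n. \<integral>x. diff_quot i n \<psi> x * \<eta> x \<partial>lborel) \<longlonglongrightarrow> (\<integral>x. partial_deriv i \<psi> x * \<eta> x \<partial>lborel)"
proof -
  obtain K where K: "compact K" "K \<subseteq> UNIV" "\<forall>x. x \<notin> K \<longrightarrow> \<psi> x = 0"
    using test_functions_support [OF \<psi>] by blast
  obtain R where R: "\<And>x. x \<in> K \<Longrightarrow> norm x \<le> R"
    using compact_imp_bounded [OF K(1)] by (auto simp: bounded_iff)
  obtain M where M: "\<And>y. \<bar>partial_deriv i \<psi> y\<bar> \<le> M"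
    using test_function_bounded test_functions_partial_deriv \<psi> by metis
  \<comment> \<open>All steps have length at most 1, so every quotient vanishes outside this
    ball.\<close>
  let ?K = "cball 0 (R + 1) :: (real ^ 'n) set"
  have supp: "diff_quot i n \<psi> x = 0" if "x \<notin> ?K" for n x
  proof -
    define v :: "real ^ 'n" where "v = (1 / real (Suc n)) *\<^sub>R axis i 1" 
    have "norm v \<le> 1" by (simp add: v_def field_simps)
    moreover have "norm x \<le> norm (x + v) + norm v"
      using norm_triangle_ineq4 [of "x + v" "v"] by simp
    ultimately have "x \<notin> K" "x + v \<notin> K"
      using that R [of x] R [of "x + v"] by auto
    with K show ?thesis by (simp add: diff_quot_def v_def del: of_nat_Suc)
  qed
  have dom: "integrable lborel (\<lambda>x. indicator ?K x *\<^sub>R (M * \<bar>\<eta> x\<bar>))"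
    by (intro borel_integrable_compact continuous_intros continuous_on_subset [OF \<eta>]) auto
  show ?thesis
  proof (rule integral_dominated_convergence [OF _ _ dom])
    show "(\<lambda>x. partial_deriv i \<psi> x * \<eta> x) \<in> borel_measurable lborel"
      "(\<lambda>x. diff_quot i n \<psi> x * \<eta> x) \<in> borel_measurable lborel" for n
      using \<eta> test_functionsD(3) [OF test_functions_partial_deriv [OF \<psi>]] test_functionsD(3) [OF diff_quot_test [OF \<psi>]]
      by (auto intro!: borel_measurable_continuous_onI continuous_intros)
    show "AE x in lborel. (\<lambda>n. diff_quot i n \<psi> x * \<eta> x) \<longlonglongrightarrow> partial_deriv i \<psi> x * \<eta> x"
      by (intro AE_I2 tendsto_intros diff_quot_tendsto \<psi>)
    show "AE x in lborel. norm (diff_quot i n \<psi> x * \<eta> x) \<le> indicator ?K x *\<^sub>R (M * \<bar>\<eta> x\<bar>)" for n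
    proof (rule AE_I2)
      fix x
      show "norm (diff_quot i n \<psi> x * \<eta> x) \<le> indicator ?K x *\<^sub>R (M * \<bar>\<eta> x\<bar>)"
        using supp [of x n] diff_quot_bounded [OF \<psi> M, of n x]
        by (cases "x \<in> ?K") (auto simp: abs_mult intro!: mult_right_mono)
    qed
  qed
qed

text \<open>Each difference quotient has integral 0 by translation invariance, and the limit
  inherits this. Applied to a product, it yields integration by parts without iterated
  integrals.\<close>

lemma integral_partial_deriv_test:
  assumes "\<psi> \<in> test_functions UNIV"
  shows "(\<integral>x. partial_deriv i \<psi> x \<partial>lborel) = 0"
proof -
  have "(\<integral>x. diff_quot i n \<psi> x * 1 \<partial>lborel) = 0" for n
    using test_function_integrable [OF assms] test_function_integrable [OF test_functions_shift [OF assms]]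
      integral_lborel_shift [OF test_function_measurable [OF assms]]
    by (simp add: diff_quot_def distrib_right left_diff_distrib)
  with integral_diff_quot_tendsto [OF assms continuous_on_const [of _ 1], of i] show ?thesis
    by (simp add: LIMSEQ_const_iff)
qed

lemma integral_by_parts_test:
  assumes "\<psi> \<in> test_functions UNIV" "\<eta> \<in> test_functions UNIV"
  shows "(\<integral>x. partial_deriv i \<psi> x * \<eta> x \<partial>lborel) = - (\<integral>x. \<psi> x * partial_deriv i \<eta> x \<partial>lborel)"
proof -
  have "0 = (\<integral>x. partial_deriv i (\<lambda>x. \<psi> x * \<eta> x) x \<partial>lborel)"
    using integral_partial_deriv_test test_functions_mult assms by metis
  also have "\<dots> = (\<integral>x. \<psi> x * partial_deriv i \<eta> x + partial_deriv i \<psi> x * \<eta> x \<partial>lborel)"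
    using assms [THEN test_functionsD(2)] by (simp add: partial_deriv_mult)
  also have "\<dots> = (\<integral>x. \<psi> x * partial_deriv i \<eta> x \<partial>lborel) + (\<integral>x. partial_deriv i \<psi> x * \<eta> x \<partial>lborel)"
    by (intro Bochner_Integration.integral_add test_function_integrable [of _ UNIV] test_functions_mult test_functions_partial_deriv assms)
  finally show ?thesis by simp
qed

text \<open>Difference quotients commute with partial derivatives, so this form of the symmetry of second
  derivatives needs no pointwise argument.\<close>

lemma integral_partial_deriv_swap:
  assumes \<psi>: "\<psi> \<in> test_functions UNIV" and \<eta>: "\<eta> \<in> test_functions UNIV"
  shows "(\<integral>x. partial_deriv j \<psi> x * partial_deriv i \<eta> x \<partial>lborel)
    = (\<integral>x. partial_deriv i \<psi> x * partial_deriv j \<eta> x \<partial>lborel)"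
proof -
  note pd = test_functions_partial_deriv
  have "(\<lambda>n. \<integral>x. diff_quot j n \<psi> x * partial_deriv i \<eta> x \<partial>lborel)
      \<longlonglongrightarrow> (\<integral>x. partial_deriv j \<psi> x * partial_deriv i \<eta> x \<partial>lborel)"
    by (intro integral_diff_quot_tendsto \<psi> test_functionsD(3) [OF pd [OF \<eta>]])
  moreover have "(\<integral>x. diff_quot j n \<psi> x * partial_deriv i \<eta> x \<partial>lborel)
      = - (\<integral>x. diff_quot j n (partial_deriv i \<psi>) x * \<eta> x \<partial>lborel)" for n
    using integral_by_parts_test [OF diff_quot_test [OF \<psi>] \<eta>]
    by (simp add: partial_deriv_diff_quot [OF \<psi>])
  moreover have "(\<lambda>n. - (\<integral>x. diff_quot j n (partial_deriv i \<psi>) x * \<eta> x \<partial>lborel))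
      \<longlonglongrightarrow> - (\<integral>x. partial_deriv j (partial_deriv i \<psi>) x * \<eta> x \<partial>lborel)"
    by (intro tendsto_minus integral_diff_quot_tendsto pd \<psi> test_functionsD(3) [OF \<eta>])
  ultimately show ?thesis
    using integral_by_parts_test [OF pd [OF \<psi>] \<eta>, of j i] LIMSEQ_unique by fastforce
qed

text \<open>One integration by parts on either side leaves the two first derivatives distributed in
  opposite ways over \<open>\<psi>\<close> and \<open>\<eta>\<close>;
  \<open>integral_partial_deriv_swap\<close> exchanges them.\<close>

lemma integral_by_parts_twice:
  assumes \<psi>: "\<psi> \<in> test_functions UNIV" and \<eta>: "\<eta> \<in> test_functions UNIV"
  shows "(\<integral>x. \<psi> x * partial_deriv i (partial_deriv j \<eta>) x \<partial>lborel)
    = (\<integral>x. partial_deriv i (partial_deriv j \<psi>) x * \<eta> x \<partial>lborel)"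
  using integral_by_parts_test [OF \<psi> test_functions_partial_deriv [OF \<eta>], of i j]
    integral_by_parts_test [OF test_functions_partial_deriv [OF \<psi>] \<eta>, of i j]
    integral_partial_deriv_swap [OF \<psi> \<eta>, of i j] by linarith

subsection \<open>Lebesgue spaces\<close>

lemma LpD:
  assumes "f \<in> Lp p \<Omega>"
  shows "f \<in> borel_measurable (lebesgue_on \<Omega>)" "integrable (lebesgue_on \<Omega>) (\<lambda>x. norm (f x) ^ p)"
  using assms by (auto simp: Lp_def)

lemma Lp_bound:
  assumes "f \<in> borel_measurable (lebesgue_on \<Omega>)" "integrable (lebesgue_on \<Omega>) g" "\<And>x. norm (f x) ^ p \<le> g x"
  shows "f \<in> Lp p \<Omega>" "(\<integral>x. norm (f x) ^ p \<partial>lebesgue_on \<Omega>) \<le> (\<integral>x. g x \<partial>lebesgue_on \<Omega>)"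
proof -
  have nn: "0 \<le> g x" for x
    by (rule order_trans [OF _ assms(3)]) simp
  have "integrable (lebesgue_on \<Omega>) (\<lambda>x. norm (f x) ^ p)"
    by (rule Bochner_Integration.integrable_bound [OF assms(2)]) (use assms nn in auto)
  with assms show "f \<in> Lp p \<Omega>" "(\<integral>x. norm (f x) ^ p \<partial>lebesgue_on \<Omega>) \<le> (\<integral>x. g x \<partial>lebesgue_on \<Omega>)"
    by (auto simp: Lp_def intro!: integral_mono)
qed

lemma norm_add_power_le:
  fixes u v :: "'a::real_normed_vector"
  shows "norm (u + v) ^ p \<le> 2 ^ p * (norm u ^ p + norm v ^ p)"
proof -
  have "norm (u + v) ^ p \<le> (2 * max (norm u) (norm v)) ^ p"
    using norm_triangle_ineq [of u v] by (intro power_mono) auto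
  also have "\<dots> = 2 ^ p * max (norm u) (norm v) ^ p"
    by (simp add: power_mult_distrib)
  also have "max (norm u) (norm v) ^ p \<le> norm u ^ p + norm v ^ p"
    by (auto simp: max_def)
  finally show ?thesis by simp
qed

lemma Lp_add:
  fixes f g :: "real ^ 'n::finite \<Rightarrow> 'v::euclidean_space"
  assumes "f \<in> Lp p \<Omega>" "g \<in> Lp p \<Omega>"
  shows "(\<lambda>x. f x + g x) \<in> Lp p \<Omega>"
    "(\<integral>x. norm (f x + g x) ^ p \<partial>lebesgue_on \<Omega>)
       \<le> 2 ^ p * ((\<integral>x. norm (f x) ^ p \<partial>lebesgue_on \<Omega>) + (\<integral>x. norm (g x) ^ p \<partial>lebesgue_on \<Omega>))"
  using assms [THEN LpD(1)] assms [THEN LpD(2)]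
    Lp_bound [of "\<lambda>x. f x + g x" \<Omega> "\<lambda>x. 2 ^ p * (norm (f x) ^ p + norm (g x) ^ p)" p]
  by (auto simp: norm_add_power_le)

lemma Lp_scaleR: "f \<in> Lp p \<Omega> \<Longrightarrow> (\<lambda>x. a *\<^sub>R f x) \<in> Lp p \<Omega>"
  by (auto simp: Lp_def power_mult_distrib)

lemma Lp_lincomb: "f \<in> Lp p \<Omega> \<Longrightarrow> g \<in> Lp p \<Omega> \<Longrightarrow> (\<lambda>x. a *\<^sub>R f x + b *\<^sub>R g x) \<in> Lp p \<Omega>"
  by (intro Lp_add Lp_scaleR)

lemma Lp_diff: "f \<in> Lp p \<Omega> \<Longrightarrow> g \<in> Lp p \<Omega> \<Longrightarrow> (\<lambda>x. f x - g x) \<in> Lp p \<Omega>"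
  using Lp_lincomb [of f p \<Omega> g 1 "-1"] by simp

lemma Lp_zero: "p > 0 \<Longrightarrow> (\<lambda>_. 0) \<in> Lp p \<Omega>"
  by (simp add: Lp_def zero_power)

lemma Lp_norm_nonneg: "p > 0 \<Longrightarrow> 0 \<le> Lp_norm p \<Omega> f"
  by (simp add: Lp_norm_def)

lemma Lp_norm_power: "p > 0 \<Longrightarrow> Lp_norm p \<Omega> f ^ p = (\<integral>x. norm (f x) ^ p \<partial>lebesgue_on \<Omega>)"
  by (simp add: Lp_norm_def)

lemma Lp_norm_minus_commute: "Lp_norm p \<Omega> (\<lambda>x. f x - g x) = Lp_norm p \<Omega> (\<lambda>x. g x - f x)"
  by (simp add: Lp_norm_def norm_minus_commute)

lemma power_add_power_le:
  fixes a b :: real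
  assumes "0 \<le> a" "0 \<le> b" "p > 0"
  shows "a ^ p + b ^ p \<le> (a + b) ^ p"
proof -
  obtain q where q: "p = Suc q" using assms(3) gr0_implies_Suc by blast
  have "a * a ^ q \<le> a * (a + b) ^ q" "b * b ^ q \<le> b * (a + b) ^ q"
    using assms by (auto intro!: mult_left_mono power_mono)
  then show ?thesis by (simp add: q distrib_right)
qed

text \<open>A quasi-triangle inequality: the constant 2 comes from \<open>norm_add_power_le\<close>
  and the superadditivity of powers. It serves to bound convergent sequences, where the value of the
  constant is immaterial.\<close>

lemma Lp_norm_add:
  assumes "f \<in> Lp p \<Omega>" "g \<in> Lp p \<Omega>" "p > 0"
  shows "Lp_norm p \<Omega> (\<lambda>x. f x + g x) \<le> 2 * (Lp_norm p \<Omega> f + Lp_norm p \<Omega> g)"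
proof (rule power_le_imp_le_base)
  let ?a = "Lp_norm p \<Omega> f" and ?b = "Lp_norm p \<Omega> g"
  have nn: "0 \<le> ?a" "0 \<le> ?b" using assms by (simp_all add: Lp_norm_nonneg)
  have "Lp_norm p \<Omega> (\<lambda>x. f x + g x) ^ p \<le> 2 ^ p * (?a ^ p + ?b ^ p)"
    using Lp_add(2) [OF assms(1,2)] assms(3) by (simp add: Lp_norm_power)
  also have "?a ^ p + ?b ^ p \<le> (?a + ?b) ^ p"
    by (rule power_add_power_le [OF nn assms(3)])
  finally show "Lp_norm p \<Omega> (\<lambda>x. f x + g x) ^ Suc (p - 1) \<le> (2 * (?a + ?b)) ^ Suc (p - 1)"
    using assms(3) by (simp add: power_mult_distrib del: distrib_left_numeral)
  show "0 \<le> 2 * (?a + ?b)" using nn by simp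
qed

lemma Lp_cong_AE:
  assumes "f \<in> Lp p \<Omega>" "g \<in> borel_measurable (lebesgue_on \<Omega>)" "AE x in lebesgue_on \<Omega>. f x = g x"
  shows "g \<in> Lp p \<Omega>"
proof -
  have "integrable (lebesgue_on \<Omega>) (\<lambda>x. norm (f x) ^ p) \<longleftrightarrow> integrable (lebesgue_on \<Omega>) (\<lambda>x. norm (g x) ^ p)"
    by (rule Bochner_Integration.integrable_cong_AE) (use assms LpD(1) [OF assms(1)] in \<open>auto elim!: eventually_mono\<close>)
  with assms show ?thesis by (auto simp: Lp_def)
qed

lemma Lp_norm_cong_AE:
  assumes "f \<in> borel_measurable (lebesgue_on \<Omega>)" "g \<in> borel_measurable (lebesgue_on \<Omega>)"
    "AE x in lebesgue_on \<Omega>. f x = g x"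
  shows "Lp_norm p \<Omega> f = Lp_norm p \<Omega> g"
  unfolding Lp_norm_def
  by (rule arg_cong [of _ _ "root p"], rule integral_cong_AE) (use assms in \<open>auto elim!: eventually_mono\<close>)

lemma Lp_norm_eq_0_AE:
  assumes "AE x in lebesgue_on \<Omega>. f x = 0" "p > 0"
  shows "Lp_norm p \<Omega> f = 0"
proof -
  have "(\<integral>x. norm (f x) ^ p \<partial>lebesgue_on \<Omega>) = 0"
    by (rule integral_eq_zero_AE) (use assms in \<open>auto elim!: eventually_mono\<close>)
  then show ?thesis by (simp add: Lp_norm_def)
qed

lemma Lp_norm_eq_0_iff:
  assumes "f \<in> Lp p \<Omega>" "p > 0"
  shows "Lp_norm p \<Omega> f = 0 \<longleftrightarrow> (AE x in lebesgue_on \<Omega>. f x = 0)"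
  using integral_nonneg_eq_0_iff_AE [OF LpD(2) [OF assms(1)]] assms(2) by (simp add: Lp_norm_def)

lemma tendsto_from_bound:
  fixes x :: "nat \<Rightarrow> real"
  assumes "\<And>m. \<bar>x m\<bar> \<le> c * y m" "y \<longlonglongrightarrow> 0"
  shows "x \<longlonglongrightarrow> 0"
proof (rule tendsto_rabs_zero_cancel, rule tendsto_sandwich [OF _ _ tendsto_const])
  show "(\<lambda>m. c * y m) \<longlonglongrightarrow> 0" by (rule tendsto_mult_right_zero [OF assms(2)])
qed (use assms(1) in auto)

text \<open>Integrals of powers, unlike their roots, can be added over components and compared under
  pointwise bounds.\<close>

lemma Lp_tendsto_iff:
  assumes "p > 0"
  shows "Lp_tendsto p \<Omega> f g \<longleftrightarrow> (\<forall>m. f m \<in> Lp p \<Omega>) \<and> g \<in> Lp p \<Omega> \<and>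
    (\<lambda>m. \<integral>x. norm (f m x - g x) ^ p \<partial>lebesgue_on \<Omega>) \<longlonglongrightarrow> 0"
proof -
  have "(\<lambda>m. Lp_norm p \<Omega> (\<lambda>x. f m x - g x)) \<longlonglongrightarrow> 0 \<longleftrightarrow>
    (\<lambda>m. \<integral>x. norm (f m x - g x) ^ p \<partial>lebesgue_on \<Omega>) \<longlonglongrightarrow> 0"
  proof
    assume "(\<lambda>m. Lp_norm p \<Omega> (\<lambda>x. f m x - g x)) \<longlonglongrightarrow> 0"
    from tendsto_power [OF this, of p] assms
    show "(\<lambda>m. \<integral>x. norm (f m x - g x) ^ p \<partial>lebesgue_on \<Omega>) \<longlonglongrightarrow> 0"
      by (simp add: Lp_norm_power zero_power)
  next
    assume "(\<lambda>m. \<integral>x. norm (f m x - g x) ^ p \<partial>lebesgue_on \<Omega>) \<longlonglongrightarrow> 0"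
    from tendsto_real_root [OF this, of p] show "(\<lambda>m. Lp_norm p \<Omega> (\<lambda>x. f m x - g x)) \<longlonglongrightarrow> 0"
      by (simp add: Lp_norm_def)
  qed
  then show ?thesis by (simp add: Lp_tendsto_def)
qed

lemma Lp_tendsto_subseq:
  assumes "Lp_tendsto p \<Omega> f g" "strict_mono r"
  shows "Lp_tendsto p \<Omega> (\<lambda>m. f (r m)) g"
  using assms(1) LIMSEQ_subseq_LIMSEQ [OF _ assms(2), of "\<lambda>m. Lp_norm p \<Omega> (\<lambda>x. f m x - g x)" 0]
  by (simp add: Lp_tendsto_def o_def)

lemma Lp_tendsto_cong_AE:
  assumes "Lp_tendsto p \<Omega> f g" "h \<in> Lp p \<Omega>" "AE x in lebesgue_on \<Omega>. g x = h x"
  shows "Lp_tendsto p \<Omega> f h"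
proof -
  have "Lp_norm p \<Omega> (\<lambda>x. f m x - g x) = Lp_norm p \<Omega> (\<lambda>x. f m x - h x)" for m
    using assms unfolding Lp_tendsto_def
    by (intro Lp_norm_cong_AE borel_measurable_diff LpD(1) [of _ p]) (auto elim!: eventually_mono)
  with assms show ?thesis by (simp add: Lp_tendsto_def)
qed

lemma Lp_tendsto_bounded:
  assumes "Lp_tendsto p \<Omega> f g" "p > 0"
  shows "\<exists>C. \<forall>m. Lp_norm p \<Omega> (f m) \<le> C"
proof -
  have f: "f m \<in> Lp p \<Omega>" and g: "g \<in> Lp p \<Omega>" for m
    using assms by (auto simp: Lp_tendsto_def)
  have "convergent (\<lambda>m. Lp_norm p \<Omega> (\<lambda>x. f m x - g x))"
    using assms by (auto simp: Lp_tendsto_def convergent_def)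
  then have "Bseq (\<lambda>m. Lp_norm p \<Omega> (\<lambda>x. f m x - g x))"
    by (rule convergent_imp_Bseq)
  then have "\<exists>C. \<forall>m. norm (Lp_norm p \<Omega> (\<lambda>x. f m x - g x)) \<le> C"
    unfolding Bseq_def by blast
  then obtain C where C: "norm (Lp_norm p \<Omega> (\<lambda>x. f m x - g x)) \<le> C" for m
    by auto
  have "Lp_norm p \<Omega> (f m) \<le> 2 * (C + Lp_norm p \<Omega> g)" for m
  proof -
    have "Lp_norm p \<Omega> (f m) \<le> 2 * (Lp_norm p \<Omega> (\<lambda>x. f m x - g x) + Lp_norm p \<Omega> g)"
      using Lp_norm_add [OF Lp_diff [OF f [of m] g] g assms(2)] by simp
    with C [of m] show ?thesis by simp
  qed
  then show ?thesis by blast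
qed

section \<open>Hilbert space structure of L2\<close>

lemma Lp_inner_integrable:
  fixes f g :: "real ^ 'n::finite \<Rightarrow> 'v::euclidean_space"
  assumes "f \<in> Lp 2 \<Omega>" "g \<in> Lp 2 \<Omega>"
  shows "integrable (lebesgue_on \<Omega>) (\<lambda>x. f x \<bullet> g x)"
proof (rule Bochner_Integration.integrable_bound)
  show "integrable (lebesgue_on \<Omega>) (\<lambda>x. norm (f x) ^ 2 + norm (g x) ^ 2)"
    by (intro Bochner_Integration.integrable_add LpD(2) assms)
  have "\<bar>f x \<bullet> g x\<bar> \<le> (norm (f x))\<^sup>2 + (norm (g x))\<^sup>2" for x
  proof -
    have "\<bar>f x \<bullet> g x\<bar> \<le> norm (f x) * norm (g x)" by (rule Cauchy_Schwarz_ineq2)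
    also have "\<dots> \<le> (norm (f x))\<^sup>2 + (norm (g x))\<^sup>2"
      using sum_squares_bound [of "norm (f x)" "norm (g x)"]
        mult_nonneg_nonneg [OF norm_ge_zero [of "f x"] norm_ge_zero [of "g x"]] by linarith
    finally show ?thesis .
  qed
  then show "AE x in lebesgue_on \<Omega>. norm (f x \<bullet> g x) \<le> norm ((norm (f x))\<^sup>2 + (norm (g x))\<^sup>2)"
    by simp
qed (use LpD(1) [OF assms(1)] LpD(1) [OF assms(2)] in auto)

lemma Lp_inner_lincomb:
  fixes f g h :: "real ^ 'n::finite \<Rightarrow> 'v::euclidean_space"
  assumes "f \<in> Lp 2 \<Omega>" "g \<in> Lp 2 \<Omega>" "h \<in> Lp 2 \<Omega>"
  shows "(\<integral>x. (a *\<^sub>R f x + b *\<^sub>R g x) \<bullet> h x \<partial>lebesgue_on \<Omega>)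
    = a * (\<integral>x. f x \<bullet> h x \<partial>lebesgue_on \<Omega>) + b * (\<integral>x. g x \<bullet> h x \<partial>lebesgue_on \<Omega>)"
  using assms by (simp add: inner_add_left Lp_inner_integrable)

lemma Lp_inner_diff:
  fixes f g h :: "real ^ 'n::finite \<Rightarrow> 'v::euclidean_space"
  assumes "f \<in> Lp 2 \<Omega>" "g \<in> Lp 2 \<Omega>" "h \<in> Lp 2 \<Omega>"
  shows "(\<integral>x. (f x - g x) \<bullet> h x \<partial>lebesgue_on \<Omega>)
    = (\<integral>x. f x \<bullet> h x \<partial>lebesgue_on \<Omega>) - (\<integral>x. g x \<bullet> h x \<partial>lebesgue_on \<Omega>)"
  using assms by (simp add: inner_diff_left Lp_inner_integrable)

text \<open>As a quadratic polynomial in \<open>t\<close> this is fed to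
  \<open>discriminant_nonneg_quadratic\<close>, for the Cauchy-Schwarz inequality and for the
  orthogonality of projections; at \<open>t = 1\<close> it expands a squared distance.\<close>

lemma L2_norm_diff_scaleR:
  fixes f g :: "real ^ 'n::finite \<Rightarrow> 'v::euclidean_space"
  assumes "f \<in> Lp 2 \<Omega>" "g \<in> Lp 2 \<Omega>"
  shows "(\<integral>x. norm (f x - t *\<^sub>R g x) ^ 2 \<partial>lebesgue_on \<Omega>)
    = (\<integral>x. norm (f x) ^ 2 \<partial>lebesgue_on \<Omega>) - 2 * t * (\<integral>x. f x \<bullet> g x \<partial>lebesgue_on \<Omega>)
      + t\<^sup>2 * (\<integral>x. norm (g x) ^ 2 \<partial>lebesgue_on \<Omega>)"
proof -
  have "norm (f x - t *\<^sub>R g x) ^ 2 = norm (f x) ^ 2 - 2 * t * (f x \<bullet> g x) + t\<^sup>2 * norm (g x) ^ 2" for x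
    by (simp only: power2_norm_eq_inner)
      (simp add: inner_diff_left inner_diff_right inner_commute power2_eq_square)
  then show ?thesis
    using assms LpD(2) [OF assms(1)] LpD(2) [OF assms(2)]
    by (simp add: Lp_inner_integrable)
qed

lemma discriminant_nonneg_quadratic:
  fixes a b c :: real
  assumes "\<And>t. 0 \<le> a - 2 * t * b + t\<^sup>2 * c" "0 \<le> c"
  shows "b\<^sup>2 \<le> a * c"
proof (cases "c = 0")
  case True
  have "b = 0"
  proof (rule ccontr)
    assume "b \<noteq> 0"
    \<comment> \<open>At this \<open>t\<close> the polynomial, linear because \<open>c = 0\<close>,
      takes the value -1.\<close>
    then show False
      using assms(1) [of "(a + 1) / (2 * b)"] True by simp
  qed
  with True show ?thesis by simp
next
  case False
  then have "0 \<le> a - b\<^sup>2 / c"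
    using assms(1) [of "b / c"] by (simp add: power2_eq_square field_simps)
  then have "b\<^sup>2 / c \<le> a" by simp
  with False assms(2) show ?thesis by (simp add: field_simps)
qed

lemma L2_Cauchy_Schwarz:
  fixes f g :: "real ^ 'n::finite \<Rightarrow> 'v::euclidean_space"
  assumes "f \<in> Lp 2 \<Omega>" "g \<in> Lp 2 \<Omega>"
  shows "\<bar>\<integral>x. f x \<bullet> g x \<partial>lebesgue_on \<Omega>\<bar> \<le> Lp_norm 2 \<Omega> f * Lp_norm 2 \<Omega> g"
proof -
  have "(\<integral>x. f x \<bullet> g x \<partial>lebesgue_on \<Omega>)\<^sup>2
      \<le> (\<integral>x. norm (f x) ^ 2 \<partial>lebesgue_on \<Omega>) * (\<integral>x. norm (g x) ^ 2 \<partial>lebesgue_on \<Omega>)"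
  proof (rule discriminant_nonneg_quadratic)
    fix t
    show "0 \<le> (\<integral>x. norm (f x) ^ 2 \<partial>lebesgue_on \<Omega>) - 2 * t * (\<integral>x. f x \<bullet> g x \<partial>lebesgue_on \<Omega>)
      + t\<^sup>2 * (\<integral>x. norm (g x) ^ 2 \<partial>lebesgue_on \<Omega>)"
      unfolding L2_norm_diff_scaleR [OF assms, symmetric] by simp
  qed simp
  also have "\<dots> = (Lp_norm 2 \<Omega> f * Lp_norm 2 \<Omega> g)\<^sup>2"
    by (simp add: power_mult_distrib Lp_norm_power)
  finally show ?thesis
    by (metis abs_le_square_iff abs_of_nonneg mult_nonneg_nonneg Lp_norm_nonneg zero_less_numeral)
qed

lemma Lp_tendsto_inner:
  fixes f :: "nat \<Rightarrow> real ^ 'n::finite \<Rightarrow> 'v::euclidean_space"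
  assumes "Lp_tendsto 2 \<Omega> f g" "h \<in> Lp 2 \<Omega>"
  shows "(\<lambda>n. \<integral>x. f n x \<bullet> h x \<partial>lebesgue_on \<Omega>) \<longlonglongrightarrow> (\<integral>x. g x \<bullet> h x \<partial>lebesgue_on \<Omega>)"
proof -
  have f: "f n \<in> Lp 2 \<Omega>" and g: "g \<in> Lp 2 \<Omega>" and 0: "(\<lambda>n. Lp_norm 2 \<Omega> (\<lambda>x. f n x - g x)) \<longlonglongrightarrow> 0" for n
    using assms by (auto simp: Lp_tendsto_def)
  have "(\<lambda>n. (\<integral>x. f n x \<bullet> h x \<partial>lebesgue_on \<Omega>) - (\<integral>x. g x \<bullet> h x \<partial>lebesgue_on \<Omega>)) \<longlonglongrightarrow> 0"
  proof (rule tendsto_from_bound [OF _ 0])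
    show "\<bar>(\<integral>x. f n x \<bullet> h x \<partial>lebesgue_on \<Omega>) - (\<integral>x. g x \<bullet> h x \<partial>lebesgue_on \<Omega>)\<bar>
      \<le> Lp_norm 2 \<Omega> h * Lp_norm 2 \<Omega> (\<lambda>x. f n x - g x)" for n
      using L2_Cauchy_Schwarz [OF Lp_diff [OF f g] assms(2)] Lp_inner_diff [OF f g assms(2)]
      by (simp add: mult.commute)
  qed
  then show ?thesis by (simp add: LIM_zero_iff)
qed

text \<open>The assumed rate makes consecutive distances at most \<open>(1 / 2) ^ n\<close>. On a
  finite measure space the Cauchy-Schwarz inequality with the constant function 1 turns this into
  summability in L1, so the telescoping series converges absolutely almost everywhere. Fatou's
  lemma, for fixed \<open>m\<close>, transfers the rate to the limit.\<close>

lemma L2_complete: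
  fixes f :: "nat \<Rightarrow> real ^ 'n::finite \<Rightarrow> 'v::euclidean_space"
  assumes fin: "finite_measure (lebesgue_on \<Omega>)" and f: "\<And>n. f n \<in> Lp 2 \<Omega>"
    and cauchy: "\<And>m n. m \<le> n \<Longrightarrow> (\<integral>x. norm (f m x - f n x) ^ 2 \<partial>lebesgue_on \<Omega>) \<le> (1 / 4) ^ m"
  shows "\<exists>g\<in>Lp 2 \<Omega>. \<forall>m. (\<integral>x. norm (f m x - g x) ^ 2 \<partial>lebesgue_on \<Omega>) \<le> (1 / 4) ^ m"
proof -
  let ?M = "lebesgue_on \<Omega>"
  interpret finite_measure ?M by (rule fin)
  define d where "d n x = norm (f (Suc n) x - f n x)" for n x
  have one: "(\<lambda>_. 1::real) \<in> Lp 2 \<Omega>" by (simp add: Lp_def)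
  have d2: "d n \<in> Lp 2 \<Omega>" for n
    using Lp_diff [OF f f, of "Suc n" n] by (auto simp: Lp_def d_def [abs_def])
  have dint: "integrable ?M (d n)" for n
    using Lp_inner_integrable [OF d2 one] by simp
  have dm [measurable]: "d n \<in> borel_measurable ?M" for n
    by (rule LpD(1) [OF d2])
  define c where "c = Lp_norm 2 \<Omega> (\<lambda>_. 1::real)"
  have c: "c \<ge> 0" by (simp add: c_def Lp_norm_nonneg)
  have d_le: "(\<integral>x. d n x \<partial>?M) \<le> c * (1 / 2) ^ n" for n
  proof -
    have "(Lp_norm 2 \<Omega> (d n))\<^sup>2 \<le> (1 / 4) ^ n"
      using cauchy [of n "Suc n"] by (simp add: Lp_norm_power d_def norm_minus_commute)
    also have "(1 / 4) ^ n = ((1 / 2 :: real) ^ n)\<^sup>2"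
      by (simp add: power_divide power2_eq_square flip: power_mult_distrib)
    finally have "Lp_norm 2 \<Omega> (d n) \<le> (1 / 2) ^ n"
      by (rule power2_le_imp_le) simp
    moreover have "(\<integral>x. d n x \<partial>?M) \<le> Lp_norm 2 \<Omega> (d n) * c"
      using L2_Cauchy_Schwarz [OF d2 one, of n] by (simp add: c_def)
    ultimately show ?thesis
      using c by (metis mult.commute mult_left_mono order_trans)
  qed
  have "AE x in ?M. suminf (\<lambda>n. ennreal (d n x)) \<noteq> \<infinity>"
  proof (rule nn_integral_PInf_AE)
    show "(\<lambda>x. suminf (\<lambda>n. ennreal (d n x))) \<in> borel_measurable ?M"
      using dm by measurable
    have "(\<integral>\<^sup>+x. suminf (\<lambda>n. ennreal (d n x)) \<partial>?M) = suminf (\<lambda>n. \<integral>\<^sup>+x. ennreal (d n x) \<partial>?M)"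
      using dm by (intro nn_integral_suminf) measurable
    also have "\<dots> = suminf (\<lambda>n. ennreal (\<integral>x. d n x \<partial>?M))"
      by (intro suminf_cong nn_integral_eq_integral dint) (simp add: d_def)
    also have "\<dots> \<le> suminf (\<lambda>n. ennreal (c * (1 / 2) ^ n))"
      by (intro suminf_le ennreal_leI d_le) auto
    also have "\<dots> = ennreal (suminf (\<lambda>n. c * (1 / 2) ^ n))"
      using c by (intro suminf_ennreal2 summable_mult summable_geometric) auto
    finally show "(\<integral>\<^sup>+x. suminf (\<lambda>n. ennreal (d n x)) \<partial>?M) \<noteq> \<infinity>"
      unfolding infinity_ennreal_def by (rule neq_top_trans [OF ennreal_neq_top])
  qed
  then have conv: "AE x in ?M. (\<lambda>n. f n x) \<longlonglongrightarrow> lim (\<lambda>n. f n x)"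
  proof eventually_elim
    case (elim x)
    then have "summable (\<lambda>n. d n x)"
      by (intro summable_suminf_not_top) (auto simp: d_def)
    then have "summable (\<lambda>n. f (Suc n) x - f n x)"
      unfolding d_def by (rule summable_norm_cancel)
    then have "convergent (\<lambda>n. \<Sum>k<n. f (Suc k) x - f k x)"
      by (simp add: summable_iff_convergent)
    then have "convergent (\<lambda>n. (f n x - f 0 x) + f 0 x)"
      unfolding sum_lessThan_telescope [of "\<lambda>k. f k x"] by (intro convergent_add convergent_const)
    then show ?case by (simp add: convergent_LIMSEQ_iff)
  qed
  \<comment> \<open>Only on a null set is the value of \<open>lim\<close> arbitrary; using it
    everywhere keeps \<open>g\<close> measurable.\<close>
  define g where "g x = lim (\<lambda>n. f n x)" for x
  have fm [measurable]: "f n \<in> borel_measurable ?M" for n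
    by (rule LpD(1) [OF f])
  have gm: "g \<in> borel_measurable ?M"
    unfolding g_def [abs_def] by measurable
  have nn: "(\<integral>\<^sup>+x. ennreal (norm (f m x - g x) ^ 2) \<partial>?M) \<le> ennreal ((1 / 4) ^ m)" for m
  proof -
    have "(\<integral>\<^sup>+x. ennreal (norm (f m x - g x) ^ 2) \<partial>?M)
      = (\<integral>\<^sup>+x. liminf (\<lambda>n. ennreal (norm (f m x - f n x) ^ 2)) \<partial>?M)"
    proof (rule nn_integral_cong_AE)
      show "AE x in ?M. ennreal (norm (f m x - g x) ^ 2) = liminf (\<lambda>n. ennreal (norm (f m x - f n x) ^ 2))"
        using conv
      proof eventually_elim
        case (elim x)
        then have "(\<lambda>n. ennreal (norm (f m x - f n x) ^ 2)) \<longlonglongrightarrow> ennreal (norm (f m x - g x) ^ 2)"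
          unfolding g_def by (intro tendsto_intros)
        then show ?case
          by (metis lim_imp_Liminf trivial_limit_sequentially)
      qed
    qed
    also have "\<dots> \<le> liminf (\<lambda>n. \<integral>\<^sup>+x. ennreal (norm (f m x - f n x) ^ 2) \<partial>?M)"
      by (intro nn_integral_liminf) (use fm in measurable)
    also have "\<dots> \<le> liminf (\<lambda>n::nat. ennreal ((1 / 4) ^ m))"
    proof (rule Liminf_mono)
      show "\<forall>\<^sub>F n in sequentially. (\<integral>\<^sup>+x. ennreal (norm (f m x - f n x) ^ 2) \<partial>?M) \<le> ennreal ((1 / 4) ^ m)"
        using eventually_ge_at_top [of m]
      proof eventually_elim
        case (elim n)
        have "(\<integral>\<^sup>+x. ennreal (norm (f m x - f n x) ^ 2) \<partial>?M) = ennreal (\<integral>x. norm (f m x - f n x) ^ 2 \<partial>?M)"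
          using LpD(2) [OF Lp_diff [OF f f]] by (intro nn_integral_eq_integral) auto
        with cauchy [OF elim] show ?case by (simp add: ennreal_leI)
      qed
    qed
    also have "\<dots> = ennreal ((1 / 4) ^ m)"
      by (simp add: Liminf_const)
    finally show ?thesis .
  qed
  have diff: "(\<lambda>x. f m x - g x) \<in> Lp 2 \<Omega>" for m
  proof -
    have "integrable ?M (\<lambda>x. norm (f m x - g x) ^ 2)"
      by (rule integrableI_bounded)
        (use fm gm nn [of m] le_less_trans [OF _ ennreal_less_top] in auto)
    then show ?thesis using fm gm by (simp add: Lp_def)
  qed
  show ?thesis
  proof (intro bexI [of _ g] allI)
    show "g \<in> Lp 2 \<Omega>"
      using Lp_diff [OF f [of 0] diff [of 0]] by simp
    fix m
    have "ennreal (\<integral>x. norm (f m x - g x) ^ 2 \<partial>?M) = (\<integral>\<^sup>+x. ennreal (norm (f m x - g x) ^ 2) \<partial>?M)"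
      using LpD(2) [OF diff] by (intro nn_integral_eq_integral [symmetric]) auto
    with nn [of m] have "ennreal (\<integral>x. norm (f m x - g x) ^ 2 \<partial>?M) \<le> ennreal ((1 / 4) ^ m)"
      by (simp only:)
    then show "(\<integral>x. norm (f m x - g x) ^ 2 \<partial>?M) \<le> (1 / 4) ^ m"
      by (subst (asm) ennreal_le_iff) auto
  qed
qed

text \<open>\<open>V\<close> need not be closed, so the projection \<open>p\<close> is delivered as
  a limit of members of \<open>V\<close>. A minimising sequence is Cauchy by the parallelogram
  identity, because midpoints stay in \<open>V\<close>.\<close>

lemma L2_projection:
  fixes f :: "real ^ 'n::finite \<Rightarrow> 'v::euclidean_space"
  assumes fin: "finite_measure (lebesgue_on \<Omega>)" and f: "f \<in> Lp 2 \<Omega>"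
    and V: "V \<subseteq> Lp 2 \<Omega>" and V0: "(\<lambda>_. 0) \<in> V"
    and lin: "\<And>v w a b. v \<in> V \<Longrightarrow> w \<in> V \<Longrightarrow> (\<lambda>x. a *\<^sub>R v x + b *\<^sub>R w x) \<in> V"
  shows "\<exists>v p. (\<forall>n::nat. v n \<in> V) \<and> Lp_tendsto 2 \<Omega> v p \<and>
    (\<forall>w\<in>V. (\<integral>x. (f x - p x) \<bullet> w x \<partial>lebesgue_on \<Omega>) = 0)"
proof -
  let ?M = "lebesgue_on \<Omega>"
  define N where "N h = (\<integral>x. norm (h x :: 'v) ^ 2 \<partial>?M)" for h
  define D where "D = (INF v\<in>V. N (\<lambda>x. f x - v x))"
  have bdd: "bdd_below ((\<lambda>v. N (\<lambda>x. f x - v x)) ` V)"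
    by (auto simp: N_def bdd_below_def intro!: exI [of _ 0])
  have D_le: "D \<le> N (\<lambda>x. f x - v x)" if "v \<in> V" for v
    unfolding D_def using that by (intro cINF_lower bdd)
  \<comment> \<open>The parallelogram identity will give
    \<open>2 * e m + 2 * e n \<le> 4 * e m\<close>; the division by 4 makes this the rate
    \<open>(1 / 4) ^ m\<close> required by \<open>L2_complete\<close>.\<close>
  define e where "e n = (1 / 4 :: real) ^ n / 4" for n :: nat
  have "\<exists>v\<in>V. N (\<lambda>x. f x - v x) < D + e n" for n
  proof -
    have "(INF v\<in>V. N (\<lambda>x. f x - v x)) < D + e n"
      by (simp add: D_def [symmetric] e_def)
    then show ?thesis using V0 bdd by (subst (asm) cINF_less_iff) auto
  qed
  then obtain v where vV: "\<And>n. v n \<in> V" and v: "\<And>n. N (\<lambda>x. f x - v n x) < D + e n"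
    by metis
  have v2: "v n \<in> Lp 2 \<Omega>" for n using vV V by blast
  have par: "N (\<lambda>x. v m x - v n x) \<le> (1 / 4) ^ m" if "m \<le> n" for m n
  proof -
    define w where "w x = (1 / 2) *\<^sub>R v m x + (1 / 2) *\<^sub>R v n x" for x
    have w: "w \<in> V" unfolding w_def [abs_def] by (intro lin vV)
    then have w2: "w \<in> Lp 2 \<Omega>" using V by blast
    have "norm (v m x - v n x) ^ 2 = 2 * norm (f x - v m x) ^ 2 + 2 * norm (f x - v n x) ^ 2
        - 4 * norm (f x - w x) ^ 2" for x
      unfolding w_def power2_norm_eq_inner
      by (simp add: inner_simps inner_commute algebra_simps)
    then have "N (\<lambda>x. v m x - v n x) = 2 * N (\<lambda>x. f x - v m x) + 2 * N (\<lambda>x. f x - v n x) - 4 * N (\<lambda>x. f x - w x)"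
      unfolding N_def using f v2 w2 by (simp add: LpD(2) Lp_diff)
    also have "\<dots> \<le> 2 * e m + 2 * e n"
      using v [of m] v [of n] D_le [OF w] by simp
    also have "e n \<le> e m"
      unfolding e_def using that by (intro divide_right_mono power_decreasing) auto
    finally show ?thesis by (simp add: e_def)
  qed
  obtain p where p: "p \<in> Lp 2 \<Omega>" and vp: "\<And>m. N (\<lambda>x. v m x - p x) \<le> (1 / 4) ^ m"
    using L2_complete [OF fin v2 par [unfolded N_def]] unfolding N_def by metis
  have lim: "Lp_tendsto 2 \<Omega> v p"
  proof -
    have "(\<lambda>m. N (\<lambda>x. v m x - p x)) \<longlonglongrightarrow> 0"
    proof (rule tendsto_sandwich [OF _ _ tendsto_const])
      show "(\<lambda>m. (1 / 4 :: real) ^ m) \<longlonglongrightarrow> 0" by (simp add: LIMSEQ_realpow_zero)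
    qed (use vp in \<open>auto simp: N_def\<close>)
    then show ?thesis using v2 p by (simp add: Lp_tendsto_iff N_def)
  qed
  have "(\<integral>x. (f x - p x) \<bullet> w x \<partial>?M) = 0" if w: "w \<in> V" for w
  proof -
    have w2: "w \<in> Lp 2 \<Omega>" using w V by blast
    \<comment> \<open>Since \<open>v n\<close> minimises up to \<open>e n\<close>, moving it by a
      multiple of \<open>w\<close> gains at most \<open>e n\<close> for every multiple; the
      discriminant then shows that the residual \<open>f - v n\<close> is almost orthogonal to
      \<open>w\<close>.\<close>
    have I: "(\<integral>x. (f x - v n x) \<bullet> w x \<partial>?M)\<^sup>2 \<le> e n * N w" for n
    proof (rule discriminant_nonneg_quadratic)
      fix t
      have "D \<le> N (\<lambda>x. f x - (1 *\<^sub>R v n x + t *\<^sub>R w x))"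
        by (intro D_le lin vV w)
      also have "\<dots> = N (\<lambda>x. (f x - v n x) - t *\<^sub>R w x)"
        by (simp add: algebra_simps)
      also have "\<dots> = N (\<lambda>x. f x - v n x) - 2 * t * (\<integral>x. (f x - v n x) \<bullet> w x \<partial>?M) + t\<^sup>2 * N w"
        unfolding N_def by (intro L2_norm_diff_scaleR Lp_diff f v2 w2)
      finally show "0 \<le> e n - 2 * t * (\<integral>x. (f x - v n x) \<bullet> w x \<partial>?M) + t\<^sup>2 * N w"
        using v [of n] by simp
    qed (simp add: N_def)
    have "(\<lambda>n. (\<integral>x. (f x - v n x) \<bullet> w x \<partial>?M)\<^sup>2) \<longlonglongrightarrow> 0"
    proof (rule tendsto_sandwich [OF _ _ tendsto_const])
      have "(\<lambda>n. (1 / 4) ^ n / 4 * N w) \<longlonglongrightarrow> 0 / 4 * N w"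
        by (intro tendsto_intros LIMSEQ_realpow_zero) auto
      then show "(\<lambda>n. e n * N w) \<longlonglongrightarrow> 0" by (simp add: e_def)
    qed (use I in auto)
    moreover have "(\<lambda>n. (\<integral>x. (f x - v n x) \<bullet> w x \<partial>?M)\<^sup>2) \<longlonglongrightarrow> (\<integral>x. (f x - p x) \<bullet> w x \<partial>?M)\<^sup>2"
      unfolding Lp_inner_diff [OF f v2 w2] Lp_inner_diff [OF f p w2]
      by (intro tendsto_intros Lp_tendsto_inner [OF lim w2])
    ultimately show ?thesis using LIMSEQ_unique by fastforce
  qed
  with lim vV show ?thesis by blast
qed

text \<open>The double annihilator theorem. With \<open>p\<close> the projection,
  \<open>f - p\<close> annihilates \<open>V\<close>, hence \<open>f\<close> by \<open>orth\<close>,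
  and \<open>p\<close> by passing to the limit; so it is orthogonal to itself. Density and closure
  statements below reduce to computing an annihilator.\<close>

lemma L2_biorthogonal:
  fixes f :: "real ^ 'n::finite \<Rightarrow> 'v::euclidean_space"
  assumes fin: "finite_measure (lebesgue_on \<Omega>)" and f: "f \<in> Lp 2 \<Omega>"
    and V: "V \<subseteq> Lp 2 \<Omega>" and V0: "(\<lambda>_. 0) \<in> V"
    and lin: "\<And>v w a b. v \<in> V \<Longrightarrow> w \<in> V \<Longrightarrow> (\<lambda>x. a *\<^sub>R v x + b *\<^sub>R w x) \<in> V"
    and orth: "\<And>g. g \<in> Lp 2 \<Omega> \<Longrightarrow> (\<And>w. w \<in> V \<Longrightarrow> (\<integral>x. g x \<bullet> w x \<partial>lebesgue_on \<Omega>) = 0)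
      \<Longrightarrow> (\<integral>x. g x \<bullet> f x \<partial>lebesgue_on \<Omega>) = 0"
  shows "\<exists>v. (\<forall>n::nat. v n \<in> V) \<and> Lp_tendsto 2 \<Omega> v f"
proof -
  let ?M = "lebesgue_on \<Omega>"
  obtain v p where vV: "\<And>n::nat. v n \<in> V" and lim: "Lp_tendsto 2 \<Omega> v p"
    and perp: "\<And>w. w \<in> V \<Longrightarrow> (\<integral>x. (f x - p x) \<bullet> w x \<partial>?M) = 0"
    using L2_projection [OF fin f V V0 lin] by blast
  have p: "p \<in> Lp 2 \<Omega>" using lim by (simp add: Lp_tendsto_def)
  note fp = Lp_diff [OF f p]
  have "(\<lambda>n. \<integral>x. v n x \<bullet> (f x - p x) \<partial>?M) \<longlonglongrightarrow> (\<integral>x. p x \<bullet> (f x - p x) \<partial>?M)"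
    by (rule Lp_tendsto_inner [OF lim fp])
  then have "(\<integral>x. p x \<bullet> (f x - p x) \<partial>?M) = 0"
    using perp [OF vV] by (simp add: inner_commute LIMSEQ_const_iff)
  moreover have "(\<integral>x. f x \<bullet> (f x - p x) \<partial>?M) = 0"
    using orth [OF fp perp] by (simp add: inner_commute)
  ultimately have "(\<integral>x. (f x - p x) \<bullet> (f x - p x) \<partial>?M) = 0"
    using Lp_inner_diff [OF f p fp] by simp
  then have "Lp_norm 2 \<Omega> (\<lambda>x. f x - p x) = 0"
    by (simp add: Lp_norm_def power2_norm_eq_inner)
  then have "AE x in ?M. f x - p x = 0"
    using Lp_norm_eq_0_iff [OF fp] by simp
  then have "AE x in ?M. p x = f x"
    by eventually_elim simp
  from Lp_tendsto_cong_AE [OF lim f this] vV show ?thesis by blast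
qed

lemma Lp_linear_diff:
  assumes "Lp_linear p \<Omega> F" "f \<in> Lp p \<Omega>" "g \<in> Lp p \<Omega>"
  shows "F (\<lambda>x. f x - g x) = F f - F g"
  using assms(1) [unfolded Lp_linear_def, rule_format, OF assms(2,3), of 1 "-1"] by simp

lemma Lp_linear_tendsto:
  assumes F: "Lp_linear p \<Omega> F" "\<And>f. f \<in> Lp p \<Omega> \<Longrightarrow> \<bar>F f\<bar> \<le> C * Lp_norm p \<Omega> f" and lim: "Lp_tendsto p \<Omega> f g"
  shows "(\<lambda>n. F (f n)) \<longlonglongrightarrow> F g"
proof -
  have f: "f n \<in> Lp p \<Omega>" and g: "g \<in> Lp p \<Omega>" and 0: "(\<lambda>n. Lp_norm p \<Omega> (\<lambda>x. f n x - g x)) \<longlonglongrightarrow> 0" for n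
    using lim by (auto simp: Lp_tendsto_def)
  have "(\<lambda>n. F (f n) - F g) \<longlonglongrightarrow> 0"
    using F(2) [OF Lp_diff [OF f g]] Lp_linear_diff [OF F(1) f g] by (intro tendsto_from_bound [OF _ 0]) simp
  then show ?thesis by (simp add: LIM_zero_iff)
qed

text \<open>The component \<open>r\<close> of some \<open>g\<close> orthogonal to the kernel of
  \<open>F\<close> spans the complement of the kernel; scaled by \<open>F r\<close> over its squared
  norm it represents \<open>F\<close>.\<close>

lemma L2_Riesz:
  fixes F :: "(real ^ 'n::finite \<Rightarrow> 'v::euclidean_space) \<Rightarrow> real"
  assumes fin: "finite_measure (lebesgue_on \<Omega>)"
    and lin: "Lp_linear 2 \<Omega> F" and bnd: "\<And>f. f \<in> Lp 2 \<Omega> \<Longrightarrow> \<bar>F f\<bar> \<le> C * Lp_norm 2 \<Omega> f"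
  shows "\<exists>a\<in>Lp 2 \<Omega>. \<forall>f\<in>Lp 2 \<Omega>. F f = (\<integral>x. a x \<bullet> f x \<partial>lebesgue_on \<Omega>)"
proof (cases "\<forall>f\<in>Lp 2 \<Omega>. F f = 0")
  case True
  then show ?thesis by (intro bexI [of _ "\<lambda>_. 0"]) (auto simp: Lp_zero)
next
  case False
  then obtain g where g: "g \<in> Lp 2 \<Omega>" "F g \<noteq> 0" by blast
  have linD: "F (\<lambda>x. a *\<^sub>R f x + b *\<^sub>R h x) = a * F f + b * F h" if "f \<in> Lp 2 \<Omega>" "h \<in> Lp 2 \<Omega>" for f h a b
    using lin that by (simp add: Lp_linear_def)
  define V where "V = {f \<in> Lp 2 \<Omega>. F f = 0}"
  have "F (\<lambda>_. 0) = 0" using linD [OF g(1) g(1), of 0 0] by simp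
  then have "\<exists>v p. (\<forall>n::nat. v n \<in> V) \<and> Lp_tendsto 2 \<Omega> v p \<and>
    (\<forall>w\<in>V. (\<integral>x. (g x - p x) \<bullet> w x \<partial>lebesgue_on \<Omega>) = 0)"
    by (intro L2_projection [OF fin g(1)]) (auto simp: V_def Lp_zero linD Lp_lincomb)
  then obtain v p where v: "\<And>n::nat. v n \<in> V" and lim: "Lp_tendsto 2 \<Omega> v p"
    and perp: "\<And>w. w \<in> V \<Longrightarrow> (\<integral>x. (g x - p x) \<bullet> w x \<partial>lebesgue_on \<Omega>) = 0" by blast
  have p: "p \<in> Lp 2 \<Omega>" using lim by (simp add: Lp_tendsto_def)
  have "(\<lambda>n. F (v n)) \<longlonglongrightarrow> F p" by (rule Lp_linear_tendsto [OF lin bnd lim])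
  \<comment> \<open>Boundedness of \<open>F\<close> makes the kernel closed, which puts the
    projection itself into it.\<close>
  then have Fp: "F p = 0" using v by (simp add: V_def LIMSEQ_const_iff)
  define r where "r x = g x - p x" for x
  have r: "r \<in> Lp 2 \<Omega>" unfolding r_def [abs_def] by (intro Lp_diff g p)
  have Fr: "F r = F g"
    using Lp_linear_diff [OF lin g(1) p] Fp by (simp add: r_def [abs_def])
  let ?R = "\<integral>x. r x \<bullet> r x \<partial>lebesgue_on \<Omega>"
  have "?R \<noteq> 0"
  proof
    assume "?R = 0"
    then have "Lp_norm 2 \<Omega> r = 0" by (simp add: Lp_norm_def power2_norm_eq_inner)
    with bnd [OF r] Fr g show False by simp
  qed
  have "F f = (\<integral>x. (F r / ?R) *\<^sub>R r x \<bullet> f x \<partial>lebesgue_on \<Omega>)" if f: "f \<in> Lp 2 \<Omega>" for f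
  proof -
    \<comment> \<open>The multiple of \<open>r\<close> with the same value under \<open>F\<close> is
      subtracted from \<open>f\<close>, so \<open>w\<close> lies in the kernel and is orthogonal to
      \<open>r\<close>.\<close>
    define w where "w x = 1 *\<^sub>R f x + (- (F f / F r)) *\<^sub>R r x" for x
    have "F w = 0"
      unfolding w_def [abs_def] linD [OF f r] using Fr g by simp
    moreover have "w \<in> Lp 2 \<Omega>"
      unfolding w_def [abs_def] by (intro Lp_lincomb f r)
    ultimately have "(\<integral>x. w x \<bullet> r x \<partial>lebesgue_on \<Omega>) = 0"
      using perp [of w] by (simp add: V_def r_def inner_commute)
    then have "(\<integral>x. f x \<bullet> r x \<partial>lebesgue_on \<Omega>) = F f / F r * ?R"
      unfolding w_def [abs_def] Lp_inner_lincomb [OF f r r] by simp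
    then show ?thesis
      using Fr g \<open>?R \<noteq> 0\<close> by (simp add: inner_commute)
  qed
  moreover have "(\<lambda>x. (F r / ?R) *\<^sub>R r x) \<in> Lp 2 \<Omega>" by (intro Lp_scaleR r)
  ultimately show ?thesis by (intro bexI [of _ "\<lambda>x. (F r / ?R) *\<^sub>R r x"]) auto
qed

subsection \<open>The fundamental lemma of the calculus of variations\<close>

text \<open>Bumps approximate indicators of boxes, so the integral of \<open>f\<close> over every
  closed box inside \<open>\<Omega>\<close> is 0. Lebesgue differentiation along shrinking cubes
  with one corner at \<open>x\<close> then recovers \<open>f x\<close> for almost every
  \<open>x\<close>.\<close>

lemma fundamental_lemma:
  fixes f :: "real ^ 'n::finite \<Rightarrow> real"
  assumes op: "open \<Omega>" and f: "integrable (lebesgue_on \<Omega>) f"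
    and orth: "\<And>\<psi>. \<psi> \<in> test_functions \<Omega> \<Longrightarrow> (\<integral>x. f x * \<psi> x \<partial>lebesgue_on \<Omega>) = 0"
  shows "AE x in lebesgue_on \<Omega>. f x = 0"
proof -
  have S: "\<Omega> \<in> sets lebesgue" using op by (simp add: borel_open)
  \<comment> \<open>Extension by zero, since the differentiation theorem is applied on the whole
    space.\<close>
  define F where "F x = (if x \<in> \<Omega> then f x else 0)" for x
  have F: "integrable lebesgue F"
    using f S by (simp add: F_def [abs_def] Lebesgue_Measure.integrable_restrict_UNIV)
  have box0: "integral (cbox a b) F = 0" if ab: "cbox a b \<subseteq> \<Omega>" for a b
  proof -
    have box: "box a b \<in> sets lebesgue" "box a b \<subseteq> \<Omega>"
      using ab box_subset_cbox [of a b] by auto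
    have "(\<lambda>n. \<integral>x. f x * box_bump a b (real (Suc n)) x \<partial>lebesgue_on \<Omega>)
        \<longlonglongrightarrow> (\<integral>x. f x * indicator (box a b) x \<partial>lebesgue_on \<Omega>)"
    proof (rule integral_dominated_convergence [where w = "\<lambda>x. norm (f x)"])
      have fm: "f \<in> borel_measurable (lebesgue_on \<Omega>)" using f by auto
      show "(\<lambda>x. f x * indicator (box a b) x) \<in> borel_measurable (lebesgue_on \<Omega>)"
        using box by (intro borel_measurable_times fm borel_measurable_indicator) (auto simp: sets_restrict_space)
      have "box_bump a b (real (Suc n)) \<in> borel_measurable (lebesgue_on \<Omega>)" for n
        using test_function_measurable [OF box_bump_test [OF _ ab]]
        by (intro measurable_restrict_space1 measurable_completion) auto
      then show "(\<lambda>x. f x * box_bump a b (real (Suc n)) x) \<in> borel_measurable (lebesgue_on \<Omega>)" for n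
        by (intro borel_measurable_times fm)
      show "integrable (lebesgue_on \<Omega>) (\<lambda>x. norm (f x))" using f by simp
      show "AE x in lebesgue_on \<Omega>. (\<lambda>n. f x * box_bump a b (real (Suc n)) x) \<longlonglongrightarrow> f x * indicator (box a b) x"
        by (intro AE_I2 tendsto_intros box_bump_tendsto)
      show "AE x in lebesgue_on \<Omega>. norm (f x * box_bump a b (real (Suc n)) x) \<le> norm (f x)" for n
        using box_bump_bounds [of a b "real (Suc n)"]
        by (intro AE_I2) (simp add: abs_mult mult_left_le del: of_nat_Suc)
    qed
    moreover have "(\<integral>x. f x * box_bump a b (real (Suc n)) x \<partial>lebesgue_on \<Omega>) = 0" for n
      using box_bump_test [OF _ ab] by (intro orth) auto
    ultimately have "0 = (\<integral>x. f x * indicator (box a b) x \<partial>lebesgue_on \<Omega>)"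
      by (simp add: LIMSEQ_const_iff)
    also have "\<dots> = (\<integral>x. (if x \<in> box a b then F x else 0) \<partial>lebesgue_on \<Omega>)"
      using box by (intro Bochner_Integration.integral_cong) (auto simp: F_def)
    also have "\<dots> = integral\<^sup>L (lebesgue_on (box a b)) F"
      using box S by (subst Lebesgue_Measure.integral_restrict_Int) (auto simp: Int_absorb2)
    also have "\<dots> = integral (box a b) F"
      using integrable_mult_indicator [OF box(1) F] box(1)
      by (intro lebesgue_integral_eq_integral) (simp_all add: integrable_restrict_space)
    finally show ?thesis by (simp add: integral_open_interval)
  qed
  have "F integrable_on cbox a b" for a b
    using integrable_on_lebesgue [OF F] by (rule integrable_on_subcbox) auto
  then obtain N where N: "negligible N" and
    lim: "\<And>x e. x \<notin> N \<Longrightarrow> 0 < e \<Longrightarrow> \<exists>d>0. \<forall>h. 0 < h \<and> h < d \<longrightarrow>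
      norm (integral (cbox x (x + h *\<^sub>R One)) F /\<^sub>R h ^ DIM(real ^ 'n) - F x) < e"
    using integrable_ccontinuous_explicit [of F] by blast
  have "f x = 0" if x: "x \<in> \<Omega>" "x \<notin> N" for x
  proof (rule ccontr)
    assume nz: "f x \<noteq> 0"
    then obtain d where d: "d > 0" "\<And>h. 0 < h \<Longrightarrow> h < d \<Longrightarrow>
        norm (integral (cbox x (x + h *\<^sub>R One)) F /\<^sub>R h ^ DIM(real ^ 'n) - F x) < \<bar>f x\<bar>"
      using lim [OF x(2), of "\<bar>f x\<bar>"] by auto
    obtain r where r: "r > 0" "ball x r \<subseteq> \<Omega>"
      using op x(1) openE by blast
    \<comment> \<open>\<open>c\<close> exceeds the diagonal of the unit cube, so a cube of side at
      most \<open>r / (2 * c)\<close> with corner \<open>x\<close> stays inside the ball of radius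
      \<open>r\<close>. The term \<open>d / 2\<close> keeps \<open>h\<close> strictly below
      \<open>d\<close>.\<close>
    define c where "c = norm (One :: real ^ 'n) + 1"
    have c: "c > 0" using norm_ge_zero [of "One :: real ^ 'n"] unfolding c_def by linarith
    define h where "h = min (d / 2) (r / (2 * c))"
    have "h \<le> d / 2" unfolding h_def by (rule min.cobounded1)
    moreover have "0 < d / 2" "0 < r / (2 * c)"
      using d(1) r(1) c by (auto intro!: divide_pos_pos)
    ultimately have h: "h > 0" "h < d"
      unfolding h_def min_less_iff_conj by (blast, linarith)
    have "cbox x (x + h *\<^sub>R One) \<subseteq> \<Omega>"
    proof
      fix y assume y: "y \<in> cbox x (x + h *\<^sub>R One)"
      have "norm (y - x) \<le> norm (h *\<^sub>R (One :: real ^ 'n))"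
      proof (rule norm_le_componentwise)
        fix b :: "real ^ 'n" assume b: "b \<in> Basis"
        have "x \<bullet> b \<le> y \<bullet> b" "y \<bullet> b \<le> x \<bullet> b + h"
          using y b by (auto simp: mem_box inner_simps)
        then show "\<bar>(y - x) \<bullet> b\<bar> \<le> \<bar>(h *\<^sub>R One) \<bullet> b\<bar>"
          using b h by (simp add: inner_simps)
      qed
      also have "\<dots> \<le> h * c" using h by (simp add: c_def)
      also have "\<dots> \<le> r / (2 * c) * c"
        using c by (intro mult_right_mono) (auto simp: h_def)
      also have "\<dots> < r" using c r(1) by simp
      finally show "y \<in> \<Omega>"
        using r(2) by (auto simp: dist_norm norm_minus_commute)
    qed
    from box0 [OF this] d(2) [OF h] x show False by (simp add: F_def)
  qed
  moreover have "AE x in lebesgue. x \<notin> N"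
    using N by (simp add: negligible_iff_null_sets AE_not_in)
  ultimately show ?thesis
    using S by (subst AE_restrict_space_iff) (auto elim!: eventually_mono)
qed

section \<open>Linear images and vector-valued functions\<close>

lemma Lp_bounded_linear:
  fixes T :: "'v::euclidean_space \<Rightarrow> 'w::euclidean_space"
  assumes T: "bounded_linear T" and f: "f \<in> Lp p \<Omega>"
  shows "(\<lambda>x. T (f x)) \<in> Lp p \<Omega>"
proof -
  obtain K where K: "\<And>v. norm (T v) \<le> norm v * K"
    using bounded_linear.bounded [OF T] by blast
  have "(\<lambda>x. T (f x)) \<in> borel_measurable (lebesgue_on \<Omega>)"
    using LpD(1) [OF f] linear_continuous_on [OF T, of UNIV]
    by (intro measurable_compose [of f _ borel T]) (auto intro: borel_measurable_continuous_onI)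
  moreover have "norm (T (f x)) ^ p \<le> norm (f x) ^ p * K ^ p" for x
    using power_mono [OF K norm_ge_zero, of "f x" p] by (simp add: power_mult_distrib)
  ultimately show ?thesis
    using LpD(2) [OF f] by (intro Lp_bound(1) [where g = "\<lambda>x. norm (f x) ^ p * K ^ p"]) auto
qed

lemma Lp_tendsto_bounded_linear:
  fixes T :: "'v::euclidean_space \<Rightarrow> 'w::euclidean_space"
  assumes T: "bounded_linear T" and lim: "Lp_tendsto p \<Omega> f g" and p: "p > 0"
  shows "Lp_tendsto p \<Omega> (\<lambda>m x. T (f m x)) (\<lambda>x. T (g x))"
proof -
  obtain K where K: "\<And>v. norm (T v) \<le> norm v * K"
    using bounded_linear.bounded [OF T] by blast
  have f: "f m \<in> Lp p \<Omega>" and g: "g \<in> Lp p \<Omega>"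
    and 0: "(\<lambda>m. \<integral>x. norm (f m x - g x) ^ p \<partial>lebesgue_on \<Omega>) \<longlonglongrightarrow> 0" for m
    using lim by (auto simp: Lp_tendsto_iff [OF p])
  have "(\<lambda>m. \<integral>x. norm (T (f m x) - T (g x)) ^ p \<partial>lebesgue_on \<Omega>) \<longlonglongrightarrow> 0"
  proof (rule tendsto_sandwich [OF _ _ tendsto_const])
    show "(\<lambda>m. (\<integral>x. norm (f m x - g x) ^ p \<partial>lebesgue_on \<Omega>) * K ^ p) \<longlonglongrightarrow> 0"
      by (rule tendsto_mult_left_zero [OF 0])
    have "norm (T (f m x) - T (g x)) ^ p \<le> norm (f m x - g x) ^ p * K ^ p" for m x
      using power_mono [OF K norm_ge_zero, of "f m x - g x" p]
      by (simp add: power_mult_distrib linear_diff [OF bounded_linear.linear [OF T]])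
    then have "(\<integral>x. norm (T (f m x) - T (g x)) ^ p \<partial>lebesgue_on \<Omega>)
        \<le> (\<integral>x. norm (f m x - g x) ^ p * K ^ p \<partial>lebesgue_on \<Omega>)" for m
      by (intro Lp_bound(2) LpD(1) [OF Lp_diff [OF Lp_bounded_linear [OF T f] Lp_bounded_linear [OF T g]]]
          integrable_mult_left LpD(2) [OF Lp_diff [OF f g]])
    then show "\<forall>\<^sub>F m in sequentially. (\<integral>x. norm (T (f m x) - T (g x)) ^ p \<partial>lebesgue_on \<Omega>)
        \<le> (\<integral>x. norm (f m x - g x) ^ p \<partial>lebesgue_on \<Omega>) * K ^ p"
      by simp
  qed simp
  then show ?thesis
    using Lp_bounded_linear [OF T f] Lp_bounded_linear [OF T g] by (simp add: Lp_tendsto_iff [OF p])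
qed

lemma Lp_component:
  fixes f :: "real ^ 'n::finite \<Rightarrow> 'v::euclidean_space ^ 'k::finite"
  shows "f \<in> Lp p \<Omega> \<Longrightarrow> (\<lambda>x. f x $ i) \<in> Lp p \<Omega>"
  by (rule Lp_bounded_linear [OF bounded_linear_vec_nth])

text \<open>The norm is bounded by the sum of the component norms, and each of these by the largest
  one, whose power is a single term of the sum on the right.\<close>

lemma norm_vec_power_le:
  fixes v :: "'v::euclidean_space ^ 'k::finite"
  shows "norm v ^ p \<le> real CARD('k) ^ p * (\<Sum>i\<in>UNIV. norm (v $ i) ^ p)"
proof -
  have "Max (range (\<lambda>i. norm (v $ i))) \<in> range (\<lambda>i. norm (v $ i))"
    by (intro Max_in) auto
  then obtain j where "Max (range (\<lambda>i. norm (v $ i))) = norm (v $ j)" by blast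
  then have j: "norm (v $ i) \<le> norm (v $ j)" for i
    using Max_ge [of "range (\<lambda>i. norm (v $ i))" "norm (v $ i)"] by simp
  have "norm v \<le> (\<Sum>i\<in>UNIV. norm (v $ i))"
    unfolding norm_vec_def by (intro L2_set_le_sum) auto
  also have "\<dots> \<le> real CARD('k) * norm (v $ j)"
    using sum_bounded_above [of UNIV "\<lambda>i. norm (v $ i)" "norm (v $ j)"] j by simp
  finally have "norm v ^ p \<le> (real CARD('k) * norm (v $ j)) ^ p"
    by (intro power_mono) auto
  also have "\<dots> = real CARD('k) ^ p * norm (v $ j) ^ p"
    by (simp add: power_mult_distrib)
  also have "\<dots> \<le> real CARD('k) ^ p * (\<Sum>i\<in>UNIV. norm (v $ i) ^ p)"
    by (intro mult_left_mono member_le_sum) auto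
  finally show ?thesis .
qed

lemma Lp_vec:
  fixes f :: "real ^ 'n::finite \<Rightarrow> 'v::euclidean_space ^ 'k::finite"
  assumes "\<And>i. (\<lambda>x. f x $ i) \<in> Lp p \<Omega>"
  shows "f \<in> Lp p \<Omega>"
    "(\<integral>x. norm (f x) ^ p \<partial>lebesgue_on \<Omega>)
       \<le> real CARD('k) ^ p * (\<Sum>i\<in>UNIV. \<integral>x. norm (f x $ i) ^ p \<partial>lebesgue_on \<Omega>)"
proof -
  have "f \<in> borel_measurable (lebesgue_on \<Omega>)"
  proof (subst borel_measurable_euclidean_space, rule ballI)
    fix b :: "'v ^ 'k" assume "b \<in> Basis"
    then obtain i c where "b = axis i c" by (auto simp: Basis_vec_def)
    then show "(\<lambda>x. f x \<bullet> b) \<in> borel_measurable (lebesgue_on \<Omega>)"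
      using LpD(1) [OF assms [of i]] by (simp add: inner_axis)
  qed
  moreover have "integrable (lebesgue_on \<Omega>) (\<lambda>x. real CARD('k) ^ p * (\<Sum>i\<in>UNIV. norm (f x $ i) ^ p))"
    by (intro integrable_mult_right Bochner_Integration.integrable_sum LpD(2) [OF assms])
  moreover have "(\<integral>x. real CARD('k) ^ p * (\<Sum>i\<in>UNIV. norm (f x $ i) ^ p) \<partial>lebesgue_on \<Omega>)
      = real CARD('k) ^ p * (\<Sum>i\<in>UNIV. \<integral>x. norm (f x $ i) ^ p \<partial>lebesgue_on \<Omega>)"
    by (simp add: Bochner_Integration.integral_sum LpD(2) [OF assms])
  ultimately show "f \<in> Lp p \<Omega>" "(\<integral>x. norm (f x) ^ p \<partial>lebesgue_on \<Omega>)
       \<le> real CARD('k) ^ p * (\<Sum>i\<in>UNIV. \<integral>x. norm (f x $ i) ^ p \<partial>lebesgue_on \<Omega>)"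
    using Lp_bound [OF _ _ norm_vec_power_le] by metis+
qed

lemma Lp_tendsto_vec:
  fixes f :: "nat \<Rightarrow> real ^ 'n::finite \<Rightarrow> 'v::euclidean_space ^ 'k::finite"
  assumes p: "p > 0" and lim: "\<And>i. Lp_tendsto p \<Omega> (\<lambda>m x. f m x $ i) (\<lambda>x. g x $ i)"
  shows "Lp_tendsto p \<Omega> f g"
proof -
  have f: "(\<lambda>x. f m x $ i) \<in> Lp p \<Omega>" and g: "(\<lambda>x. g x $ i) \<in> Lp p \<Omega>"
    and 0: "(\<lambda>m. \<integral>x. norm (f m x $ i - g x $ i) ^ p \<partial>lebesgue_on \<Omega>) \<longlonglongrightarrow> 0" for m i
    using lim by (auto simp: Lp_tendsto_iff [OF p])
  have "(\<lambda>m. \<integral>x. norm (f m x - g x) ^ p \<partial>lebesgue_on \<Omega>) \<longlonglongrightarrow> 0"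
  proof (rule tendsto_sandwich [OF _ _ tendsto_const])
    have "(\<lambda>m. real CARD('k) ^ p * (\<Sum>i\<in>UNIV. \<integral>x. norm (f m x $ i - g x $ i) ^ p \<partial>lebesgue_on \<Omega>))
      \<longlonglongrightarrow> real CARD('k) ^ p * (\<Sum>i\<in>(UNIV :: 'k set). 0)"
      by (intro tendsto_intros 0)
    then show "(\<lambda>m. real CARD('k) ^ p * (\<Sum>i\<in>UNIV. \<integral>x. norm (f m x $ i - g x $ i) ^ p \<partial>lebesgue_on \<Omega>)) \<longlonglongrightarrow> 0"
      by simp
    show "\<forall>\<^sub>F m in sequentially. (\<integral>x. norm (f m x - g x) ^ p \<partial>lebesgue_on \<Omega>)
      \<le> real CARD('k) ^ p * (\<Sum>i\<in>UNIV. \<integral>x. norm (f m x $ i - g x $ i) ^ p \<partial>lebesgue_on \<Omega>)"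
      using Lp_vec(2) [of "\<lambda>x. f m x - g x" p \<Omega> for m] Lp_diff [OF f g] by simp
  qed simp
  with Lp_vec(1) [OF f] Lp_vec(1) [OF g] show ?thesis by (simp add: Lp_tendsto_iff [OF p])
qed

text \<open>Pairs carry the sum of the two inner products, so that a function and its Hessian can be
  approximated simultaneously by \<open>L2_biorthogonal\<close>.\<close>

lemma Lp_Pair:
  assumes "f \<in> Lp 2 \<Omega>" "g \<in> Lp 2 \<Omega>"
  shows "(\<lambda>x. (f x, g x)) \<in> Lp 2 \<Omega>"
  using assms by (auto simp: Lp_def norm_Pair)

lemma AE_vec_eqI:
  fixes f g :: "'a \<Rightarrow> 'v ^ 'k::finite"
  assumes "\<And>i. AE x in M. f x $ i = g x $ i"
  shows "AE x in M. f x = g x"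
proof -
  have "AE x in M. \<forall>i\<in>UNIV. f x $ i = g x $ i"
    by (intro AE_finite_allI assms) auto
  then show ?thesis by eventually_elim (simp add: vec_eq_iff)
qed

subsection \<open>Weak derivatives\<close>

definition test_grad :: "(real ^ 'n::finite \<Rightarrow> real) \<Rightarrow> real ^ 'n \<Rightarrow> real ^ 'n" where
  "test_grad \<psi> x = (\<chi> i. partial_deriv i \<psi> x)"

definition test_hess :: "(real ^ 'n::finite \<Rightarrow> real) \<Rightarrow> real ^ 'n \<Rightarrow> real ^ 'n ^ 'n" where
  "test_hess \<psi> x = (\<chi> i j. partial_deriv i (partial_deriv j \<psi>) x)"

text \<open>The trace of a Hessian is the Laplacian, that is, the divergence of the gradient; it
  enters when norms of gradients are computed by parts.\<close>

definition mat_trace :: "real ^ 'n::finite ^ 'n \<Rightarrow> real" where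
  "mat_trace M = (\<Sum>i\<in>UNIV. M $ i $ i)"

lemma bounded_linear_entry: "bounded_linear (\<lambda>M::real ^ 'n::finite ^ 'm::finite. M $ i $ j)"
  by (rule bounded_linear_compose [OF bounded_linear_vec_nth bounded_linear_vec_nth])

lemma bounded_linear_mat_trace: "bounded_linear (mat_trace :: real ^ 'n::finite ^ 'n \<Rightarrow> real)"
  unfolding mat_trace_def [abs_def] by (intro bounded_linear_sum bounded_linear_entry)

lemma bounded_linear_axis: "bounded_linear (axis i :: 'v::euclidean_space \<Rightarrow> 'v ^ 'k::finite)"
  by (intro linear_conv_bounded_linear [THEN iffD1] linearI) (auto simp: axis_def vec_eq_iff)

lemma Lp_entry: "f \<in> Lp p \<Omega> \<Longrightarrow> (\<lambda>x. f x $ i $ j) \<in> Lp p \<Omega>"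
  for f :: "real ^ 'n::finite \<Rightarrow> real ^ 'a::finite ^ 'b::finite"
  by (rule Lp_bounded_linear [OF bounded_linear_entry])

lemma Lp_mult_integrable:
  fixes f g :: "real ^ 'n::finite \<Rightarrow> real"
  shows "f \<in> Lp 2 \<Omega> \<Longrightarrow> g \<in> Lp 2 \<Omega> \<Longrightarrow> integrable (lebesgue_on \<Omega>) (\<lambda>x. f x * g x)"
  using Lp_inner_integrable [of f \<Omega> g] by simp

lemma Lp_vec_inner_integral:
  fixes f g :: "real ^ 'n::finite \<Rightarrow> 'v::euclidean_space ^ 'k::finite"
  assumes "f \<in> Lp 2 \<Omega>" "g \<in> Lp 2 \<Omega>"
  shows "(\<integral>x. f x \<bullet> g x \<partial>lebesgue_on \<Omega>) = (\<Sum>i\<in>UNIV. \<integral>x. f x $ i \<bullet> g x $ i \<partial>lebesgue_on \<Omega>)"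
  unfolding inner_vec_def
  by (intro Bochner_Integration.integral_sum Lp_inner_integrable Lp_component assms)

locale finite_domain =
  fixes \<Omega> :: "(real ^ 'n::finite) set"
  assumes op: "open \<Omega>" and fin: "finite_measure (lebesgue_on \<Omega>)"
begin

lemma test_Lp:
  assumes "\<psi> \<in> test_functions \<Omega>"
  shows "\<psi> \<in> Lp p \<Omega>"
proof -
  obtain M where M: "\<And>x. \<bar>\<psi> x\<bar> \<le> M" using test_function_bounded [OF assms] by blast
  have "\<psi> \<in> borel_measurable (lebesgue_on \<Omega>)"
    using test_function_measurable [OF assms] by (intro measurable_restrict_space1 measurable_completion) auto
  moreover have "integrable (lebesgue_on \<Omega>) (\<lambda>_. M ^ p)"
    using fin by (simp add: finite_measure.integrable_const)
  moreover have "norm (\<psi> x) ^ p \<le> M ^ p" for x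
    using M [of x] by (intro power_mono) auto
  ultimately show ?thesis by (rule Lp_bound(1))
qed

text \<open>From \<open>(t\<^sup>2 - 1)\<^sup>2 \<ge> 0\<close>, together with the integrability of
  constants on a space of finite measure.\<close>

lemma L4_L2:
  assumes "f \<in> Lp 4 \<Omega>"
  shows "f \<in> Lp 2 \<Omega>"
proof (rule Lp_bound(1))
  show "integrable (lebesgue_on \<Omega>) (\<lambda>x. 1 + norm (f x) ^ 4)"
    using LpD(2) [OF assms] fin by (auto simp: finite_measure.integrable_const)
  fix x
  have "0 \<le> (norm (f x) ^ 2 - 1)\<^sup>2" by simp
  moreover have "(norm (f x) ^ 2 - 1)\<^sup>2 = norm (f x) ^ 4 + 1 - 2 * norm (f x) ^ 2"
    by (simp add: power2_diff flip: power_mult)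
  moreover have "0 \<le> norm (f x) ^ 4" by simp
  ultimately show "norm (f x) ^ 2 \<le> 1 + norm (f x) ^ 4" by linarith
qed (rule LpD(1) [OF assms])

lemma test_test_integral:
  assumes "\<psi> \<in> test_functions \<Omega>" "\<eta> \<in> test_functions \<Omega>"
  shows "(\<integral>x. \<psi> x * \<eta> x \<partial>lebesgue_on \<Omega>) = (\<integral>x. \<psi> x * \<eta> x \<partial>lborel)"
  by (rule test_function_integral [OF test_functions_mult [OF assms] op])

lemma test_UNIV: "\<psi> \<in> test_functions \<Omega> \<Longrightarrow> \<psi> \<in> test_functions UNIV"
  using test_functions_mono [of \<Omega> UNIV] by blast

lemma test_by_parts:
  assumes "\<psi> \<in> test_functions \<Omega>" "\<eta> \<in> test_functions \<Omega>"
  shows "(\<integral>x. \<psi> x * partial_deriv i \<eta> x \<partial>lebesgue_on \<Omega>) = - (\<integral>x. partial_deriv i \<psi> x * \<eta> x \<partial>lebesgue_on \<Omega>)"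
  using integral_by_parts_test [OF assms [THEN test_UNIV]] assms
  by (simp add: test_test_integral test_functions_partial_deriv)

lemma test_by_parts_twice:
  assumes "\<psi> \<in> test_functions \<Omega>" "\<eta> \<in> test_functions \<Omega>"
  shows "(\<integral>x. \<psi> x * partial_deriv i (partial_deriv j \<eta>) x \<partial>lebesgue_on \<Omega>)
    = (\<integral>x. partial_deriv i (partial_deriv j \<psi>) x * \<eta> x \<partial>lebesgue_on \<Omega>)"
  using integral_by_parts_twice [OF assms [THEN test_UNIV]] assms
  by (simp add: test_test_integral test_functions_partial_deriv)

lemma AE_eq_by_test:
  fixes f g :: "real ^ 'n \<Rightarrow> real"
  assumes f: "f \<in> Lp 2 \<Omega>" and g: "g \<in> Lp 2 \<Omega>"
    and eq: "\<And>\<psi>. \<psi> \<in> test_functions \<Omega> \<Longrightarrow>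
      (\<integral>x. f x * \<psi> x \<partial>lebesgue_on \<Omega>) = (\<integral>x. g x * \<psi> x \<partial>lebesgue_on \<Omega>)"
  shows "AE x in lebesgue_on \<Omega>. f x = g x"
proof -
  \<comment> \<open>Pairing with the constant 1 makes L2 functions integrable, as
    \<open>fundamental_lemma\<close> requires.\<close>
  have "(\<lambda>_. 1::real) \<in> Lp 2 \<Omega>"
    using fin by (simp add: Lp_def finite_measure.integrable_const)
  from Lp_mult_integrable [OF Lp_diff [OF f g] this]
  have "integrable (lebesgue_on \<Omega>) (\<lambda>x. f x - g x)" by simp
  moreover have "(\<integral>x. (f x - g x) * \<psi> x \<partial>lebesgue_on \<Omega>) = 0" if "\<psi> \<in> test_functions \<Omega>" for \<psi>
    using eq [OF that] Lp_mult_integrable [OF f test_Lp [OF that]] Lp_mult_integrable [OF g test_Lp [OF that]]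
    by (simp add: left_diff_distrib)
  ultimately have "AE x in lebesgue_on \<Omega>. f x - g x = 0"
    by (rule fundamental_lemma [OF op])
  then show ?thesis by eventually_elim simp
qed

text \<open>Any candidate \<open>g\<close> shows that the choice in the definition is not void, and
  \<open>AE_eq_by_test\<close>, applied to each coordinate, identifies the chosen function with
  \<open>g\<close>. The next three lemmas remove the other choices in the same way.\<close>

lemma weak_gradient:
  assumes g: "g \<in> Lp 2 \<Omega>" "is_weak_gradient \<Omega> u g"
  shows "weak_gradient \<Omega> u \<in> Lp 2 \<Omega>" "is_weak_gradient \<Omega> u (weak_gradient \<Omega> u)"
    "AE x in lebesgue_on \<Omega>. weak_gradient \<Omega> u x = g x"
proof -
  have w: "weak_gradient \<Omega> u \<in> Lp 2 \<Omega> \<and> is_weak_gradient \<Omega> u (weak_gradient \<Omega> u)"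
    unfolding weak_gradient_def by (rule someI [of _ g]) (use g in blast)
  then show w1: "weak_gradient \<Omega> u \<in> Lp 2 \<Omega>" and w2: "is_weak_gradient \<Omega> u (weak_gradient \<Omega> u)"
    by auto
  show "AE x in lebesgue_on \<Omega>. weak_gradient \<Omega> u x = g x"
  proof (intro AE_vec_eqI AE_eq_by_test Lp_component w1 g(1))
    fix i \<psi> assume "\<psi> \<in> test_functions \<Omega>"
    then show "(\<integral>x. weak_gradient \<Omega> u x $ i * \<psi> x \<partial>lebesgue_on \<Omega>) = (\<integral>x. g x $ i * \<psi> x \<partial>lebesgue_on \<Omega>)"
      using w2 [unfolded is_weak_gradient_def, rule_format, of \<psi> i]
        g(2) [unfolded is_weak_gradient_def, rule_format, of \<psi> i] by simp
  qed
qed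

lemma weak_hessian:
  assumes h: "h \<in> Lp 2 \<Omega>" "is_weak_hessian \<Omega> u h"
  shows "weak_hessian \<Omega> u \<in> Lp 2 \<Omega>" "is_weak_hessian \<Omega> u (weak_hessian \<Omega> u)"
    "AE x in lebesgue_on \<Omega>. weak_hessian \<Omega> u x = h x"
proof -
  have w: "weak_hessian \<Omega> u \<in> Lp 2 \<Omega> \<and> is_weak_hessian \<Omega> u (weak_hessian \<Omega> u)"
    unfolding weak_hessian_def by (rule someI [of _ h]) (use h in blast)
  then show w1: "weak_hessian \<Omega> u \<in> Lp 2 \<Omega>" and w2: "is_weak_hessian \<Omega> u (weak_hessian \<Omega> u)"
    by auto
  show "AE x in lebesgue_on \<Omega>. weak_hessian \<Omega> u x = h x"
  proof (intro AE_vec_eqI AE_eq_by_test Lp_entry w1 h(1))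
    fix i j \<psi> assume "\<psi> \<in> test_functions \<Omega>"
    then show "(\<integral>x. weak_hessian \<Omega> u x $ i $ j * \<psi> x \<partial>lebesgue_on \<Omega>) = (\<integral>x. h x $ i $ j * \<psi> x \<partial>lebesgue_on \<Omega>)"
      using w2 [unfolded is_weak_hessian_def, rule_format, of \<psi> i j]
        h(2) [unfolded is_weak_hessian_def, rule_format, of \<psi> i j] by simp
  qed
qed

lemma weak_div:
  assumes f: "f \<in> Lp 2 \<Omega>" "is_weak_div \<Omega> \<phi> f"
  shows "weak_div \<Omega> \<phi> \<in> Lp 2 \<Omega>" "AE x in lebesgue_on \<Omega>. weak_div \<Omega> \<phi> x = f x"
proof -
  have w: "weak_div \<Omega> \<phi> \<in> Lp 2 \<Omega> \<and> is_weak_div \<Omega> \<phi> (weak_div \<Omega> \<phi>)"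
    unfolding weak_div_def by (rule someI [of _ f]) (use f in blast)
  then show w1: "weak_div \<Omega> \<phi> \<in> Lp 2 \<Omega>" by auto
  show "AE x in lebesgue_on \<Omega>. weak_div \<Omega> \<phi> x = f x"
  proof (intro AE_eq_by_test w1 f(1))
    fix \<psi> assume "\<psi> \<in> test_functions \<Omega>"
    then show "(\<integral>x. weak_div \<Omega> \<phi> x * \<psi> x \<partial>lebesgue_on \<Omega>) = (\<integral>x. f x * \<psi> x \<partial>lebesgue_on \<Omega>)"
      using w [THEN conjunct2, unfolded is_weak_div_def, rule_format, of \<psi>]
        f(2) [unfolded is_weak_div_def, rule_format, of \<psi>] by simp
  qed
qed

lemma weak_hess_contr:
  assumes f: "f \<in> Lp 2 \<Omega>" "is_weak_hess_contr \<Omega> \<xi> f"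
  shows "weak_hess_contr \<Omega> \<xi> \<in> Lp 2 \<Omega>" "AE x in lebesgue_on \<Omega>. weak_hess_contr \<Omega> \<xi> x = f x"
proof -
  have w: "weak_hess_contr \<Omega> \<xi> \<in> Lp 2 \<Omega> \<and> is_weak_hess_contr \<Omega> \<xi> (weak_hess_contr \<Omega> \<xi>)"
    unfolding weak_hess_contr_def by (rule someI [of _ f]) (use f in blast)
  then show w1: "weak_hess_contr \<Omega> \<xi> \<in> Lp 2 \<Omega>" by auto
  show "AE x in lebesgue_on \<Omega>. weak_hess_contr \<Omega> \<xi> x = f x"
  proof (intro AE_eq_by_test w1 f(1))
    fix \<psi> assume "\<psi> \<in> test_functions \<Omega>"
    then show "(\<integral>x. weak_hess_contr \<Omega> \<xi> x * \<psi> x \<partial>lebesgue_on \<Omega>) = (\<integral>x. f x * \<psi> x \<partial>lebesgue_on \<Omega>)"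
      using w [THEN conjunct2, unfolded is_weak_hess_contr_def, rule_format, of \<psi>]
        f(2) [unfolded is_weak_hess_contr_def, rule_format, of \<psi>] by simp
  qed
qed

lemma test_grad_Lp: "\<psi> \<in> test_functions \<Omega> \<Longrightarrow> test_grad \<psi> \<in> Lp p \<Omega>"
  by (intro Lp_vec(1)) (simp add: test_grad_def test_Lp test_functions_partial_deriv)

lemma test_hess_Lp: "\<psi> \<in> test_functions \<Omega> \<Longrightarrow> test_hess \<psi> \<in> Lp p \<Omega>"
  by (intro Lp_vec(1)) (simp add: test_hess_def test_Lp test_functions_partial_deriv)

lemma test_hess_lincomb:
  assumes "\<psi> \<in> test_functions \<Omega>" "\<eta> \<in> test_functions \<Omega>"
  shows "test_hess (\<lambda>x. a * \<psi> x + b * \<eta> x) x = a *\<^sub>R test_hess \<psi> x + b *\<^sub>R test_hess \<eta> x"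
proof -
  have "partial_deriv j (\<lambda>x. a * \<psi> x + b * \<eta> x) = (\<lambda>x. a * partial_deriv j \<psi> x + b * partial_deriv j \<eta> x)" for j
    using assms [THEN test_functionsD(2)] by (auto simp: partial_deriv_lincomb)
  then show ?thesis
    using assms [THEN test_functions_partial_deriv, THEN test_functionsD(2)]
    by (simp add: test_hess_def vec_eq_iff partial_deriv_lincomb)
qed

lemma test_weak_gradient: "\<psi> \<in> test_functions \<Omega> \<Longrightarrow> is_weak_gradient \<Omega> \<psi> (test_grad \<psi>)"
  by (simp add: is_weak_gradient_def test_grad_def test_by_parts)

lemma test_weak_hessian: "\<psi> \<in> test_functions \<Omega> \<Longrightarrow> is_weak_hessian \<Omega> \<psi> (test_hess \<psi>)"
  by (simp add: is_weak_hessian_def test_hess_def test_by_parts_twice)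

lemma is_weak_gradient_diff:
  assumes "is_weak_gradient \<Omega> u g" "is_weak_gradient \<Omega> v k"
    "u \<in> Lp 2 \<Omega>" "v \<in> Lp 2 \<Omega>" "g \<in> Lp 2 \<Omega>" "k \<in> Lp 2 \<Omega>"
  shows "is_weak_gradient \<Omega> (\<lambda>x. u x - v x) (\<lambda>x. g x - k x)"
  using assms unfolding is_weak_gradient_def
  by (simp add: left_diff_distrib Lp_mult_integrable test_Lp test_functions_partial_deriv Lp_component)

lemma is_weak_hessian_diff:
  assumes "is_weak_hessian \<Omega> u g" "is_weak_hessian \<Omega> v k"
    "u \<in> Lp 2 \<Omega>" "v \<in> Lp 2 \<Omega>" "g \<in> Lp 2 \<Omega>" "k \<in> Lp 2 \<Omega>"
  shows "is_weak_hessian \<Omega> (\<lambda>x. u x - v x) (\<lambda>x. g x - k x)"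
  using assms unfolding is_weak_hessian_def
  by (simp add: left_diff_distrib Lp_mult_integrable test_Lp test_functions_partial_deriv Lp_entry)

text \<open>Fields with a single nonzero coordinate \<open>\<psi>\<close> turn an identity over
  \<open>Hdiv\<close> into the defining identity of a weak gradient.\<close>

lemma test_field_div:
  assumes \<psi>: "\<psi> \<in> test_functions \<Omega>"
  shows "(\<lambda>x. axis i (\<psi> x)) \<in> Hdiv \<Omega>"
    "is_weak_div \<Omega> (\<lambda>x. axis i (\<psi> x)) (partial_deriv i \<psi>)"
proof -
  have "(\<lambda>x. axis i (\<psi> x) :: real ^ 'n) \<in> Lp 2 \<Omega>"
    by (intro Lp_bounded_linear [OF bounded_linear_axis] test_Lp \<psi>)
  moreover have "is_weak_div \<Omega> (\<lambda>x. axis i (\<psi> x)) (partial_deriv i \<psi>)"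
    by (auto simp: is_weak_div_def axis_def if_distrib [of "\<lambda>a. a * b" for b] cong: if_cong
        intro!: test_by_parts \<psi>)
  moreover have "partial_deriv i \<psi> \<in> Lp 2 \<Omega>"
    by (intro test_Lp test_functions_partial_deriv \<psi>)
  ultimately show "(\<lambda>x. axis i (\<psi> x)) \<in> Hdiv \<Omega>"
    "is_weak_div \<Omega> (\<lambda>x. axis i (\<psi> x)) (partial_deriv i \<psi>)"
    by (auto simp: Hdiv_def)
qed

text \<open>Single-entry matrix fields serve twice: they recover the defining identity of a weak
  Hessian, and their annihilator in L2 is trivial, which gives density.\<close>

lemma test_field_hess_contr:
  assumes \<psi>: "\<psi> \<in> test_functions \<Omega>"
  shows "(\<lambda>x. axis i (axis j (\<psi> x))) \<in> Hhess \<Omega>"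
    "is_weak_hess_contr \<Omega> (\<lambda>x. axis i (axis j (\<psi> x))) (partial_deriv i (partial_deriv j \<psi>))"
proof -
  have "(\<lambda>x. axis i (axis j (\<psi> x)) :: real ^ 'n ^ 'n) \<in> Lp 2 \<Omega>"
    by (intro Lp_bounded_linear [OF bounded_linear_axis] test_Lp \<psi>)
  moreover have "(\<Sum>a\<in>UNIV. \<Sum>b\<in>UNIV. (axis i (axis j t) :: real ^ 'n ^ 'n) $ a $ b * c a b) = t * c i j" for t c
  proof -
    have "(\<Sum>b\<in>UNIV. (axis i (axis j t) :: real ^ 'n ^ 'n) $ a $ b * c a b) = (if a = i then t * c i j else 0)" for a
      by (auto simp: axis_def if_distrib [of "\<lambda>a. a * b" for b] cong: if_cong)
    then show ?thesis by simp
  qed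
  then have "is_weak_hess_contr \<Omega> (\<lambda>x. axis i (axis j (\<psi> x))) (partial_deriv i (partial_deriv j \<psi>))"
    by (simp add: is_weak_hess_contr_def test_by_parts_twice \<psi>)
  moreover have "partial_deriv i (partial_deriv j \<psi>) \<in> Lp 2 \<Omega>"
    by (intro test_Lp test_functions_partial_deriv \<psi>)
  ultimately show "(\<lambda>x. axis i (axis j (\<psi> x))) \<in> Hhess \<Omega>"
    "is_weak_hess_contr \<Omega> (\<lambda>x. axis i (axis j (\<psi> x))) (partial_deriv i (partial_deriv j \<psi>))"
    by (auto simp: Hhess_def)
qed

lemma L2_inner_cong_AE:
  fixes f g h :: "real ^ 'n \<Rightarrow> 'v::euclidean_space"
  assumes "f \<in> Lp 2 \<Omega>" "g \<in> Lp 2 \<Omega>" "h \<in> Lp 2 \<Omega>" "AE x in lebesgue_on \<Omega>. f x = g x"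
  shows "(\<integral>x. f x \<bullet> h x \<partial>lebesgue_on \<Omega>) = (\<integral>x. g x \<bullet> h x \<partial>lebesgue_on \<Omega>)"
  using assms by (intro integral_cong_AE) (auto intro!: borel_measurable_integrable Lp_inner_integrable elim!: eventually_mono)

end

text \<open>The error of the second factor is absorbed by the bound on the first; the error of the
  first is paired with a fixed function.\<close>

lemma Lp_tendsto_inner2:
  fixes f f' :: "nat \<Rightarrow> real ^ 'n::finite \<Rightarrow> 'v::euclidean_space"
  assumes "Lp_tendsto 2 \<Omega> f g" "Lp_tendsto 2 \<Omega> f' g'"
  shows "(\<lambda>n. \<integral>x. f n x \<bullet> f' n x \<partial>lebesgue_on \<Omega>) \<longlonglongrightarrow> (\<integral>x. g x \<bullet> g' x \<partial>lebesgue_on \<Omega>)"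
proof -
  have f: "f n \<in> Lp 2 \<Omega>" and g: "g \<in> Lp 2 \<Omega>" and f': "f' n \<in> Lp 2 \<Omega>" and g': "g' \<in> Lp 2 \<Omega>"
    and 0: "(\<lambda>n. Lp_norm 2 \<Omega> (\<lambda>x. f' n x - g' x)) \<longlonglongrightarrow> 0" for n
    using assms by (auto simp: Lp_tendsto_def)
  obtain C where C: "\<And>n. Lp_norm 2 \<Omega> (f n) \<le> C"
    using Lp_tendsto_bounded [OF assms(1)] by auto
  have "(\<lambda>n. \<integral>x. f n x \<bullet> (f' n x - g' x) \<partial>lebesgue_on \<Omega>) \<longlonglongrightarrow> 0"
  proof (rule tendsto_from_bound [OF _ 0])
    show "\<bar>\<integral>x. f n x \<bullet> (f' n x - g' x) \<partial>lebesgue_on \<Omega>\<bar> \<le> C * Lp_norm 2 \<Omega> (\<lambda>x. f' n x - g' x)" for n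
      by (rule order_trans [OF L2_Cauchy_Schwarz [OF f Lp_diff [OF f' g']]])
        (intro mult_right_mono C Lp_norm_nonneg, simp)
  qed
  moreover have "(\<integral>x. f n x \<bullet> (f' n x - g' x) \<partial>lebesgue_on \<Omega>)
      = (\<integral>x. f n x \<bullet> f' n x \<partial>lebesgue_on \<Omega>) - (\<integral>x. f n x \<bullet> g' x \<partial>lebesgue_on \<Omega>)" for n
    using Lp_inner_diff [OF f' g' f] by (simp add: inner_commute)
  ultimately have "(\<lambda>n. ((\<integral>x. f n x \<bullet> f' n x \<partial>lebesgue_on \<Omega>) - (\<integral>x. f n x \<bullet> g' x \<partial>lebesgue_on \<Omega>))
      + (\<integral>x. f n x \<bullet> g' x \<partial>lebesgue_on \<Omega>)) \<longlonglongrightarrow> 0 + (\<integral>x. g x \<bullet> g' x \<partial>lebesgue_on \<Omega>)"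
    by (intro tendsto_add Lp_tendsto_inner [OF assms(1) g']) simp
  then show ?thesis by simp
qed

context finite_domain
begin

text \<open>The limit pair \<open>(u, h)\<close> annihilates the annihilator of \<open>{(\<psi>, \<H> \<psi>)}\<close>, hence lies in the closure of
  this subspace; no regularity of the boundary is needed.  The gradients then converge because \<open>g\<close> itself
  is an admissible field in \<open>hdiv\<close>, its divergence being the trace of \<open>h\<close>.\<close>

proposition H20_identification:
  fixes u :: "real ^ 'n \<Rightarrow> real"
  assumes u: "u \<in> Lp 2 \<Omega>" and g: "g \<in> Lp 2 \<Omega>" and h: "h \<in> Lp 2 \<Omega>"
    and hdiv: "\<And>\<phi>. \<phi> \<in> Hdiv \<Omega> \<Longrightarrow> (\<integral>x. g x \<bullet> \<phi> x + u x * weak_div \<Omega> \<phi> x \<partial>lebesgue_on \<Omega>) = 0"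
    and hhess: "\<And>\<xi>. \<xi> \<in> Hhess \<Omega> \<Longrightarrow> (\<integral>x. weak_hess_contr \<Omega> \<xi> x * u x - \<xi> x \<bullet> h x \<partial>lebesgue_on \<Omega>) = 0"
  shows "u \<in> H20 \<Omega>" "AE x in lebesgue_on \<Omega>. weak_gradient \<Omega> u x = g x"
    "AE x in lebesgue_on \<Omega>. weak_hessian \<Omega> u x = h x"
proof -
  let ?M = "lebesgue_on \<Omega>"
  \<comment> \<open>The hypothesis speaks of the divergence selected by choice; this form accepts
    any function \<open>f\<close> representing it.\<close>
  have div_eq: "(\<integral>x. g x \<bullet> \<phi> x \<partial>?M) = - (\<integral>x. u x * f x \<partial>?M)"
    if \<phi>: "\<phi> \<in> Lp 2 \<Omega>" and f: "f \<in> Lp 2 \<Omega>" "is_weak_div \<Omega> \<phi> f" for \<phi> f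
  proof -
    have "\<phi> \<in> Hdiv \<Omega>" using that by (auto simp: Hdiv_def)
    then have "(\<integral>x. g x \<bullet> \<phi> x \<partial>?M) + (\<integral>x. u x * weak_div \<Omega> \<phi> x \<partial>?M) = 0"
      using hdiv [of \<phi>] Lp_inner_integrable [OF g \<phi>] Lp_mult_integrable [OF u weak_div(1) [OF f]]
      by simp
    moreover have "(\<integral>x. u x * weak_div \<Omega> \<phi> x \<partial>?M) = (\<integral>x. u x * f x \<partial>?M)"
      using L2_inner_cong_AE [OF weak_div(1) [OF f] f(1) u weak_div(2) [OF f]]
      by (simp add: mult.commute)
    ultimately show ?thesis by simp
  qed
  have hess_eq: "(\<integral>x. \<xi> x \<bullet> h x \<partial>?M) = (\<integral>x. f x * u x \<partial>?M)"
    if \<xi>: "\<xi> \<in> Lp 2 \<Omega>" and f: "f \<in> Lp 2 \<Omega>" "is_weak_hess_contr \<Omega> \<xi> f" for \<xi> f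
  proof -
    have "\<xi> \<in> Hhess \<Omega>" using that by (auto simp: Hhess_def)
    then have "(\<integral>x. weak_hess_contr \<Omega> \<xi> x * u x \<partial>?M) - (\<integral>x. \<xi> x \<bullet> h x \<partial>?M) = 0"
      using hhess [of \<xi>] Lp_inner_integrable [OF \<xi> h] Lp_mult_integrable [OF weak_hess_contr(1) [OF f] u]
      by simp
    moreover have "(\<integral>x. weak_hess_contr \<Omega> \<xi> x * u x \<partial>?M) = (\<integral>x. f x * u x \<partial>?M)"
      using L2_inner_cong_AE [OF weak_hess_contr(1) [OF f] f(1) u weak_hess_contr(2) [OF f]]
      by simp
    ultimately show ?thesis by simp
  qed
  have axis_inner: "v \<bullet> axis i t = v $ i * t" "axis i t \<bullet> v = t * v $ i" for v :: "real ^ 'n" and i t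
    by (simp_all add: inner_axis inner_axis' mult.commute)
  have gw: "is_weak_gradient \<Omega> u g"
    unfolding is_weak_gradient_def
  proof (intro ballI allI)
    fix \<psi> i assume \<psi>: "\<psi> \<in> test_functions \<Omega>"
    have "(\<integral>x. g x \<bullet> axis i (\<psi> x) \<partial>?M) = - (\<integral>x. u x * partial_deriv i \<psi> x \<partial>?M)"
      using test_field_div [OF \<psi>, of i]
      by (intro div_eq test_Lp test_functions_partial_deriv \<psi>) (auto simp: Hdiv_def)
    then show "(\<integral>x. u x * partial_deriv i \<psi> x \<partial>?M) = - (\<integral>x. g x $ i * \<psi> x \<partial>?M)"
      by (simp add: axis_inner)
  qed
  have hw: "is_weak_hessian \<Omega> u h"
    unfolding is_weak_hessian_def
  proof (intro ballI allI)
    fix \<psi> i j assume \<psi>: "\<psi> \<in> test_functions \<Omega>"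
    have "(\<integral>x. axis i (axis j (\<psi> x)) \<bullet> h x \<partial>?M) = (\<integral>x. partial_deriv i (partial_deriv j \<psi>) x * u x \<partial>?M)"
      using test_field_hess_contr [OF \<psi>, of i j]
      by (intro hess_eq test_Lp test_functions_partial_deriv \<psi>) (auto simp: Hhess_def)
    then show "(\<integral>x. u x * partial_deriv i (partial_deriv j \<psi>) x \<partial>?M) = (\<integral>x. h x $ i $ j * \<psi> x \<partial>?M)"
      by (simp add: inner_axis' axis_inner mult.commute)
  qed
  show "AE x in ?M. weak_gradient \<Omega> u x = g x" by (rule weak_gradient(3) [OF g gw])
  show "AE x in ?M. weak_hessian \<Omega> u x = h x" by (rule weak_hessian(3) [OF h hw])
  have "\<exists>v. (\<forall>n::nat. v n \<in> (\<lambda>\<psi> x. (\<psi> x, test_hess \<psi> x)) ` test_functions \<Omega>) \<and>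
      Lp_tendsto 2 \<Omega> v (\<lambda>x. (u x, h x))"
  proof (rule L2_biorthogonal [OF fin Lp_Pair [OF u h]])
    show "(\<lambda>\<psi> x. (\<psi> x, test_hess \<psi> x)) ` test_functions \<Omega> \<subseteq> Lp 2 \<Omega>"
      by (auto intro: Lp_Pair test_Lp test_hess_Lp)
    have th0: "test_hess (\<lambda>_. 0) x = 0" for x :: "real ^ 'n"
      using test_hess_lincomb [OF test_functions_zero [of \<Omega>] test_functions_zero [of \<Omega>], of 0 0] by simp
    then show "(\<lambda>_. 0) \<in> (\<lambda>\<psi> x. (\<psi> x, test_hess \<psi> x)) ` test_functions \<Omega>"
      by (intro image_eqI [OF _ test_functions_zero]) (simp add: zero_prod_def)
    show "(\<lambda>x. a *\<^sub>R v x + b *\<^sub>R w x) \<in> (\<lambda>\<psi> x. (\<psi> x, test_hess \<psi> x)) ` test_functions \<Omega>"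
      if "v \<in> (\<lambda>\<psi> x. (\<psi> x, test_hess \<psi> x)) ` test_functions \<Omega>"
        "w \<in> (\<lambda>\<psi> x. (\<psi> x, test_hess \<psi> x)) ` test_functions \<Omega>" for v w a b
    proof -
      from that(1) obtain \<psi> where \<psi>: "v = (\<lambda>x. (\<psi> x, test_hess \<psi> x))" "\<psi> \<in> test_functions \<Omega>"
        by (rule imageE)
      from that(2) obtain \<eta> where \<eta>: "w = (\<lambda>x. (\<eta> x, test_hess \<eta> x))" "\<eta> \<in> test_functions \<Omega>"
        by (rule imageE)
      show ?thesis
        by (rule image_eqI [OF _ test_functions_lincomb [OF \<psi>(2) \<eta>(2), of a b]])
          (simp add: \<psi>(1) \<eta>(1) test_hess_lincomb [OF \<psi>(2) \<eta>(2)])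
    qed
    fix G :: "real ^ 'n \<Rightarrow> real \<times> (real ^ 'n ^ 'n)"
    assume G: "G \<in> Lp 2 \<Omega>" and perp: "\<And>w. w \<in> (\<lambda>\<psi> x. (\<psi> x, test_hess \<psi> x)) ` test_functions \<Omega> \<Longrightarrow>
      (\<integral>x. G x \<bullet> w x \<partial>?M) = 0"
    define f where "f x = fst (G x)" for x
    define \<xi> where "\<xi> x = snd (G x)" for x
    have f: "f \<in> Lp 2 \<Omega>" and \<xi>: "\<xi> \<in> Lp 2 \<Omega>"
      unfolding f_def [abs_def] \<xi>_def [abs_def]
      by (intro Lp_bounded_linear [OF _ G] bounded_linear_fst bounded_linear_snd)+
    have split: "(\<integral>x. G x \<bullet> (a x, b x) \<partial>?M) = (\<integral>x. f x * a x \<partial>?M) + (\<integral>x. \<xi> x \<bullet> b x \<partial>?M)"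
      if "a \<in> Lp 2 \<Omega>" "b \<in> Lp 2 \<Omega>" for a b
      using Lp_mult_integrable [OF f that(1)] Lp_inner_integrable [OF \<xi> that(2)]
      by (simp add: inner_prod_def f_def \<xi>_def)
    \<comment> \<open>Orthogonality to all pairs \<open>(\<psi>, \<H> \<psi>)\<close> says exactly
      that the distribution \<open>\<H> : \<xi>\<close> is \<open>- f\<close>. Hence
      \<open>\<xi>\<close> is an admissible field, and its identity with \<open>u\<close> and
      \<open>h\<close> is the orthogonality sought.\<close>
    have "is_weak_hess_contr \<Omega> \<xi> (\<lambda>x. - f x)"
      unfolding is_weak_hess_contr_def
    proof
      fix \<psi> assume \<psi>: "\<psi> \<in> test_functions \<Omega>"
      have "(\<integral>x. f x * \<psi> x \<partial>?M) + (\<integral>x. \<xi> x \<bullet> test_hess \<psi> x \<partial>?M) = 0"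
        using perp [OF imageI [OF \<psi>]] split [OF test_Lp [OF \<psi>] test_hess_Lp [OF \<psi>]] by simp
      then show "(\<integral>x. (\<Sum>i\<in>UNIV. \<Sum>j\<in>UNIV. \<xi> x $ i $ j * partial_deriv i (partial_deriv j \<psi>) x) \<partial>?M)
          = (\<integral>x. - f x * \<psi> x \<partial>?M)"
        by (simp add: inner_vec_def test_hess_def)
    qed
    then have "(\<integral>x. \<xi> x \<bullet> h x \<partial>?M) = (\<integral>x. - f x * u x \<partial>?M)"
      using Lp_scaleR [OF f, of "-1"] by (intro hess_eq \<xi>) auto
    then show "(\<integral>x. G x \<bullet> (u x, h x) \<partial>?M) = 0"
      by (simp add: split u h)
  qed
  then obtain v where v: "\<And>n::nat. v n \<in> (\<lambda>\<psi> x. (\<psi> x, test_hess \<psi> x)) ` test_functions \<Omega>"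
    and vlim: "Lp_tendsto 2 \<Omega> v (\<lambda>x. (u x, h x))"
    by blast
  have "\<exists>\<psi>. \<forall>n. \<psi> n \<in> test_functions \<Omega> \<and> v n = (\<lambda>x. (\<psi> n x, test_hess (\<psi> n) x))"
    using v unfolding image_iff by (intro choice) blast
  then obtain \<psi> where \<psi>: "\<And>n. \<psi> n \<in> test_functions \<Omega>"
    and v_eq: "\<And>n. v n = (\<lambda>x. (\<psi> n x, test_hess (\<psi> n) x))"
    by blast
  have lim_u: "Lp_tendsto 2 \<Omega> \<psi> u" and lim_h: "Lp_tendsto 2 \<Omega> (\<lambda>n. test_hess (\<psi> n)) h"
    using Lp_tendsto_bounded_linear [OF bounded_linear_fst vlim] Lp_tendsto_bounded_linear [OF bounded_linear_snd vlim]
    by (simp_all add: v_eq)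
  have tr_h: "(\<lambda>x. mat_trace (h x)) \<in> Lp 2 \<Omega>"
    by (rule Lp_bounded_linear [OF bounded_linear_mat_trace h])
  have lim_tr: "Lp_tendsto 2 \<Omega> (\<lambda>n x. mat_trace (test_hess (\<psi> n) x)) (\<lambda>x. mat_trace (h x))"
    by (rule Lp_tendsto_bounded_linear [OF bounded_linear_mat_trace lim_h]) simp
  \<comment> \<open>By parts, \<open>J\<close> is minus the squared L2 norm of
    \<open>g\<close>.\<close>
  define J where "J = (\<integral>x. u x * mat_trace (h x) \<partial>?M)"
  have grad_test: "(\<integral>x. g x \<bullet> test_grad \<eta> x \<partial>?M) = - (\<integral>x. u x * mat_trace (test_hess \<eta> x) \<partial>?M)"
    if \<eta>: "\<eta> \<in> test_functions \<Omega>" for \<eta>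
  proof -
    have "(\<integral>x. g x \<bullet> test_grad \<eta> x \<partial>?M) = (\<Sum>i\<in>UNIV. \<integral>x. g x $ i * partial_deriv i \<eta> x \<partial>?M)"
      using Lp_vec_inner_integral [OF g test_grad_Lp [OF \<eta>]] by (simp add: test_grad_def)
    also have "\<dots> = (\<Sum>i\<in>UNIV. - (\<integral>x. u x * partial_deriv i (partial_deriv i \<eta>) x \<partial>?M))"
      using gw test_functions_partial_deriv [OF \<eta>]
      by (intro sum.cong) (simp_all add: is_weak_gradient_def)
    also have "\<dots> = - (\<integral>x. (\<Sum>i\<in>UNIV. u x * partial_deriv i (partial_deriv i \<eta>) x) \<partial>?M)"
      by (subst Bochner_Integration.integral_sum)
        (auto simp: sum_negf intro!: Lp_mult_integrable u test_Lp test_functions_partial_deriv \<eta>)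
    finally show ?thesis
      by (simp add: mat_trace_def test_hess_def sum_distrib_left)
  qed
  have gg: "(\<integral>x. g x \<bullet> g x \<partial>?M) = - J"
    unfolding J_def
  proof (rule div_eq [OF g tr_h])
    show "is_weak_div \<Omega> g (\<lambda>x. mat_trace (h x))"
      unfolding is_weak_div_def
    proof
      fix \<eta> assume \<eta>: "\<eta> \<in> test_functions \<Omega>"
      have "(\<integral>x. (\<Sum>i\<in>UNIV. g x $ i * partial_deriv i \<eta> x) \<partial>?M)
          = - (\<integral>x. (\<Sum>i\<in>UNIV. u x * partial_deriv i (partial_deriv i \<eta>) x) \<partial>?M)"
        using grad_test [OF \<eta>] by (simp add: inner_vec_def test_grad_def mat_trace_def test_hess_def sum_distrib_left)
      also have "(\<integral>x. (\<Sum>i\<in>UNIV. u x * partial_deriv i (partial_deriv i \<eta>) x) \<partial>?M)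
          = (\<Sum>i\<in>UNIV. \<integral>x. h x $ i $ i * \<eta> x \<partial>?M)"
        using hw \<eta>
        by (subst Bochner_Integration.integral_sum)
          (auto simp: is_weak_hessian_def intro!: Lp_mult_integrable u test_Lp test_functions_partial_deriv)
      also have "\<dots> = (\<integral>x. mat_trace (h x) * \<eta> x \<partial>?M)"
        unfolding mat_trace_def sum_distrib_right
        by (intro Bochner_Integration.integral_sum [symmetric] Lp_mult_integrable Lp_entry h test_Lp \<eta>)
      finally show "(\<integral>x. (\<Sum>i\<in>UNIV. g x $ i * partial_deriv i \<eta> x) \<partial>?M) = - (\<integral>x. mat_trace (h x) * \<eta> x \<partial>?M)" .
    qed
  qed
  have test_test: "(\<integral>x. test_grad \<eta> x \<bullet> test_grad \<eta> x \<partial>?M) = - (\<integral>x. \<eta> x * mat_trace (test_hess \<eta> x) \<partial>?M)"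
    if \<eta>: "\<eta> \<in> test_functions \<Omega>" for \<eta>
  proof -
    note pd = test_functions_partial_deriv
    have "(\<integral>x. test_grad \<eta> x \<bullet> test_grad \<eta> x \<partial>?M) = (\<Sum>i\<in>UNIV. \<integral>x. partial_deriv i \<eta> x * partial_deriv i \<eta> x \<partial>?M)"
      using Lp_vec_inner_integral [OF test_grad_Lp [OF \<eta>] test_grad_Lp [OF \<eta>]] by (simp add: test_grad_def)
    also have "\<dots> = (\<Sum>i\<in>UNIV. - (\<integral>x. \<eta> x * partial_deriv i (partial_deriv i \<eta>) x \<partial>?M))"
      using test_by_parts [OF \<eta> pd [OF \<eta>]] by simp
    also have "\<dots> = - (\<integral>x. (\<Sum>i\<in>UNIV. \<eta> x * partial_deriv i (partial_deriv i \<eta>) x) \<partial>?M)"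
      by (subst Bochner_Integration.integral_sum)
        (auto simp: sum_negf intro!: Lp_mult_integrable test_Lp pd \<eta>)
    finally show ?thesis
      by (simp add: mat_trace_def test_hess_def sum_distrib_left)
  qed
  have lim_g: "Lp_tendsto 2 \<Omega> (\<lambda>n. test_grad (\<psi> n)) g"
  proof -
    \<comment> \<open>The square is expanded and every term is rewritten through Laplacians, which
      converge by \<open>lim_tr\<close>. The three limits are \<open>- J\<close>,
      \<open>2 * J\<close> and \<open>- J\<close>, and they cancel.\<close>
    have eq: "(\<integral>x. norm (test_grad (\<psi> n) x - g x) ^ 2 \<partial>?M)
      = - (\<integral>x. \<psi> n x * mat_trace (test_hess (\<psi> n) x) \<partial>?M)
        + 2 * (\<integral>x. mat_trace (test_hess (\<psi> n) x) * u x \<partial>?M) - J" for n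
      using L2_norm_diff_scaleR [OF test_grad_Lp [OF \<psi>] g, of n 1] grad_test [OF \<psi>, of n] test_test [OF \<psi>, of n] gg
      by (simp add: inner_commute power2_norm_eq_inner mult.commute)
    have "(\<lambda>n. \<integral>x. norm (test_grad (\<psi> n) x - g x) ^ 2 \<partial>?M) \<longlonglongrightarrow> - J + 2 * J - J"
      unfolding eq
      using Lp_tendsto_inner2 [OF lim_u lim_tr] Lp_tendsto_inner [OF lim_tr u]
      by (intro tendsto_intros) (simp_all add: J_def mult.commute)
    then show ?thesis
      using test_grad_Lp [OF \<psi>] g by (simp add: Lp_tendsto_iff)
  qed
  have "u \<in> H2 \<Omega>" using u g h gw hw by (auto simp: H2_def)
  moreover have "\<exists>\<psi>\<in>test_functions \<Omega>. H2_norm \<Omega> (\<lambda>x. u x - \<psi> x) < \<epsilon>" if \<epsilon>: "\<epsilon> > 0" for \<epsilon>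
  proof -
    \<comment> \<open>\<open>H2_norm\<close> refers to derivatives of the difference selected by
      choice; they are first identified almost everywhere with differences of known
      derivatives.\<close>
    have ng: "Lp_norm 2 \<Omega> (weak_gradient \<Omega> (\<lambda>x. u x - \<psi> n x)) = Lp_norm 2 \<Omega> (\<lambda>x. test_grad (\<psi> n) x - g x)" for n
    proof -
      have d: "(\<lambda>x. g x - test_grad (\<psi> n) x) \<in> Lp 2 \<Omega>" by (intro Lp_diff g test_grad_Lp \<psi>)
      note w = weak_gradient [OF d is_weak_gradient_diff [OF gw test_weak_gradient [OF \<psi>] u test_Lp [OF \<psi>] g test_grad_Lp [OF \<psi>]]]
      show ?thesis
        unfolding Lp_norm_minus_commute [of 2 \<Omega> "test_grad (\<psi> n)" g]
        by (rule Lp_norm_cong_AE [OF LpD(1) [OF w(1)] LpD(1) [OF d] w(3)])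
    qed
    have nh: "Lp_norm 2 \<Omega> (weak_hessian \<Omega> (\<lambda>x. u x - \<psi> n x)) = Lp_norm 2 \<Omega> (\<lambda>x. test_hess (\<psi> n) x - h x)" for n
    proof -
      have d: "(\<lambda>x. h x - test_hess (\<psi> n) x) \<in> Lp 2 \<Omega>" by (intro Lp_diff h test_hess_Lp \<psi>)
      note w = weak_hessian [OF d is_weak_hessian_diff [OF hw test_weak_hessian [OF \<psi>] u test_Lp [OF \<psi>] h test_hess_Lp [OF \<psi>]]]
      show ?thesis
        unfolding Lp_norm_minus_commute [of 2 \<Omega> "test_hess (\<psi> n)" h]
        by (rule Lp_norm_cong_AE [OF LpD(1) [OF w(1)] LpD(1) [OF d] w(3)])
    qed
    have "(\<lambda>n. H2_norm \<Omega> (\<lambda>x. u x - \<psi> n x)) \<longlonglongrightarrow> sqrt (0\<^sup>2 + 0\<^sup>2 + 0\<^sup>2)"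
      unfolding H2_norm_def ng nh Lp_norm_minus_commute [of 2 \<Omega> u]
      using lim_u lim_g lim_h unfolding Lp_tendsto_def by (intro tendsto_intros) auto
    then have "\<forall>\<^sub>F n in sequentially. H2_norm \<Omega> (\<lambda>x. u x - \<psi> n x) < \<epsilon>"
      using \<epsilon> by (intro order_tendstoD) auto
    then obtain n where "H2_norm \<Omega> (\<lambda>x. u x - \<psi> n x) < \<epsilon>"
      by (auto simp: eventually_sequentially)
    with \<psi> show ?thesis by blast
  qed
  ultimately show "u \<in> H20 \<Omega>" by (simp add: H20_def)
qed

end

subsection \<open>Limits of discrete functions\<close>

text \<open>Both coefficients are taken to be 0. Since linearity holds only almost everywhere,
  \<open>F 0\<close> need not vanish at every point.\<close>

lemma discrete_linear_0:
  assumes "linear_into_Lp p \<Omega> X F" "subspace X"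
  shows "AE x in lebesgue_on \<Omega>. F 0 x = 0"
  using assms(1) [unfolded linear_into_Lp_def, THEN conjunct2, rule_format, of 0 0 0 0] subspace_0 [OF assms(2)]
  by simp

lemma hd_norm_nonneg: "0 \<le> hd_norm \<Omega> D w"
  by (simp add: hd_norm_def Lp_norm_nonneg)

context
  fixes \<Omega> :: "(real ^ 'n::finite) set" and D :: "('x::real_vector, 'n) hess_disc"
  assumes D: "hessian_discretisation \<Omega> D"
begin

lemma hd_subspace: "subspace (hd_space D)"
  and hd_Pi_lin: "linear_into_Lp 2 \<Omega> (hd_space D) (hd_Pi D)"
  and hd_grad_lin: "linear_into_Lp 4 \<Omega> (hd_space D) (hd_grad D)"
  and hd_hess_lin: "linear_into_Lp 2 \<Omega> (hd_space D) (hd_hess D)"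
  using D by (auto simp: hessian_discretisation_def)

lemma hd_Pi_Lp: "w \<in> hd_space D \<Longrightarrow> hd_Pi D w \<in> Lp 2 \<Omega>"
  and hd_grad_Lp: "w \<in> hd_space D \<Longrightarrow> hd_grad D w \<in> Lp 4 \<Omega>"
  and hd_hess_Lp: "w \<in> hd_space D \<Longrightarrow> hd_hess D w \<in> Lp 2 \<Omega>"
  using hd_Pi_lin hd_grad_lin hd_hess_lin by (auto simp: linear_into_Lp_def)

lemma hd_norm_eq_0: "w \<in> hd_space D \<Longrightarrow> hd_norm \<Omega> D w = 0 \<longleftrightarrow> w = 0"
  using D by (auto simp: hessian_discretisation_def is_norm_on_def)

lemma hd_norm_pos: "w \<in> hd_space D \<Longrightarrow> w \<noteq> 0 \<Longrightarrow> 0 < hd_norm \<Omega> D w"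
  using hd_norm_eq_0 hd_norm_nonneg [of \<Omega> D w] by fastforce

text \<open>The supremum in \<open>hd_C\<close> leaves out \<open>w = 0\<close>; that case rests on
  \<open>discrete_linear_0\<close>.\<close>

lemma hd_C_bound:
  assumes C: "hd_C \<Omega> D \<le> ennreal C" "0 \<le> C" and w: "w \<in> hd_space D"
  shows "Lp_norm 2 \<Omega> (hd_Pi D w) \<le> C * hd_norm \<Omega> D w" "Lp_norm 4 \<Omega> (hd_grad D w) \<le> C * hd_norm \<Omega> D w"
proof -
  have "Lp_norm 2 \<Omega> (hd_Pi D w) \<le> C * hd_norm \<Omega> D w \<and> Lp_norm 4 \<Omega> (hd_grad D w) \<le> C * hd_norm \<Omega> D w"
  proof (cases "w = 0")
    case True
    then show ?thesis
      using discrete_linear_0 [OF hd_Pi_lin hd_subspace] discrete_linear_0 [OF hd_grad_lin hd_subspace]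
        C(2) hd_norm_nonneg [of \<Omega> D]
      by (simp add: Lp_norm_eq_0_AE)
  next
    case False
    let ?N = "hd_norm \<Omega> D w"
    have N: "?N > 0" using w False by (rule hd_norm_pos)
    have "ennreal (max (Lp_norm 2 \<Omega> (hd_Pi D w) / ?N) (Lp_norm 4 \<Omega> (hd_grad D w) / ?N)) \<le> hd_C \<Omega> D"
      unfolding hd_C_def using w False by (intro SUP_upper) auto
    also have "\<dots> \<le> ennreal C" by (rule C)
    finally have "max (Lp_norm 2 \<Omega> (hd_Pi D w) / ?N) (Lp_norm 4 \<Omega> (hd_grad D w) / ?N) \<le> C"
      using C(2) by (simp add: ennreal_le_iff)
    then show ?thesis using N by (simp add: divide_le_eq)
  qed
  then show "Lp_norm 2 \<Omega> (hd_Pi D w) \<le> C * hd_norm \<Omega> D w" "Lp_norm 4 \<Omega> (hd_grad D w) \<le> C * hd_norm \<Omega> D w"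
    by auto
qed

end

text \<open>The common pattern behind \<open>hd_W\<close> and \<open>hd_W_hat\<close>: bounded norms
  times vanishing suprema of ratios control the functionals along the sequence. The supremum does
  not see the zero vector, hence the hypothesis \<open>I0\<close>.\<close>

lemma tendsto_of_SUP_ratio:
  fixes X :: "nat \<Rightarrow> 'x::zero set"
  assumes S: "\<And>m. (SUP w \<in> X m - {0}. ennreal (1 / N m w * \<bar>I m w\<bar>)) \<le> S m" and S0: "S \<longlonglongrightarrow> 0"
    and u: "\<And>m. u m \<in> X m" and N: "\<And>m. N m (u m) \<le> C" "\<And>m. u m \<noteq> 0 \<Longrightarrow> 0 < N m (u m)"
    and I0: "\<And>m. I m 0 = 0"
  shows "(\<lambda>m. I m (u m)) \<longlonglongrightarrow> (0::real)"
proof -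
  have le: "ennreal \<bar>I m (u m)\<bar> \<le> ennreal C * S m" for m
  proof (cases "u m = 0")
    case False
    have "\<bar>I m (u m)\<bar> = N m (u m) * (1 / N m (u m) * \<bar>I m (u m)\<bar>)"
      using N(2) [OF False] by simp
    also have "ennreal \<dots> = ennreal (N m (u m)) * ennreal (1 / N m (u m) * \<bar>I m (u m)\<bar>)"
      using N(2) [OF False] by (intro ennreal_mult) auto
    also have "\<dots> \<le> ennreal C * S m"
      using u [of m] False by (intro mult_mono ennreal_leI N order_trans [OF SUP_upper S]) auto
    finally show ?thesis .
  qed (simp add: I0)
  have "(\<lambda>m. ennreal C * S m) \<longlonglongrightarrow> ennreal C * 0"
    by (intro ennreal_tendsto_cmult S0) simp
  then have lim: "(\<lambda>m. ennreal C * S m) \<longlonglongrightarrow> 0" by simp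
  have "(\<lambda>m. ennreal \<bar>I m (u m)\<bar>) \<longlonglongrightarrow> 0"
    by (rule tendsto_sandwich [OF _ _ tendsto_const lim]) (simp_all add: le)
  then have "(\<lambda>m. \<bar>I m (u m)\<bar>) \<longlonglongrightarrow> 0"
    using tendsto_ennrealD [of "\<lambda>m. \<bar>I m (u m)\<bar>" 0] by simp
  then show ?thesis by (rule tendsto_rabs_zero_cancel)
qed

context finite_domain
begin

text \<open>The squared pointwise distances \<open>k m\<close> tend to 0 in L2; pairing them with
  the constant 1 gives convergence of their integrals.\<close>

lemma L4_tendsto_L2:
  assumes "Lp_tendsto 4 \<Omega> f g"
  shows "Lp_tendsto 2 \<Omega> f g"
proof -
  have f: "f m \<in> Lp 4 \<Omega>" and g: "g \<in> Lp 4 \<Omega>"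
    and 0: "(\<lambda>m. \<integral>x. norm (f m x - g x) ^ 4 \<partial>lebesgue_on \<Omega>) \<longlonglongrightarrow> 0" for m
    using assms by (auto simp: Lp_tendsto_iff)
  have one: "(\<lambda>_. 1::real) \<in> Lp 2 \<Omega>"
    using fin by (simp add: Lp_def finite_measure.integrable_const)
  define k where "k m x = norm (f m x - g x) ^ 2" for m x
  have k4: "(k m x)\<^sup>2 = norm (f m x - g x) ^ 4" for m x
    by (simp add: k_def flip: power_mult)
  have k: "k m \<in> Lp 2 \<Omega>" for m
    using LpD [OF Lp_diff [OF f [of m] g]] unfolding Lp_def by (simp add: k4) (simp add: k_def [abs_def])
  have "(\<lambda>m. \<integral>x. norm (k m x) ^ 2 \<partial>lebesgue_on \<Omega>) \<longlonglongrightarrow> 0"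
    using 0 by (simp add: k4)
  then have "Lp_tendsto 2 \<Omega> k (\<lambda>_. 0)"
    using k by (simp add: Lp_tendsto_iff Lp_zero)
  from Lp_tendsto_inner [OF this one]
  have "(\<lambda>m. \<integral>x. k m x \<partial>lebesgue_on \<Omega>) \<longlonglongrightarrow> 0" by simp
  then show ?thesis
    using L4_L2 [OF f] L4_L2 [OF g] by (simp add: Lp_tendsto_iff k_def)
qed

text \<open>The fields \<open>\<xi>\<close> whose integrals converge form a subspace
  \<open>K\<close>. It is closed because the sequence is bounded, and dense because only null
  functions annihilate all single-entry test fields. The limit functional obeys the same bound
  \<open>C\<close>, so Riesz representation supplies \<open>h\<close>; no subsequence is
  taken.\<close>

lemma L2_weak_limit:
  fixes f :: "nat \<Rightarrow> real ^ 'n \<Rightarrow> real ^ 'n ^ 'n"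
  assumes f: "\<And>m. f m \<in> Lp 2 \<Omega>" and bnd: "\<And>m. Lp_norm 2 \<Omega> (f m) \<le> C"
    and conv: "\<And>i j \<psi>. \<psi> \<in> test_functions \<Omega> \<Longrightarrow>
      convergent (\<lambda>m. \<integral>x. axis i (axis j (\<psi> x)) \<bullet> f m x \<partial>lebesgue_on \<Omega>)"
  shows "\<exists>h\<in>Lp 2 \<Omega>. \<forall>\<xi>\<in>Lp 2 \<Omega>.
    (\<lambda>m. \<integral>x. \<xi> x \<bullet> f m x \<partial>lebesgue_on \<Omega>) \<longlonglongrightarrow> (\<integral>x. \<xi> x \<bullet> h x \<partial>lebesgue_on \<Omega>)"
proof -
  let ?M = "lebesgue_on \<Omega>"
  let ?I = "\<lambda>\<xi> m. \<integral>x. \<xi> x \<bullet> f m x \<partial>?M"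
  have C: "0 \<le> C" using order_trans [OF Lp_norm_nonneg bnd] by simp
  have I_le: "\<bar>?I \<xi> m\<bar> \<le> C * Lp_norm 2 \<Omega> \<xi>" if "\<xi> \<in> Lp 2 \<Omega>" for \<xi> m
  proof -
    have "\<bar>?I \<xi> m\<bar> \<le> Lp_norm 2 \<Omega> \<xi> * Lp_norm 2 \<Omega> (f m)"
      by (rule L2_Cauchy_Schwarz [OF that f])
    also have "\<dots> \<le> Lp_norm 2 \<Omega> \<xi> * C"
      by (intro mult_left_mono bnd Lp_norm_nonneg) simp
    finally show ?thesis by (simp add: mult.commute)
  qed
  define K where "K = {\<xi> \<in> Lp 2 \<Omega>. convergent (?I \<xi>)}"
  have test_K: "(\<lambda>x. axis i (axis j (\<psi> x))) \<in> K" if "\<psi> \<in> test_functions \<Omega>" for i j \<psi>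
    using test_field_hess_contr(1) [OF that, of i j] conv [OF that, of i j] by (simp add: K_def Hhess_def)
  have K_all: "\<xi> \<in> K" if \<xi>: "\<xi> \<in> Lp 2 \<Omega>" for \<xi>
  proof -
    have "\<exists>v. (\<forall>n::nat. v n \<in> K) \<and> Lp_tendsto 2 \<Omega> v \<xi>"
    proof (rule L2_biorthogonal [OF fin \<xi>])
      show "K \<subseteq> Lp 2 \<Omega>" by (auto simp: K_def)
      show "(\<lambda>_. 0) \<in> K" by (simp add: K_def Lp_zero convergent_const)
      show "(\<lambda>x. a *\<^sub>R v x + b *\<^sub>R w x) \<in> K" if "v \<in> K" "w \<in> K" for v w a b
      proof -
        have vw: "v \<in> Lp 2 \<Omega>" "w \<in> Lp 2 \<Omega>" "convergent (?I v)" "convergent (?I w)"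
          using that by (auto simp: K_def)
        then have "convergent (\<lambda>m. a * ?I v m + b * ?I w m)"
          by (intro convergent_add convergent_mult convergent_const)
        with vw show ?thesis
          by (simp add: K_def Lp_lincomb Lp_inner_lincomb [OF vw(1,2) f])
      qed
      fix G assume G: "G \<in> Lp 2 \<Omega>" and perp: "\<And>w. w \<in> K \<Longrightarrow> (\<integral>x. G x \<bullet> w x \<partial>?M) = 0"
      have "AE x in ?M. G x $ i $ j = 0" for i j
      proof (rule AE_eq_by_test [OF Lp_entry [OF G] Lp_zero])
        fix \<psi> assume "\<psi> \<in> test_functions \<Omega>"
        from perp [OF test_K [OF this, of i j]]
        show "(\<integral>x. G x $ i $ j * \<psi> x \<partial>?M) = (\<integral>x. 0 * \<psi> x \<partial>?M)"
          by (simp add: inner_axis)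
      qed simp
      then have "AE x in ?M. G x = 0"
        by (intro AE_vec_eqI) simp
      then have "AE x in ?M. G x \<bullet> \<xi> x = 0" by eventually_elim simp
      then show "(\<integral>x. G x \<bullet> \<xi> x \<partial>?M) = 0" by (rule integral_eq_zero_AE)
    qed
    then obtain v where v: "\<And>n::nat. v n \<in> K" and lim: "Lp_tendsto 2 \<Omega> v \<xi>" by blast
    \<comment> \<open>Closedness of \<open>K\<close>: replacing \<open>\<xi>\<close> by
      \<open>v n\<close> costs \<open>e / 4\<close> at either index, and the Cauchy property for
      \<open>v n\<close> leaves \<open>e / 2\<close>.\<close>
    have "Cauchy (?I \<xi>)"
    proof (rule metric_CauchyI)
      fix e :: real assume e: "e > 0"
      have "(\<lambda>n. C * Lp_norm 2 \<Omega> (\<lambda>x. v n x - \<xi> x)) \<longlonglongrightarrow> C * 0"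
        using lim unfolding Lp_tendsto_def by (intro tendsto_intros) auto
      then have "\<forall>\<^sub>F n in sequentially. C * Lp_norm 2 \<Omega> (\<lambda>x. v n x - \<xi> x) < e / 4"
        using e by (intro order_tendstoD) auto
      then obtain n where n: "C * Lp_norm 2 \<Omega> (\<lambda>x. v n x - \<xi> x) < e / 4"
        by (auto simp: eventually_sequentially)
      have vn: "v n \<in> Lp 2 \<Omega>" and "convergent (?I (v n))" using v [of n] by (auto simp: K_def)
      then have "Cauchy (?I (v n))" by (simp add: Cauchy_convergent_iff)
      then have "\<exists>M. \<forall>m\<ge>M. \<forall>k\<ge>M. dist (?I (v n) m) (?I (v n) k) < e / 2"
        using e by (intro metric_CauchyD) simp_all
      then obtain M where M: "\<forall>m\<ge>M. \<forall>k\<ge>M. dist (?I (v n) m) (?I (v n) k) < e / 2"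
        by blast
      have close: "\<bar>?I (v n) m - ?I \<xi> m\<bar> < e / 4" for m
        using I_le [OF Lp_diff [OF vn \<xi>], of m] n Lp_inner_diff [OF vn \<xi> f, of m] by simp
      have "dist (?I \<xi> m) (?I \<xi> k) < e" if "m \<ge> M" "k \<ge> M" for m k
      proof -
        have "\<bar>?I (v n) m - ?I (v n) k\<bar> < e / 2"
          using M that unfolding dist_real_def by blast
        with close [of m] close [of k] show ?thesis unfolding dist_real_def by linarith
      qed
      then show "\<exists>M. \<forall>m\<ge>M. \<forall>k\<ge>M. dist (?I \<xi> m) (?I \<xi> k) < e" by blast
    qed
    with \<xi> show ?thesis by (simp add: K_def Cauchy_convergent_iff)
  qed
  define F where "F \<xi> = lim (?I \<xi>)" for \<xi>
  have F: "?I \<xi> \<longlonglongrightarrow> F \<xi>" if "\<xi> \<in> Lp 2 \<Omega>" for \<xi>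
    using K_all [OF that] by (simp add: K_def F_def convergent_LIMSEQ_iff)
  have "\<exists>h\<in>Lp 2 \<Omega>. \<forall>\<xi>\<in>Lp 2 \<Omega>. F \<xi> = (\<integral>x. h x \<bullet> \<xi> x \<partial>?M)"
  proof (rule L2_Riesz [OF fin])
    show "Lp_linear 2 \<Omega> F"
      unfolding Lp_linear_def
    proof (intro ballI allI)
      fix v w :: "real ^ 'n \<Rightarrow> real ^ 'n ^ 'n" and a b
      assume vw: "v \<in> Lp 2 \<Omega>" "w \<in> Lp 2 \<Omega>"
      have "?I (\<lambda>x. a *\<^sub>R v x + b *\<^sub>R w x) \<longlonglongrightarrow> a * F v + b * F w"
        unfolding Lp_inner_lincomb [OF vw f] by (intro tendsto_intros F vw)
      with F [OF Lp_lincomb [OF vw]] show "F (\<lambda>x. a *\<^sub>R v x + b *\<^sub>R w x) = a * F v + b * F w"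
        by (rule LIMSEQ_unique)
    qed
    show "\<bar>F \<xi>\<bar> \<le> C * Lp_norm 2 \<Omega> \<xi>" if "\<xi> \<in> Lp 2 \<Omega>" for \<xi>
      by (rule LIMSEQ_le_const2 [OF tendsto_rabs [OF F [OF that]]]) (use I_le [OF that] in blast)
  qed
  then obtain h where "h \<in> Lp 2 \<Omega>" "\<And>\<xi>. \<xi> \<in> Lp 2 \<Omega> \<Longrightarrow> F \<xi> = (\<integral>x. h x \<bullet> \<xi> x \<partial>?M)" by blast
  with F show ?thesis by (intro bexI [of _ h]) (auto simp: inner_commute)
qed

text \<open>Limit-conformity expresses the limits of the integrals of the Hessians against
  \<open>Hhess\<close> fields through \<open>u\<close> alone. Single-entry fields thereby produce a
  weak limit \<open>h\<close>, and general fields then show that \<open>u\<close>, \<open>g\<close>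
  and \<open>h\<close> satisfy the hypotheses of \<open>H20_identification\<close>.\<close>

proposition limit_of_bounded_discrete_functions:
  fixes D :: "nat \<Rightarrow> ('x::real_vector, 'n) hess_disc"
  assumes D: "\<And>m. hessian_discretisation \<Omega> (D m)" and conf: "hd_limit_conforming \<Omega> D"
    and w: "\<And>m. w m \<in> hd_space (D m)" and bnd: "\<And>m. hd_norm \<Omega> (D m) (w m) \<le> C"
    and lim_u: "Lp_tendsto 2 \<Omega> (\<lambda>m. hd_Pi (D m) (w m)) u"
    and lim_g: "Lp_tendsto 4 \<Omega> (\<lambda>m. hd_grad (D m) (w m)) g"
  shows "u \<in> H20 \<Omega>" "Lp_tendsto 4 \<Omega> (\<lambda>m. hd_grad (D m) (w m)) (weak_gradient \<Omega> u)"
    "\<And>\<xi>. \<xi> \<in> Lp 2 \<Omega> \<Longrightarrow> (\<lambda>m. \<integral>x. \<xi> x \<bullet> hd_hess (D m) (w m) x \<partial>lebesgue_on \<Omega>)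
      \<longlonglongrightarrow> (\<integral>x. \<xi> x \<bullet> weak_hessian \<Omega> u x \<partial>lebesgue_on \<Omega>)"
proof -
  let ?M = "lebesgue_on \<Omega>"
  let ?u = "\<lambda>m. hd_Pi (D m) (w m)" and ?g = "\<lambda>m. hd_grad (D m) (w m)" and ?h = "\<lambda>m. hd_hess (D m) (w m)"
  have u: "u \<in> Lp 2 \<Omega>" and g4: "g \<in> Lp 4 \<Omega>" using lim_u lim_g by (auto simp: Lp_tendsto_def)
  note g = L4_L2 [OF g4]
  have um: "?u m \<in> Lp 2 \<Omega>" and gm4: "?g m \<in> Lp 4 \<Omega>" and hm: "?h m \<in> Lp 2 \<Omega>" for m
    using hd_Pi_Lp [OF D w] hd_grad_Lp [OF D w] hd_hess_Lp [OF D w] by auto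
  note gm = L4_L2 [OF gm4]
  \<comment> \<open>Limit-conformity controls the sum of two defects; combining a field with the
    zero field of the other kind isolates one of them.\<close>
  have hess0: "(\<lambda>_. 0) \<in> Hhess \<Omega>"
    by (auto simp: Hhess_def Lp_zero is_weak_hess_contr_def intro!: bexI [of _ "\<lambda>_. 0"])
  have div0: "(\<lambda>_. 0) \<in> Hdiv \<Omega>"
    by (auto simp: Hdiv_def Lp_zero is_weak_div_def intro!: bexI [of _ "\<lambda>_. 0"])
  have Pi0: "AE x in ?M. hd_Pi (D m) 0 x = 0" and grad0: "AE x in ?M. hd_grad (D m) 0 x = 0"
    and hd0: "AE x in ?M. hd_hess (D m) 0 x = 0" for m
    using discrete_linear_0 [OF hd_Pi_lin [OF D] hd_subspace [OF D]]
      discrete_linear_0 [OF hd_grad_lin [OF D] hd_subspace [OF D]]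
      discrete_linear_0 [OF hd_hess_lin [OF D] hd_subspace [OF D]] by auto
  have conf_hess: "(\<lambda>m. (\<integral>x. weak_hess_contr \<Omega> \<xi> x * ?u m x - \<xi> x \<bullet> ?h m x \<partial>?M)) \<longlonglongrightarrow> 0"
    if "\<xi> \<in> Hhess \<Omega>" for \<xi>
  proof (rule tendsto_of_SUP_ratio [where u = w and N = "\<lambda>m. hd_norm \<Omega> (D m)" and X = "\<lambda>m. hd_space (D m)"
      and I = "\<lambda>m w. \<integral>x. weak_hess_contr \<Omega> \<xi> x * hd_Pi (D m) w x - \<xi> x \<bullet> hd_hess (D m) w x \<partial>?M"])
    show "(\<lambda>m. hd_W \<Omega> (D m) \<xi> + hd_W_hat \<Omega> (D m) (\<lambda>_. 0)) \<longlonglongrightarrow> 0"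
      using conf that div0 by (auto simp: hd_limit_conforming_def)
    show "(SUP w \<in> hd_space (D m) - {0}. ennreal (1 / hd_norm \<Omega> (D m) w *
        \<bar>\<integral>x. weak_hess_contr \<Omega> \<xi> x * hd_Pi (D m) w x - \<xi> x \<bullet> hd_hess (D m) w x \<partial>?M\<bar>))
      \<le> hd_W \<Omega> (D m) \<xi> + hd_W_hat \<Omega> (D m) (\<lambda>_. 0)" for m
      unfolding hd_W_def by simp
    show "(\<integral>x. weak_hess_contr \<Omega> \<xi> x * hd_Pi (D m) 0 x - \<xi> x \<bullet> hd_hess (D m) 0 x \<partial>?M) = 0" for m
    proof (rule integral_eq_zero_AE)
      show "AE x in ?M. weak_hess_contr \<Omega> \<xi> x * hd_Pi (D m) 0 x - \<xi> x \<bullet> hd_hess (D m) 0 x = 0"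
        using Pi0 [of m] hd0 [of m] by eventually_elim simp
    qed
  qed (use w bnd hd_norm_pos [OF D w] in auto)
  have conf_div: "(\<lambda>m. (\<integral>x. ?g m x \<bullet> \<phi> x + ?u m x * weak_div \<Omega> \<phi> x \<partial>?M)) \<longlonglongrightarrow> 0"
    if "\<phi> \<in> Hdiv \<Omega>" for \<phi>
  proof (rule tendsto_of_SUP_ratio [where u = w and N = "\<lambda>m. hd_norm \<Omega> (D m)" and X = "\<lambda>m. hd_space (D m)"
      and I = "\<lambda>m w. \<integral>x. hd_grad (D m) w x \<bullet> \<phi> x + hd_Pi (D m) w x * weak_div \<Omega> \<phi> x \<partial>?M"])
    show "(\<lambda>m. hd_W \<Omega> (D m) (\<lambda>_. 0) + hd_W_hat \<Omega> (D m) \<phi>) \<longlonglongrightarrow> 0"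
      using conf that hess0 by (auto simp: hd_limit_conforming_def)
    show "(SUP w \<in> hd_space (D m) - {0}. ennreal (1 / hd_norm \<Omega> (D m) w *
        \<bar>\<integral>x. hd_grad (D m) w x \<bullet> \<phi> x + hd_Pi (D m) w x * weak_div \<Omega> \<phi> x \<partial>?M\<bar>))
      \<le> hd_W \<Omega> (D m) (\<lambda>_. 0) + hd_W_hat \<Omega> (D m) \<phi>" for m
      unfolding hd_W_hat_def by simp
    show "(\<integral>x. hd_grad (D m) 0 x \<bullet> \<phi> x + hd_Pi (D m) 0 x * weak_div \<Omega> \<phi> x \<partial>?M) = 0" for m
    proof (rule integral_eq_zero_AE)
      show "AE x in ?M. hd_grad (D m) 0 x \<bullet> \<phi> x + hd_Pi (D m) 0 x * weak_div \<Omega> \<phi> x = 0"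
        using Pi0 [of m] grad0 [of m] by eventually_elim simp
    qed
  qed (use w bnd hd_norm_pos [OF D w] in auto)
  have hess_lim: "(\<lambda>m. \<integral>x. \<xi> x \<bullet> ?h m x \<partial>?M) \<longlonglongrightarrow> (\<integral>x. weak_hess_contr \<Omega> \<xi> x * u x \<partial>?M)"
    and contr_Lp: "weak_hess_contr \<Omega> \<xi> \<in> Lp 2 \<Omega>" if \<xi>: "\<xi> \<in> Hhess \<Omega>" for \<xi>
  proof -
    have \<xi>2: "\<xi> \<in> Lp 2 \<Omega>" using \<xi> by (simp add: Hhess_def)
    show c: "weak_hess_contr \<Omega> \<xi> \<in> Lp 2 \<Omega>"
      using \<xi> weak_hess_contr(1) by (auto simp: Hhess_def)
    have "(\<lambda>m. (\<integral>x. ?u m x * weak_hess_contr \<Omega> \<xi> x \<partial>?M)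
        - (\<integral>x. weak_hess_contr \<Omega> \<xi> x * ?u m x - \<xi> x \<bullet> ?h m x \<partial>?M))
      \<longlonglongrightarrow> (\<integral>x. u x * weak_hess_contr \<Omega> \<xi> x \<partial>?M) - 0"
      using Lp_tendsto_inner [OF lim_u c] by (intro tendsto_diff conf_hess \<xi>) simp
    moreover have "(\<integral>x. weak_hess_contr \<Omega> \<xi> x * ?u m x - \<xi> x \<bullet> ?h m x \<partial>?M)
        = (\<integral>x. ?u m x * weak_hess_contr \<Omega> \<xi> x \<partial>?M) - (\<integral>x. \<xi> x \<bullet> ?h m x \<partial>?M)" for m
      using Lp_mult_integrable [OF um c] Lp_inner_integrable [OF \<xi>2 hm] by (simp add: mult.commute)
    ultimately show "(\<lambda>m. \<integral>x. \<xi> x \<bullet> ?h m x \<partial>?M) \<longlonglongrightarrow> (\<integral>x. weak_hess_contr \<Omega> \<xi> x * u x \<partial>?M)"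
      by (simp add: mult.commute)
  qed
  have "\<exists>h\<in>Lp 2 \<Omega>. \<forall>\<xi>\<in>Lp 2 \<Omega>. (\<lambda>m. \<integral>x. \<xi> x \<bullet> ?h m x \<partial>?M) \<longlonglongrightarrow> (\<integral>x. \<xi> x \<bullet> h x \<partial>?M)"
  proof (rule L2_weak_limit [OF hm])
    show "Lp_norm 2 \<Omega> (?h m) \<le> C" for m
      using bnd [of m] by (simp add: hd_norm_def)
    show "convergent (\<lambda>m. \<integral>x. axis i (axis j (\<psi> x)) \<bullet> ?h m x \<partial>?M)" if "\<psi> \<in> test_functions \<Omega>" for i j \<psi>
      unfolding convergent_def by (rule exI, rule hess_lim [OF test_field_hess_contr(1) [OF that]])
  qed
  then obtain h where h: "h \<in> Lp 2 \<Omega>"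
    and weak: "\<And>\<xi>. \<xi> \<in> Lp 2 \<Omega> \<Longrightarrow> (\<lambda>m. \<integral>x. \<xi> x \<bullet> ?h m x \<partial>?M) \<longlonglongrightarrow> (\<integral>x. \<xi> x \<bullet> h x \<partial>?M)"
    by blast
  have hdiv: "(\<integral>x. g x \<bullet> \<phi> x + u x * weak_div \<Omega> \<phi> x \<partial>?M) = 0" if \<phi>: "\<phi> \<in> Hdiv \<Omega>" for \<phi>
  proof -
    have \<phi>2: "\<phi> \<in> Lp 2 \<Omega>" and d: "weak_div \<Omega> \<phi> \<in> Lp 2 \<Omega>"
      using \<phi> weak_div(1) by (auto simp: Hdiv_def)
    have split: "(\<integral>x. a x \<bullet> \<phi> x + b x * weak_div \<Omega> \<phi> x \<partial>?M) = (\<integral>x. a x \<bullet> \<phi> x \<partial>?M) + (\<integral>x. b x * weak_div \<Omega> \<phi> x \<partial>?M)"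
      if "a \<in> Lp 2 \<Omega>" "b \<in> Lp 2 \<Omega>" for a b
      using Lp_inner_integrable [OF that(1) \<phi>2] Lp_mult_integrable [OF that(2) d] by simp
    have "(\<lambda>m. \<integral>x. ?g m x \<bullet> \<phi> x + ?u m x * weak_div \<Omega> \<phi> x \<partial>?M)
        \<longlonglongrightarrow> (\<integral>x. g x \<bullet> \<phi> x + u x * weak_div \<Omega> \<phi> x \<partial>?M)"
      unfolding split [OF gm um] split [OF g u]
      using Lp_tendsto_inner [OF L4_tendsto_L2 [OF lim_g] \<phi>2] Lp_tendsto_inner [OF lim_u d]
      by (intro tendsto_add) simp_all
    then show ?thesis using conf_div [OF \<phi>] LIMSEQ_unique by blast
  qed
  have hhess: "(\<integral>x. weak_hess_contr \<Omega> \<xi> x * u x - \<xi> x \<bullet> h x \<partial>?M) = 0" if \<xi>: "\<xi> \<in> Hhess \<Omega>" for \<xi>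
  proof -
    have \<xi>2: "\<xi> \<in> Lp 2 \<Omega>" using \<xi> by (simp add: Hhess_def)
    show ?thesis
      using LIMSEQ_unique [OF weak [OF \<xi>2] hess_lim [OF \<xi>]]
        Lp_mult_integrable [OF contr_Lp [OF \<xi>] u] Lp_inner_integrable [OF \<xi>2 h] by simp
  qed
  have id: "u \<in> H20 \<Omega>" "AE x in ?M. weak_gradient \<Omega> u x = g x" "AE x in ?M. weak_hessian \<Omega> u x = h x"
    by (rule H20_identification [OF u g h], erule hdiv, erule hhess)+
  show H20: "u \<in> H20 \<Omega>" by (rule id(1))
  then have wg: "weak_gradient \<Omega> u \<in> Lp 2 \<Omega>" and wh: "weak_hessian \<Omega> u \<in> Lp 2 \<Omega>"
    using weak_gradient(1) weak_hessian(1) by (auto simp: H20_def H2_def)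
  have g_eq: "AE x in ?M. g x = weak_gradient \<Omega> u x"
    using id(2) by eventually_elim simp
  \<comment> \<open>Agreement with \<open>g\<close> almost everywhere also places the weak gradient
    in \<open>Lp 4\<close>.\<close>
  show "Lp_tendsto 4 \<Omega> ?g (weak_gradient \<Omega> u)"
    by (rule Lp_tendsto_cong_AE [OF lim_g Lp_cong_AE [OF g4 LpD(1) [OF wg] g_eq] g_eq])
  fix \<xi> :: "real ^ 'n \<Rightarrow> real ^ 'n ^ 'n" assume \<xi>: "\<xi> \<in> Lp 2 \<Omega>"
  have "(\<integral>x. \<xi> x \<bullet> h x \<partial>?M) = (\<integral>x. \<xi> x \<bullet> weak_hessian \<Omega> u x \<partial>?M)"
    using L2_inner_cong_AE [OF wh h \<xi> id(3)] by (simp add: inner_commute)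
  with weak [OF \<xi>] show "(\<lambda>m. \<integral>x. \<xi> x \<bullet> ?h m x \<partial>?M) \<longlonglongrightarrow> (\<integral>x. \<xi> x \<bullet> weak_hessian \<Omega> u x \<partial>?M)"
    by simp
qed

text \<open>In dimension greater than four the first claim rests on consistency: \<^const>\<open>hd_S\<close> would be infinite
  otherwise.\<close>

proposition consistent_approximation:
  fixes D :: "nat \<Rightarrow> ('x::real_vector, 'n) hess_disc"
  assumes D: "\<And>m. hessian_discretisation \<Omega> (D m)" and cons: "hd_consistent \<Omega> D" and \<phi>: "\<phi> \<in> H20 \<Omega>"
  shows "weak_gradient \<Omega> \<phi> \<in> Lp 4 \<Omega>"
    "\<exists>w. (\<forall>m. w m \<in> hd_space (D m)) \<and> Lp_tendsto 2 \<Omega> (\<lambda>m. hd_Pi (D m) (w m)) \<phi> \<and>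
      Lp_tendsto 4 \<Omega> (\<lambda>m. hd_grad (D m) (w m)) (weak_gradient \<Omega> \<phi>) \<and>
      Lp_tendsto 2 \<Omega> (\<lambda>m. hd_hess (D m) (w m)) (weak_hessian \<Omega> \<phi>)"
proof -
  have \<phi>2: "\<phi> \<in> Lp 2 \<Omega>" and wg2: "weak_gradient \<Omega> \<phi> \<in> Lp 2 \<Omega>" and wh: "weak_hessian \<Omega> \<phi> \<in> Lp 2 \<Omega>"
    using \<phi> weak_gradient(1) weak_hessian(1) by (auto simp: H20_def H2_def)
  define err where "err m w = Lp_enorm 2 \<Omega> (\<lambda>x. hd_Pi (D m) w x - \<phi> x)
     + Lp_enorm 4 \<Omega> (\<lambda>x. hd_grad (D m) w x - weak_gradient \<Omega> \<phi> x)
     + Lp_enorm 2 \<Omega> (\<lambda>x. hd_hess (D m) w x - weak_hessian \<Omega> \<phi> x)" for m w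
  have S: "(\<lambda>m. hd_S \<Omega> (D m) \<phi>) \<longlonglongrightarrow> 0"
    using cons \<phi> by (simp add: hd_consistent_def)
  have S_def: "hd_S \<Omega> (D m) \<phi> = (INF w \<in> hd_space (D m). err m w)" for m
    by (simp add: hd_S_def err_def)
  show wg: "weak_gradient \<Omega> \<phi> \<in> Lp 4 \<Omega>"
  proof -
    have "\<forall>\<^sub>F m in sequentially. hd_S \<Omega> (D m) \<phi> < 1"
      using S by (rule order_tendstoD) simp
    then obtain m where "hd_S \<Omega> (D m) \<phi> < 1"
      by (auto simp: eventually_sequentially)
    then obtain w where w: "w \<in> hd_space (D m)" "err m w < 1"
      unfolding S_def by (auto simp: INF_less_iff)
    \<comment> \<open>A finite error excludes the infinite branch of \<open>Lp_enorm\<close>; the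
      weak gradient is then a difference of two L4 functions.\<close>
    have "(\<lambda>x. hd_grad (D m) w x - weak_gradient \<Omega> \<phi> x) \<in> Lp 4 \<Omega>"
    proof (rule ccontr)
      assume "\<not> ?thesis"
      with w(2) show False by (simp add: err_def Lp_enorm_def)
    qed
    from Lp_diff [OF hd_grad_Lp [OF D w(1)] this] show ?thesis by simp
  qed
  have err_eq: "err m w = ennreal (Lp_norm 2 \<Omega> (\<lambda>x. hd_Pi (D m) w x - \<phi> x)
     + Lp_norm 4 \<Omega> (\<lambda>x. hd_grad (D m) w x - weak_gradient \<Omega> \<phi> x)
     + Lp_norm 2 \<Omega> (\<lambda>x. hd_hess (D m) w x - weak_hessian \<Omega> \<phi> x))" if "w \<in> hd_space (D m)" for m w
    using Lp_diff [OF hd_Pi_Lp [OF D that] \<phi>2] Lp_diff [OF hd_grad_Lp [OF D that] wg] Lp_diff [OF hd_hess_Lp [OF D that] wh]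
    by (simp add: err_def Lp_enorm_def Lp_norm_nonneg)
  \<comment> \<open>\<open>hd_S\<close> is defined as an infimum, so \<open>w\<close> is chosen
    optimal up to \<open>1 / (m + 1)\<close>. The strict inequality behind this choice requires
    \<open>hd_S\<close> to be finite, which its value at the zero vector shows.\<close>
  have "\<exists>w. w \<in> hd_space (D m) \<and> err m w \<le> hd_S \<Omega> (D m) \<phi> + ennreal (1 / real (Suc m))" for m
  proof -
    have "0 \<in> hd_space (D m)" by (rule subspace_0 [OF hd_subspace [OF D]])
    then have "hd_S \<Omega> (D m) \<phi> \<le> err m 0" unfolding S_def by (rule INF_lower)
    also have "\<dots> < \<infinity>" using err_eq \<open>0 \<in> hd_space (D m)\<close> by simp
    finally have fin_S: "hd_S \<Omega> (D m) \<phi> < \<infinity>" .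
    have "(INF w \<in> hd_space (D m). err m w) < hd_S \<Omega> (D m) \<phi> + ennreal (1 / real (Suc m))"
      unfolding S_def [symmetric] using fin_S by (cases "hd_S \<Omega> (D m) \<phi>") (auto simp: ennreal_less_iff simp flip: ennreal_plus)
    then show ?thesis by (auto simp: INF_less_iff intro: less_imp_le)
  qed
  then obtain w where w: "\<And>m. w m \<in> hd_space (D m)"
    and err_le: "\<And>m. err m (w m) \<le> hd_S \<Omega> (D m) \<phi> + ennreal (1 / real (Suc m))"
    by metis
  have "(\<lambda>m. hd_S \<Omega> (D m) \<phi> + ennreal (1 / real (Suc m))) \<longlonglongrightarrow> 0 + ennreal 0"
    by (intro tendsto_add S tendsto_ennrealI LIMSEQ_Suc [OF lim_1_over_n])
  then have lim: "(\<lambda>m. hd_S \<Omega> (D m) \<phi> + ennreal (1 / real (Suc m))) \<longlonglongrightarrow> 0" by simp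
  have err0: "(\<lambda>m. err m (w m)) \<longlonglongrightarrow> 0"
    by (rule tendsto_sandwich [OF _ _ tendsto_const lim]) (simp_all add: err_le del: of_nat_Suc)
  let ?e = "\<lambda>m. Lp_norm 2 \<Omega> (\<lambda>x. hd_Pi (D m) (w m) x - \<phi> x)
     + Lp_norm 4 \<Omega> (\<lambda>x. hd_grad (D m) (w m) x - weak_gradient \<Omega> \<phi> x)
     + Lp_norm 2 \<Omega> (\<lambda>x. hd_hess (D m) (w m) x - weak_hessian \<Omega> \<phi> x)"
  have e0: "?e \<longlonglongrightarrow> 0"
    using err0 tendsto_ennrealD [of ?e 0] by (simp add: err_eq [OF w] Lp_norm_nonneg)
  have "Lp_tendsto 2 \<Omega> (\<lambda>m. hd_Pi (D m) (w m)) \<phi>"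
    unfolding Lp_tendsto_def using hd_Pi_Lp [OF D w] \<phi>2
    by (intro conjI allI tendsto_sandwich [OF _ _ tendsto_const e0]) (auto simp: Lp_norm_nonneg)
  moreover have "Lp_tendsto 4 \<Omega> (\<lambda>m. hd_grad (D m) (w m)) (weak_gradient \<Omega> \<phi>)"
    unfolding Lp_tendsto_def using hd_grad_Lp [OF D w] wg
    by (intro conjI allI tendsto_sandwich [OF _ _ tendsto_const e0]) (auto simp: Lp_norm_nonneg)
  moreover have "Lp_tendsto 2 \<Omega> (\<lambda>m. hd_hess (D m) (w m)) (weak_hessian \<Omega> \<phi>)"
    unfolding Lp_tendsto_def using hd_hess_Lp [OF D w] wh
    by (intro conjI allI tendsto_sandwich [OF _ _ tendsto_const e0]) (auto simp: Lp_norm_nonneg)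
  ultimately show "\<exists>w. (\<forall>m. w m \<in> hd_space (D m)) \<and> Lp_tendsto 2 \<Omega> (\<lambda>m. hd_Pi (D m) (w m)) \<phi> \<and>
      Lp_tendsto 4 \<Omega> (\<lambda>m. hd_grad (D m) (w m)) (weak_gradient \<Omega> \<phi>) \<and>
      Lp_tendsto 2 \<Omega> (\<lambda>m. hd_hess (D m) (w m)) (weak_hessian \<Omega> \<phi>)"
    using w by blast
qed

end

subsection \<open>The Hessian scheme\<close>

text \<open>The difference has norm 0, so the bound forces equal values. Through this, almost
  everywhere linearity of the discrete operators becomes exact linearity of the composed forms in
  \<open>lin_on_cwise\<close>.\<close>

lemma bounded_form_cong:
  assumes F: "Lp_linear p \<Omega> F" "\<And>f. f \<in> Lp p \<Omega> \<Longrightarrow> \<bar>F f\<bar> \<le> C * Lp_norm p \<Omega> f" "p > 0"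
    and f: "f \<in> Lp p \<Omega>" and g: "g \<in> Lp p \<Omega>" and eq: "AE x in lebesgue_on \<Omega>. f x = g x"
  shows "F f = F g"
proof -
  have "AE x in lebesgue_on \<Omega>. f x - g x = 0" using eq by eventually_elim simp
  then have "Lp_norm p \<Omega> (\<lambda>x. f x - g x) = 0" using F(3) by (rule Lp_norm_eq_0_AE)
  then show ?thesis
    using F(2) [OF Lp_diff [OF f g]] Lp_linear_diff [OF F(1) f g] by simp
qed

section \<open>Tuples of functions and extraction of subsequences\<close>

lemma cwise_nth [simp]: "cwise F \<Psi> x $ i = F (\<Psi> $ i) x"
  by (simp add: cwise_def)

lemma tuplesD: "\<Psi> \<in> tuples X \<Longrightarrow> \<Psi> $ i \<in> X"
  by (simp add: tuples_def)

lemma cwise_Lp: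
  fixes F :: "'u \<Rightarrow> real ^ 'n::finite \<Rightarrow> 'v::euclidean_space"
  shows "(\<And>i. F (\<Psi> $ i) \<in> Lp p \<Omega>) \<Longrightarrow> cwise F \<Psi> \<in> Lp p \<Omega>"
  by (rule Lp_vec(1)) simp

lemma cwise_tendsto:
  fixes F :: "nat \<Rightarrow> 'u \<Rightarrow> real ^ 'n::finite \<Rightarrow> 'v::euclidean_space"
  assumes "p > 0" "\<And>i. Lp_tendsto p \<Omega> (\<lambda>m. F m (\<Psi> m $ i)) (G (\<Phi> $ i))"
  shows "Lp_tendsto p \<Omega> (\<lambda>m. cwise (F m) (\<Psi> m)) (cwise G \<Phi>)"
  by (rule Lp_tendsto_vec) (use assms in simp_all)

text \<open>For exponent 2 the norm of a tuple is exactly Pythagorean, so the constant bounding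
  \<open>hd_Pi\<close> carries over unchanged from components to tuples.\<close>

lemma L2_norm_cwise:
  fixes F :: "'u \<Rightarrow> real ^ 'n::finite \<Rightarrow> 'v::euclidean_space"
  assumes "\<And>i. F (\<Psi> $ i) \<in> Lp 2 \<Omega>"
  shows "(Lp_norm 2 \<Omega> (cwise F \<Psi>))\<^sup>2 = (\<Sum>i\<in>UNIV. (Lp_norm 2 \<Omega> (F (\<Psi> $ i)))\<^sup>2)"
  using Lp_vec_inner_integral [OF cwise_Lp cwise_Lp, of F \<Psi> \<Omega> F \<Psi>] assms
  by (simp add: Lp_norm_power power2_norm_eq_inner)

lemma L2_norm_component_le:
  fixes F :: "'u \<Rightarrow> real ^ 'n::finite \<Rightarrow> 'v::euclidean_space"
  assumes "\<And>i. F (\<Psi> $ i) \<in> Lp 2 \<Omega>"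
  shows "Lp_norm 2 \<Omega> (F (\<Psi> $ i)) \<le> Lp_norm 2 \<Omega> (cwise F \<Psi>)"
proof (rule power2_le_imp_le)
  show "(Lp_norm 2 \<Omega> (F (\<Psi> $ i)))\<^sup>2 \<le> (Lp_norm 2 \<Omega> (cwise F \<Psi>))\<^sup>2"
    unfolding L2_norm_cwise [of F \<Psi> \<Omega>, OF assms] by (intro member_le_sum) auto
qed (simp add: Lp_norm_nonneg)

lemma subspace_tuples:
  assumes "subspace X"
  shows "subspace (tuples X :: ('x::real_vector ^ 'k::finite) set)"
  using assms unfolding subspace_def tuples_def by simp

text \<open>Copies of \<open>b\<close> placed in every slot span the tuples; this is the finite
  spanning set that \<open>galerkin_existence\<close> asks for.\<close>

lemma finite_span_tuples:
  assumes "finite b" "span b = X"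
  shows "\<exists>S. finite S \<and> span S = (tuples X :: ('x::real_vector ^ 'k::finite) set)"
proof (intro exI conjI)
  let ?S = "(\<Union>i. axis i ` b) :: ('x ^ 'k) set"
  have X: "subspace X" using assms(2) by auto
  show "finite ?S" using assms(1) by simp
  show "span ?S = tuples X"
  proof
    have "axis i v \<in> tuples X" if "v \<in> b" for i v
      using span_base [OF that] assms(2) subspace_0 [OF X] by (auto simp: tuples_def axis_def)
    then show "span ?S \<subseteq> tuples X"
      by (intro span_minimal subspace_tuples X) auto
  next
    have axis: "axis i v \<in> span ?S" if "v \<in> X" for i v
    proof -
      have "v \<in> span b" using that assms(2) by simp
      then show ?thesis
      proof (induction rule: span_induct_alt)
        case base
        have "axis i (0 :: 'x) = 0" by (simp add: axis_def vec_eq_iff)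
        then show ?case by (simp only: span_zero)
      next
        case (step c x y)
        have "axis i (c *\<^sub>R x + y) = c *\<^sub>R axis i x + axis i y"
          by (simp add: axis_def vec_eq_iff)
        moreover have "axis i x \<in> span ?S" using step by (intro span_base) auto
        ultimately show ?case using step by (simp add: span_add span_scale)
      qed
    qed
    show "tuples X \<subseteq> span ?S"
    proof
      fix \<Psi> :: "'x ^ 'k" assume "\<Psi> \<in> tuples X"
      then have "(\<Sum>i\<in>UNIV. axis i (\<Psi> $ i)) \<in> span ?S"
        by (intro span_sum axis) (simp add: tuplesD)
      also have "(\<Sum>i\<in>UNIV. axis i (\<Psi> $ i)) = \<Psi>"
        by (simp add: vec_eq_iff axis_def)
      finally show "\<Psi> \<in> span ?S" .
    qed
  qed
qed

lemma lin_on_cwise: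
  fixes F :: "'x::real_vector \<Rightarrow> real ^ 'n::finite \<Rightarrow> 'v::euclidean_space"
    and G :: "(real ^ 'n \<Rightarrow> 'v ^ 'k::finite) \<Rightarrow> real"
  assumes X: "subspace X" and F: "linear_into_Lp p \<Omega> X F" and p: "p > 0"
    and G: "Lp_linear p \<Omega> G" "\<And>f. f \<in> Lp p \<Omega> \<Longrightarrow> \<bar>G f\<bar> \<le> C * Lp_norm p \<Omega> f"
  shows "lin_on (tuples X) (\<lambda>\<Psi>. G (cwise F \<Psi>))"
  unfolding lin_on_def
proof (intro ballI allI)
  fix \<Psi> \<Phi> :: "'x ^ 'k" and s t
  assume \<Psi>: "\<Psi> \<in> tuples X" and \<Phi>: "\<Phi> \<in> tuples X"
  have Lp: "cwise F \<Theta> \<in> Lp p \<Omega>" if "\<Theta> \<in> tuples X" for \<Theta> :: "'x ^ 'k"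
    using F tuplesD [OF that] by (intro cwise_Lp) (auto simp: linear_into_Lp_def)
  have sum: "s *\<^sub>R \<Psi> + t *\<^sub>R \<Phi> \<in> tuples X"
    by (intro subspace_add subspace_scale subspace_tuples X \<Psi> \<Phi>)
  have "AE x in lebesgue_on \<Omega>. cwise F (s *\<^sub>R \<Psi> + t *\<^sub>R \<Phi>) x = s *\<^sub>R cwise F \<Psi> x + t *\<^sub>R cwise F \<Phi> x"
    using F tuplesD [OF \<Psi>] tuplesD [OF \<Phi>] by (intro AE_vec_eqI) (simp add: linear_into_Lp_def)
  then have "G (cwise F (s *\<^sub>R \<Psi> + t *\<^sub>R \<Phi>)) = G (\<lambda>x. s *\<^sub>R cwise F \<Psi> x + t *\<^sub>R cwise F \<Phi> x)"
    by (intro bounded_form_cong [OF G p] Lp sum Lp_lincomb \<Psi> \<Phi>)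
  also have "\<dots> = s * G (cwise F \<Psi>) + t * G (cwise F \<Phi>)"
    using G(1) Lp [OF \<Psi>] Lp [OF \<Phi>] by (simp add: Lp_linear_def)
  finally show "G (cwise F (s *\<^sub>R \<Psi> + t *\<^sub>R \<Phi>)) = s * G (cwise F \<Psi>) + t * G (cwise F \<Phi>)" .
qed

text \<open>Extraction one index at a time: \<open>ex\<close> works along any subsequence already
  found, and \<open>sub\<close> preserves what was obtained for the earlier indices.\<close>

lemma common_subsequence:
  fixes P :: "'i \<Rightarrow> (nat \<Rightarrow> nat) \<Rightarrow> bool"
  assumes "finite I"
    and ex: "\<And>i (r :: nat \<Rightarrow> nat). i \<in> I \<Longrightarrow> strict_mono r \<Longrightarrow> \<exists>r' :: nat \<Rightarrow> nat. strict_mono r' \<and> P i (r \<circ> r')"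
    and sub: "\<And>i (r :: nat \<Rightarrow> nat) (r' :: nat \<Rightarrow> nat). P i r \<Longrightarrow> strict_mono r' \<Longrightarrow> P i (r \<circ> r')"
  shows "\<exists>r. strict_mono r \<and> (\<forall>i\<in>I. P i r)"
  using assms(1) ex
proof (induction I)
  case empty
  show ?case by (intro exI [of _ id]) (auto simp: strict_mono_def)
next
  case (insert i I)
  then obtain r where r: "strict_mono r" "\<forall>i\<in>I. P i r" by auto
  have "\<exists>r'. strict_mono r' \<and> P i (r \<circ> r')"
    by (rule insert.prems [OF insertI1 r(1)])
  then obtain r' where r': "strict_mono r'" "P i (r \<circ> r')" by (elim exE conjE)
  with r sub have "strict_mono (r \<circ> r') \<and> (\<forall>j\<in>insert i I. P j (r \<circ> r'))"
    by (auto simp: strict_mono_o)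
  then show ?case by blast
qed

text \<open>The compactness hypothesis speaks of full sequences of discretisations. It is applied to
  the full \<open>w\<close>, and the terms along \<open>r\<close> are then read as a sequence inside
  a relatively compact range. A second extraction handles the gradients.\<close>

lemma hd_compact_subsequence:
  fixes r :: "nat \<Rightarrow> nat"
  assumes comp: "hd_compact \<Omega> D" and w: "\<And>m. w m \<in> hd_space (D m)"
    and bnd: "\<And>m. hd_norm \<Omega> (D m) (w m) \<le> C" and r: "strict_mono r"
  shows "\<exists>r' u g. strict_mono r' \<and> Lp_tendsto 2 \<Omega> (\<lambda>m. hd_Pi (D (r (r' m))) (w (r (r' m)))) u \<and>
    Lp_tendsto 4 \<Omega> (\<lambda>m. hd_grad (D (r (r' m))) (w (r (r' m)))) g"
proof -
  have "bounded (range (\<lambda>m. hd_norm \<Omega> (D m) (w m)))"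
    using bnd by (intro boundedI [of _ C]) (auto simp: hd_norm_nonneg)
  then have c: "Lp_relatively_compact 2 \<Omega> (range (\<lambda>m. hd_Pi (D m) (w m)))"
      "Lp_relatively_compact 4 \<Omega> (range (\<lambda>m. hd_grad (D m) (w m)))"
    using comp w by (auto simp: hd_compact_def)
  have "\<exists>r1 u. strict_mono r1 \<and> Lp_tendsto 2 \<Omega> ((\<lambda>m. hd_Pi (D (r m)) (w (r m))) \<circ> r1) u"
    by (rule c(1) [unfolded Lp_relatively_compact_def, THEN conjunct2, THEN spec, THEN mp]) blast
  then obtain r1 u where r1: "strict_mono r1" "Lp_tendsto 2 \<Omega> ((\<lambda>m. hd_Pi (D (r m)) (w (r m))) \<circ> r1) u"
    by (elim exE conjE)
  have "\<exists>r2 g. strict_mono r2 \<and> Lp_tendsto 4 \<Omega> ((\<lambda>m. hd_grad (D (r (r1 m))) (w (r (r1 m)))) \<circ> r2) g"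
    by (rule c(2) [unfolded Lp_relatively_compact_def, THEN conjunct2, THEN spec, THEN mp]) blast
  then obtain r2 g where r2: "strict_mono r2" "Lp_tendsto 4 \<Omega> ((\<lambda>m. hd_grad (D (r (r1 m))) (w (r (r1 m)))) \<circ> r2) g"
    by (elim exE conjE)
  have "Lp_tendsto 2 \<Omega> (\<lambda>m. hd_Pi (D (r (r1 (r2 m)))) (w (r (r1 (r2 m))))) u"
    using Lp_tendsto_subseq [OF r1(2) r2(1)] by simp
  then show ?thesis
    using r2 strict_mono_o [OF r1(1) r2(1)] by (intro exI [of _ "r1 \<circ> r2"] exI [of _ u] exI [of _ g]) (simp add: o_def)
qed

section \<open>The discrete problem: existence and a priori bound\<close>

locale hessian_forms = finite_domain \<Omega>
  for \<Omega> :: "(real ^ 'n::finite) set" +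
  fixes A :: "(real ^ 'n \<Rightarrow> real ^ 'n ^ 'n ^ 'k::finite) \<Rightarrow> (real ^ 'n \<Rightarrow> real ^ 'n ^ 'n ^ 'k) \<Rightarrow> real"
    and B :: "(real ^ 'n \<Rightarrow> real ^ 'n ^ 'n ^ 'k) \<Rightarrow> (real ^ 'n \<Rightarrow> real ^ 'n ^ 'k)
      \<Rightarrow> (real ^ 'n \<Rightarrow> real ^ 'n ^ 'k) \<Rightarrow> real"
    and L :: "(real ^ 'n \<Rightarrow> real ^ 'k) \<Rightarrow> real"
    and \<alpha> CA CB CL :: real
  assumes A_lin2: "\<Xi> \<in> Lp 2 \<Omega> \<Longrightarrow> Lp_linear 2 \<Omega> (A \<Xi>)"
    and A_lin1: "\<Xi> \<in> Lp 2 \<Omega> \<Longrightarrow> Lp_linear 2 \<Omega> (\<lambda>X. A X \<Xi>)"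
    and A_bound: "\<Xi> \<in> Lp 2 \<Omega> \<Longrightarrow> X \<in> Lp 2 \<Omega> \<Longrightarrow> \<bar>A \<Xi> X\<bar> \<le> CA * Lp_norm 2 \<Omega> \<Xi> * Lp_norm 2 \<Omega> X"
    and \<alpha>_pos: "\<alpha> > 0"
    and A_coercive: "\<Xi> \<in> Lp 2 \<Omega> \<Longrightarrow> \<alpha> * (Lp_norm 2 \<Omega> \<Xi>)\<^sup>2 \<le> A \<Xi> \<Xi>"
    and B_lin1: "\<Theta> \<in> Lp 4 \<Omega> \<Longrightarrow> T \<in> Lp 4 \<Omega> \<Longrightarrow> Lp_linear 2 \<Omega> (\<lambda>\<Xi>. B \<Xi> \<Theta> T)"
    and B_lin2: "\<Xi> \<in> Lp 2 \<Omega> \<Longrightarrow> T \<in> Lp 4 \<Omega> \<Longrightarrow> Lp_linear 4 \<Omega> (\<lambda>\<Theta>. B \<Xi> \<Theta> T)"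
    and B_lin3: "\<Xi> \<in> Lp 2 \<Omega> \<Longrightarrow> \<Theta> \<in> Lp 4 \<Omega> \<Longrightarrow> Lp_linear 4 \<Omega> (B \<Xi> \<Theta>)"
    and B_bound: "\<Xi> \<in> Lp 2 \<Omega> \<Longrightarrow> \<Theta> \<in> Lp 4 \<Omega> \<Longrightarrow> T \<in> Lp 4 \<Omega> \<Longrightarrow>
        \<bar>B \<Xi> \<Theta> T\<bar> \<le> CB * Lp_norm 2 \<Omega> \<Xi> * Lp_norm 4 \<Omega> \<Theta> * Lp_norm 4 \<Omega> T"
    and B_skew: "\<Xi> \<in> Lp 2 \<Omega> \<Longrightarrow> \<Theta> \<in> Lp 4 \<Omega> \<Longrightarrow> B \<Xi> \<Theta> \<Theta> = 0"
    and L_lin: "Lp_linear 2 \<Omega> L"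
    and L_bound: "f \<in> Lp 2 \<Omega> \<Longrightarrow> \<bar>L f\<bar> \<le> CL * Lp_norm 2 \<Omega> f"
    and C_nonneg: "0 \<le> CA" "0 \<le> CB" "0 \<le> CL"
begin

lemma A_bound1: "\<Xi> \<in> Lp 2 \<Omega> \<Longrightarrow> X \<in> Lp 2 \<Omega> \<Longrightarrow> \<bar>A X \<Xi>\<bar> \<le> (CA * Lp_norm 2 \<Omega> \<Xi>) * Lp_norm 2 \<Omega> X"
  using A_bound [of X \<Xi>] by (simp add: mult_ac)

lemma B_bound1: "\<Theta> \<in> Lp 4 \<Omega> \<Longrightarrow> T \<in> Lp 4 \<Omega> \<Longrightarrow> \<Xi> \<in> Lp 2 \<Omega> \<Longrightarrow>
    \<bar>B \<Xi> \<Theta> T\<bar> \<le> (CB * Lp_norm 4 \<Omega> \<Theta> * Lp_norm 4 \<Omega> T) * Lp_norm 2 \<Omega> \<Xi>"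
  using B_bound [of \<Xi> \<Theta> T] by (simp add: mult_ac)

lemma B_bound2: "\<Xi> \<in> Lp 2 \<Omega> \<Longrightarrow> T \<in> Lp 4 \<Omega> \<Longrightarrow> \<Theta> \<in> Lp 4 \<Omega> \<Longrightarrow>
    \<bar>B \<Xi> \<Theta> T\<bar> \<le> (CB * Lp_norm 2 \<Omega> \<Xi> * Lp_norm 4 \<Omega> T) * Lp_norm 4 \<Omega> \<Theta>"
  using B_bound [of \<Xi> \<Theta> T] by (simp add: mult_ac)

context
  fixes D :: "('x::real_vector, 'n) hess_disc" and C :: real
  assumes D: "hessian_discretisation \<Omega> D" and C: "hd_C \<Omega> D \<le> ennreal C" "0 \<le> C"
begin

lemma cwise_hd_Lp:
  assumes "\<Psi> \<in> tuples (hd_space D)"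
  shows "cwise (hd_Pi D) \<Psi> \<in> Lp 2 \<Omega>" "cwise (hd_grad D) \<Psi> \<in> Lp 4 \<Omega>" "cwise (hd_hess D) \<Psi> \<in> Lp 2 \<Omega>"
  using tuplesD [OF assms]
  by (auto intro!: cwise_Lp hd_Pi_Lp [OF D] hd_grad_Lp [OF D] hd_hess_Lp [OF D])

lemma cwise_Pi_le:
  assumes \<Psi>: "\<Psi> \<in> tuples (hd_space D)"
  shows "Lp_norm 2 \<Omega> (cwise (hd_Pi D) \<Psi>) \<le> C * Lp_norm 2 \<Omega> (cwise (hd_hess D) \<Psi>)"
proof (rule power2_le_imp_le)
  have "(Lp_norm 2 \<Omega> (cwise (hd_Pi D) \<Psi>))\<^sup>2 = (\<Sum>i\<in>UNIV. (Lp_norm 2 \<Omega> (hd_Pi D (\<Psi> $ i)))\<^sup>2)"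
    by (intro L2_norm_cwise hd_Pi_Lp [OF D] tuplesD \<Psi>)
  also have "\<dots> \<le> (\<Sum>i\<in>UNIV. (C * Lp_norm 2 \<Omega> (hd_hess D (\<Psi> $ i)))\<^sup>2)"
    using hd_C_bound(1) [OF D C tuplesD [OF \<Psi>]]
    by (intro sum_mono power_mono Lp_norm_nonneg) (auto simp: hd_norm_def)
  also have "\<dots> = (C * Lp_norm 2 \<Omega> (cwise (hd_hess D) \<Psi>))\<^sup>2"
    using L2_norm_cwise [of "hd_hess D" \<Psi> \<Omega>, OF hd_hess_Lp [OF D tuplesD [OF \<Psi>]]]
    by (simp add: power_mult_distrib sum_distrib_left)
  finally show "(Lp_norm 2 \<Omega> (cwise (hd_Pi D) \<Psi>))\<^sup>2 \<le> (C * Lp_norm 2 \<Omega> (cwise (hd_hess D) \<Psi>))\<^sup>2" .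
qed (simp add: C(2) Lp_norm_nonneg)

lemma L_Pi_le:
  assumes \<Psi>: "\<Psi> \<in> tuples (hd_space D)"
  shows "\<bar>L (cwise (hd_Pi D) \<Psi>)\<bar> \<le> CL * C * Lp_norm 2 \<Omega> (cwise (hd_hess D) \<Psi>)"
  using order_trans [OF L_bound [OF cwise_hd_Lp(1) [OF \<Psi>]] mult_left_mono [OF cwise_Pi_le [OF \<Psi>] C_nonneg(3)]]
  by (simp add: mult_ac)

lemma hessian_scheme_exists: "\<exists>\<Psi>. hessian_scheme_solution A B L D \<Psi>"
proof -
  let ?T = "tuples (hd_space D) :: ('x ^ 'k) set"
  let ?H = "cwise (hd_hess D) :: 'x ^ 'k \<Rightarrow> _" and ?G = "cwise (hd_grad D) :: 'x ^ 'k \<Rightarrow> _"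
  have X: "subspace (hd_space D)" by (rule hd_subspace [OF D])
  obtain b where "finite b" "span b = hd_space D"
    using D by (auto simp: hessian_discretisation_def)
  then obtain S where S: "finite S" "span S = ?T"
    using finite_span_tuples by blast
  have "\<exists>u\<in>?T. \<forall>w\<in>?T. A (?H u) (?H w) + B (?H u) (?G u) (?G w) = L (cwise (hd_Pi D) w)"
  \<comment> \<open>With \<open>N\<close> the norm of the discrete Hessian, \<open>L_Pi_le\<close>
    bounds the square of the right-hand side by \<open>(CL * C * N)\<^sup>2\<close>, and coercivity
    bounds \<open>N\<^sup>2\<close> by the energy over \<open>\<alpha>\<close>; this gives the value
    of \<open>K\<close>.\<close>
  proof (rule galerkin_existence [OF subspace_tuples [OF X] S, where K = "(CL * C)\<^sup>2 / \<alpha>"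
        and a = "\<lambda>u w. A (?H u) (?H w)" and b = "\<lambda>u v w. B (?H u) (?G v) (?G w)"
        and l = "\<lambda>w. L (cwise (hd_Pi D) w)"])
    show "lin_on ?T (\<lambda>u. A (?H u) (?H w))" if "w \<in> ?T" for w
      by (rule lin_on_cwise [OF X hd_hess_lin [OF D] zero_less_numeral
            A_lin1 [OF cwise_hd_Lp(3) [OF that]] A_bound1 [OF cwise_hd_Lp(3) [OF that]]])
    show "lin_on ?T (\<lambda>w. A (?H u) (?H w))" if "u \<in> ?T" for u
      by (rule lin_on_cwise [OF X hd_hess_lin [OF D] zero_less_numeral
            A_lin2 [OF cwise_hd_Lp(3) [OF that]] A_bound [OF cwise_hd_Lp(3) [OF that]]])
    show "lin_on ?T (\<lambda>u. B (?H u) (?G v) (?G w))" if "v \<in> ?T" "w \<in> ?T" for v w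
      by (rule lin_on_cwise [OF X hd_hess_lin [OF D] zero_less_numeral
            B_lin1 [OF cwise_hd_Lp(2) [OF that(1)] cwise_hd_Lp(2) [OF that(2)]]
            B_bound1 [OF cwise_hd_Lp(2) [OF that(1)] cwise_hd_Lp(2) [OF that(2)]]])
    show "lin_on ?T (\<lambda>v. B (?H u) (?G v) (?G w))" if "u \<in> ?T" "w \<in> ?T" for u w
      by (rule lin_on_cwise [OF X hd_grad_lin [OF D] zero_less_numeral
            B_lin2 [OF cwise_hd_Lp(3) [OF that(1)] cwise_hd_Lp(2) [OF that(2)]]
            B_bound2 [OF cwise_hd_Lp(3) [OF that(1)] cwise_hd_Lp(2) [OF that(2)]]])
    show "lin_on ?T (\<lambda>w. B (?H u) (?G v) (?G w))" if "u \<in> ?T" "v \<in> ?T" for u v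
      by (rule lin_on_cwise [OF X hd_grad_lin [OF D] zero_less_numeral
            B_lin3 [OF cwise_hd_Lp(3) [OF that(1)] cwise_hd_Lp(2) [OF that(2)]]
            B_bound [OF cwise_hd_Lp(3) [OF that(1)] cwise_hd_Lp(2) [OF that(2)]]])
    show "lin_on ?T (\<lambda>w. L (cwise (hd_Pi D) w))"
      by (rule lin_on_cwise [OF X hd_Pi_lin [OF D] zero_less_numeral L_lin L_bound])
    show "A (?H u) (?H u) > 0" if u: "u \<in> ?T" "u \<noteq> 0" for u
    proof -
      obtain i where "u $ i \<noteq> 0" using u(2) by (auto simp: vec_eq_iff)
      then have "0 < Lp_norm 2 \<Omega> (hd_hess D (u $ i))"
        using hd_norm_pos [OF D tuplesD [OF u(1)]] by (simp add: hd_norm_def)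
      also have "\<dots> \<le> Lp_norm 2 \<Omega> (?H u)"
        by (intro L2_norm_component_le hd_hess_Lp [OF D] tuplesD u)
      finally have "0 < \<alpha> * (Lp_norm 2 \<Omega> (?H u))\<^sup>2" using \<alpha>_pos by simp
      with A_coercive [OF cwise_hd_Lp(3) [OF u(1)]] show ?thesis by linarith
    qed
    show "B (?H u) (?G u) (?G u) = 0" if "u \<in> ?T" for u
      by (intro B_skew cwise_hd_Lp that)
    show "(L (cwise (hd_Pi D) u))\<^sup>2 \<le> (CL * C)\<^sup>2 / \<alpha> * A (?H u) (?H u)" if u: "u \<in> ?T" for u
    proof -
      have "(L (cwise (hd_Pi D) u))\<^sup>2 \<le> (CL * C * Lp_norm 2 \<Omega> (?H u))\<^sup>2"
        using power_mono [OF L_Pi_le [OF u], of 2] by simp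
      also have "\<dots> = (CL * C)\<^sup>2 / \<alpha> * (\<alpha> * (Lp_norm 2 \<Omega> (?H u))\<^sup>2)"
        using \<alpha>_pos by (simp add: power_mult_distrib)
      also have "\<dots> \<le> (CL * C)\<^sup>2 / \<alpha> * A (?H u) (?H u)"
        using \<alpha>_pos by (intro mult_left_mono A_coercive cwise_hd_Lp u) auto
      finally show ?thesis .
    qed
    show "(CL * C)\<^sup>2 / \<alpha> \<ge> 0" using \<alpha>_pos by simp
  qed
  then show ?thesis by (auto simp: hessian_scheme_solution_def)
qed

text \<open>Testing the scheme with its own solution removes \<open>B\<close> by (A3), leaving
  \<open>\<alpha> * N\<^sup>2 \<le> CL * C * N\<close> for the norm \<open>N\<close> of the discrete
  Hessian. The discretisation enters only through \<open>C\<close>, so the bound is uniform along a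
  coercive sequence.\<close>

lemma hessian_scheme_bound:
  assumes sol: "hessian_scheme_solution A B L D \<Psi>"
  shows "Lp_norm 2 \<Omega> (cwise (hd_hess D) \<Psi>) \<le> CL * C / \<alpha>"
proof -
  let ?N = "Lp_norm 2 \<Omega> (cwise (hd_hess D) \<Psi>)"
  have \<Psi>: "\<Psi> \<in> tuples (hd_space D)" using sol by (simp add: hessian_scheme_solution_def)
  have "\<alpha> * ?N\<^sup>2 \<le> A (cwise (hd_hess D) \<Psi>) (cwise (hd_hess D) \<Psi>)"
    by (intro A_coercive cwise_hd_Lp \<Psi>)
  also have "\<dots> = L (cwise (hd_Pi D) \<Psi>)"
    using sol \<Psi> B_skew [OF cwise_hd_Lp(3) [OF \<Psi>] cwise_hd_Lp(2) [OF \<Psi>]] by (auto simp: hessian_scheme_solution_def)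
  also have "\<dots> \<le> CL * C * ?N" using L_Pi_le [OF \<Psi>] by simp
  finally have "?N * (\<alpha> * ?N) \<le> ?N * (CL * C)"
    by (simp add: power2_eq_square mult_ac)
  moreover have "0 \<le> ?N" by (simp add: Lp_norm_nonneg)
  ultimately have "\<alpha> * ?N \<le> CL * C \<or> ?N = 0"
    by (metis less_eq_real_def mult_le_cancel_left_pos)
  moreover have "0 \<le> CL * C" using C C_nonneg by simp
  ultimately show ?thesis
    using \<alpha>_pos by (auto simp: le_divide_eq mult.commute)
qed

end

section \<open>Passage to the limit\<close>

lemma weak_tendsto_functional:
  fixes f :: "nat \<Rightarrow> real ^ 'n \<Rightarrow> real ^ 'n ^ 'n ^ 'k"
  assumes F: "Lp_linear 2 \<Omega> F" "\<And>f. f \<in> Lp 2 \<Omega> \<Longrightarrow> \<bar>F f\<bar> \<le> c * Lp_norm 2 \<Omega> f"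
    and f: "\<And>m. f m \<in> Lp 2 \<Omega>" and h: "h \<in> Lp 2 \<Omega>"
    and weak: "\<And>\<xi>. \<xi> \<in> Lp 2 \<Omega> \<Longrightarrow> (\<lambda>m. \<integral>x. \<xi> x \<bullet> f m x \<partial>lebesgue_on \<Omega>)
      \<longlonglongrightarrow> (\<integral>x. \<xi> x \<bullet> h x \<partial>lebesgue_on \<Omega>)"
  shows "(\<lambda>m. F (f m)) \<longlonglongrightarrow> F h"
proof -
  \<comment> \<open>Every bounded functional on L2 is an integral, so convergence of integrals is
    all that weak convergence has to provide.\<close>
  obtain a where "a \<in> Lp 2 \<Omega>" "\<And>f. f \<in> Lp 2 \<Omega> \<Longrightarrow> F f = (\<integral>x. a x \<bullet> f x \<partial>lebesgue_on \<Omega>)"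
    using L2_Riesz [OF fin F] by blast
  with weak [of a] f h show ?thesis by simp
qed

text \<open>\<open>D\<close> stands for an already extracted subsequence, so \<open>lim\<close>
  merely asserts that limits exist. Consistency supplies discrete test functions for the limit
  equation; strong convergence of the Hessians then follows by testing that equation with its own
  solution.\<close>

proposition hessian_scheme_limit:
  fixes D :: "nat \<Rightarrow> ('x::real_vector, 'n) hess_disc"
  assumes D: "\<And>m. hessian_discretisation \<Omega> (D m)"
    and cons: "hd_consistent \<Omega> D" and conf: "hd_limit_conforming \<Omega> D"
    and sol: "\<And>m. hessian_scheme_solution A B L (D m) (\<Psi>D m)"
    and bnd: "\<And>m. Lp_norm 2 \<Omega> (cwise (hd_hess (D m)) (\<Psi>D m)) \<le> C"
    and lim: "\<And>i. \<exists>u g. Lp_tendsto 2 \<Omega> (\<lambda>m. hd_Pi (D m) (\<Psi>D m $ i)) u \<and>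
      Lp_tendsto 4 \<Omega> (\<lambda>m. hd_grad (D m) (\<Psi>D m $ i)) g"
  shows "\<exists>\<Psi>. weak_solution \<Omega> A B L \<Psi> \<and>
        Lp_tendsto 2 \<Omega> (\<lambda>m. cwise (hd_Pi (D m)) (\<Psi>D m)) (cwise (\<lambda>u. u) \<Psi>) \<and>
        Lp_tendsto 4 \<Omega> (\<lambda>m. cwise (hd_grad (D m)) (\<Psi>D m)) (cwise (weak_gradient \<Omega>) \<Psi>) \<and>
        Lp_tendsto 2 \<Omega> (\<lambda>m. cwise (hd_hess (D m)) (\<Psi>D m)) (cwise (weak_hessian \<Omega>) \<Psi>)"
proof -
  let ?M = "lebesgue_on \<Omega>"
  have T: "\<Psi>D m \<in> tuples (hd_space (D m))" for m
    using sol [of m] by (simp add: hessian_scheme_solution_def)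
  have comp: "\<Psi>D m $ i \<in> hd_space (D m)" for m i
    by (rule tuplesD [OF T])
  have comp_bnd: "hd_norm \<Omega> (D m) (\<Psi>D m $ i) \<le> C" for m i
    unfolding hd_norm_def
    by (rule order_trans [OF L2_norm_component_le bnd]) (rule hd_hess_Lp [OF D comp])
  have "\<exists>U. \<forall>i. \<exists>g. Lp_tendsto 2 \<Omega> (\<lambda>m. hd_Pi (D m) (\<Psi>D m $ i)) (U i) \<and>
      Lp_tendsto 4 \<Omega> (\<lambda>m. hd_grad (D m) (\<Psi>D m $ i)) g"
    by (intro choice allI lim)
  then obtain U where "\<forall>i. \<exists>g. Lp_tendsto 2 \<Omega> (\<lambda>m. hd_Pi (D m) (\<Psi>D m $ i)) (U i) \<and>
      Lp_tendsto 4 \<Omega> (\<lambda>m. hd_grad (D m) (\<Psi>D m $ i)) g"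
    by (elim exE)
  then have "\<exists>g. \<forall>i. Lp_tendsto 2 \<Omega> (\<lambda>m. hd_Pi (D m) (\<Psi>D m $ i)) (U i) \<and>
      Lp_tendsto 4 \<Omega> (\<lambda>m. hd_grad (D m) (\<Psi>D m $ i)) (g i)"
    by (rule choice)
  then obtain g where Ug: "\<forall>i. Lp_tendsto 2 \<Omega> (\<lambda>m. hd_Pi (D m) (\<Psi>D m $ i)) (U i) \<and>
      Lp_tendsto 4 \<Omega> (\<lambda>m. hd_grad (D m) (\<Psi>D m $ i)) (g i)"
    by (elim exE)
  have U: "Lp_tendsto 2 \<Omega> (\<lambda>m. hd_Pi (D m) (\<Psi>D m $ i)) (U i)"
    and g: "Lp_tendsto 4 \<Omega> (\<lambda>m. hd_grad (D m) (\<Psi>D m $ i)) (g i)" for i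
    using Ug by simp_all
  note lims = limit_of_bounded_discrete_functions [OF D conf comp comp_bnd U g]
  define \<Psi> where "\<Psi> = (\<chi> i. U i)"
  have \<Psi>_nth [simp]: "\<Psi> $ i = U i" for i by (simp add: \<Psi>_def)
  have \<Psi>: "\<Psi> \<in> tuples (H20 \<Omega>)" using lims(1) by (simp add: tuples_def)
  let ?P = "\<lambda>m. cwise (hd_Pi (D m)) (\<Psi>D m)" and ?G = "\<lambda>m. cwise (hd_grad (D m)) (\<Psi>D m)"
    and ?H = "\<lambda>m. cwise (hd_hess (D m)) (\<Psi>D m)"
  let ?p = "cwise (\<lambda>u. u) \<Psi>" and ?g = "cwise (weak_gradient \<Omega>) \<Psi>" and ?h = "cwise (weak_hessian \<Omega>) \<Psi>"
  have P: "Lp_tendsto 2 \<Omega> ?P ?p"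
    by (rule cwise_tendsto) (simp_all add: U)
  have G: "Lp_tendsto 4 \<Omega> ?G ?g"
    by (rule cwise_tendsto) (simp_all add: lims(2))
  have Gm: "?G m \<in> Lp 4 \<Omega>" and g4: "?g \<in> Lp 4 \<Omega>" for m using G by (auto simp: Lp_tendsto_def)
  have Hm: "?H m \<in> Lp 2 \<Omega>" for m
    by (intro cwise_Lp hd_hess_Lp [OF D] comp)
  have wh: "weak_hessian \<Omega> u \<in> Lp 2 \<Omega>" if "u \<in> H20 \<Omega>" for u
    using that weak_hessian(1) by (auto simp: H20_def H2_def)
  have h2: "?h \<in> Lp 2 \<Omega>"
    by (intro cwise_Lp wh tuplesD [OF \<Psi>])
  have weak: "(\<lambda>m. \<integral>x. \<xi> x \<bullet> ?H m x \<partial>?M) \<longlonglongrightarrow> (\<integral>x. \<xi> x \<bullet> ?h x \<partial>?M)"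
    if \<xi>: "\<xi> \<in> Lp 2 \<Omega>" for \<xi> :: "real ^ 'n \<Rightarrow> real ^ 'n ^ 'n ^ 'k"
    unfolding Lp_vec_inner_integral [OF \<xi> Hm] Lp_vec_inner_integral [OF \<xi> h2]
    by (intro tendsto_sum) (simp add: lims(3) [OF Lp_component [OF \<xi>]])
  note weakF = weak_tendsto_functional [OF _ _ Hm h2 weak]
  have eq: "A (?H m) (cwise (hd_hess (D m)) \<Phi>) + B (?H m) (?G m) (cwise (hd_grad (D m)) \<Phi>)
      = L (cwise (hd_Pi (D m)) \<Phi>)" if "\<Phi> \<in> tuples (hd_space (D m))" for m \<Phi>
    using sol [of m] that by (simp add: hessian_scheme_solution_def)
  have C: "0 \<le> C" by (rule order_trans [OF Lp_norm_nonneg bnd]) simp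
  have limit_eq: "A ?h (cwise (weak_hessian \<Omega>) \<Phi>) + B ?h ?g (cwise (weak_gradient \<Omega>) \<Phi>) = L (cwise (\<lambda>u. u) \<Phi>)"
    if \<Phi>: "\<Phi> \<in> tuples (H20 \<Omega>)" for \<Phi> :: "(real ^ 'n \<Rightarrow> real) ^ 'k"
  proof -
    have "\<exists>w. \<forall>i. (\<forall>m. w i m \<in> hd_space (D m)) \<and> Lp_tendsto 2 \<Omega> (\<lambda>m. hd_Pi (D m) (w i m)) (\<Phi> $ i) \<and>
      Lp_tendsto 4 \<Omega> (\<lambda>m. hd_grad (D m) (w i m)) (weak_gradient \<Omega> (\<Phi> $ i)) \<and>
      Lp_tendsto 2 \<Omega> (\<lambda>m. hd_hess (D m) (w i m)) (weak_hessian \<Omega> (\<Phi> $ i))"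
      by (intro choice allI consistent_approximation(2) [OF D cons] tuplesD [OF \<Phi>])
    then obtain w where w_all: "\<forall>i. (\<forall>m. w i m \<in> hd_space (D m)) \<and> Lp_tendsto 2 \<Omega> (\<lambda>m. hd_Pi (D m) (w i m)) (\<Phi> $ i) \<and>
      Lp_tendsto 4 \<Omega> (\<lambda>m. hd_grad (D m) (w i m)) (weak_gradient \<Omega> (\<Phi> $ i)) \<and>
      Lp_tendsto 2 \<Omega> (\<lambda>m. hd_hess (D m) (w i m)) (weak_hessian \<Omega> (\<Phi> $ i))"
      by (elim exE)
    have w: "w i m \<in> hd_space (D m)"
      and wP: "Lp_tendsto 2 \<Omega> (\<lambda>m. hd_Pi (D m) (w i m)) (\<Phi> $ i)"
      and wG: "Lp_tendsto 4 \<Omega> (\<lambda>m. hd_grad (D m) (w i m)) (weak_gradient \<Omega> (\<Phi> $ i))"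
      and wH: "Lp_tendsto 2 \<Omega> (\<lambda>m. hd_hess (D m) (w i m)) (weak_hessian \<Omega> (\<Phi> $ i))" for i m
      using w_all by simp_all
    define W where "W m = (\<chi> i. w i m)" for m
    have W: "W m \<in> tuples (hd_space (D m))" for m using w by (simp add: W_def tuples_def)
    let ?Pw = "\<lambda>m. cwise (hd_Pi (D m)) (W m)" and ?Gw = "\<lambda>m. cwise (hd_grad (D m)) (W m)"
      and ?Hw = "\<lambda>m. cwise (hd_hess (D m)) (W m)"
    let ?g\<Phi> = "cwise (weak_gradient \<Omega>) \<Phi>" and ?h\<Phi> = "cwise (weak_hessian \<Omega>) \<Phi>"
    have limP: "Lp_tendsto 2 \<Omega> ?Pw (cwise (\<lambda>u. u) \<Phi>)"
      by (rule cwise_tendsto) (simp_all add: W_def wP)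
    have limG: "Lp_tendsto 4 \<Omega> ?Gw ?g\<Phi>"
      by (rule cwise_tendsto) (simp_all add: W_def wG)
    have limH: "Lp_tendsto 2 \<Omega> ?Hw ?h\<Phi>"
      by (rule cwise_tendsto) (simp_all add: W_def wH)
    have Gw: "?Gw m \<in> Lp 4 \<Omega>" and g\<Phi>: "?g\<Phi> \<in> Lp 4 \<Omega>" for m using limG by (auto simp: Lp_tendsto_def)
    have Hw: "?Hw m \<in> Lp 2 \<Omega>" and h\<Phi>: "?h\<Phi> \<in> Lp 2 \<Omega>" for m using limH by (auto simp: Lp_tendsto_def)
    obtain CG where CG: "\<And>m. Lp_norm 4 \<Omega> (?Gw m) \<le> CG"
      using Lp_tendsto_bounded [OF limG] by auto
    \<comment> \<open>The discrete test Hessians converge strongly, so replacing them by their limit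
      costs a multiple of the error, uniformly by the bound \<open>C\<close>. What is left is a
      fixed functional of \<open>?H m\<close>.\<close>
    have A1: "(\<lambda>m. A (?H m) (?Hw m) - A (?H m) ?h\<Phi>) \<longlonglongrightarrow> 0"
    proof (rule tendsto_from_bound)
      fix m
      have "\<bar>A (?H m) (\<lambda>x. ?Hw m x - ?h\<Phi> x)\<bar> \<le> CA * Lp_norm 2 \<Omega> (?H m) * Lp_norm 2 \<Omega> (\<lambda>x. ?Hw m x - ?h\<Phi> x)"
        by (intro A_bound Hm Lp_diff Hw h\<Phi>)
      also have "\<dots> \<le> CA * C * Lp_norm 2 \<Omega> (\<lambda>x. ?Hw m x - ?h\<Phi> x)"
        by (intro mult_right_mono mult_left_mono bnd C_nonneg Lp_norm_nonneg) simp
      finally show "\<bar>A (?H m) (?Hw m) - A (?H m) ?h\<Phi>\<bar> \<le> CA * C * Lp_norm 2 \<Omega> (\<lambda>x. ?Hw m x - ?h\<Phi> x)"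
        by (simp add: Lp_linear_diff [OF A_lin2 [OF Hm] Hw h\<Phi>])
    qed (use limH in \<open>simp add: Lp_tendsto_def\<close>)
    have A2: "(\<lambda>m. A (?H m) ?h\<Phi>) \<longlonglongrightarrow> A ?h ?h\<Phi>"
      by (rule weakF [OF A_lin1 [OF h\<Phi>] A_bound1 [OF h\<Phi>]])
    \<comment> \<open>The gradient arguments of \<open>B\<close> are exchanged one at a time, each
      at the cost of one strong error, until the weakly convergent Hessian is the only varying
      argument.\<close>
    have B1: "(\<lambda>m. B (?H m) (?G m) (?Gw m) - B (?H m) ?g (?Gw m)) \<longlonglongrightarrow> 0"
    proof (rule tendsto_from_bound)
      fix m
      have "\<bar>B (?H m) (\<lambda>x. ?G m x - ?g x) (?Gw m)\<bar>
          \<le> (CB * Lp_norm 2 \<Omega> (?H m) * Lp_norm 4 \<Omega> (?Gw m)) * Lp_norm 4 \<Omega> (\<lambda>x. ?G m x - ?g x)"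
        by (intro B_bound2 Hm Lp_diff Gm g4 Gw)
      also have "\<dots> \<le> CB * C * CG * Lp_norm 4 \<Omega> (\<lambda>x. ?G m x - ?g x)"
        using C C_nonneg CG bnd by (intro mult_right_mono mult_mono Lp_norm_nonneg mult_nonneg_nonneg) auto
      finally show "\<bar>B (?H m) (?G m) (?Gw m) - B (?H m) ?g (?Gw m)\<bar> \<le> CB * C * CG * Lp_norm 4 \<Omega> (\<lambda>x. ?G m x - ?g x)"
        by (simp add: Lp_linear_diff [OF B_lin2 [OF Hm Gw] Gm g4])
    qed (use G in \<open>simp add: Lp_tendsto_def\<close>)
    have B2: "(\<lambda>m. B (?H m) ?g (?Gw m) - B (?H m) ?g ?g\<Phi>) \<longlonglongrightarrow> 0"
    proof (rule tendsto_from_bound)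
      fix m
      have "\<bar>B (?H m) ?g (\<lambda>x. ?Gw m x - ?g\<Phi> x)\<bar>
          \<le> CB * Lp_norm 2 \<Omega> (?H m) * Lp_norm 4 \<Omega> ?g * Lp_norm 4 \<Omega> (\<lambda>x. ?Gw m x - ?g\<Phi> x)"
        by (intro B_bound Hm Lp_diff Gw g4 g\<Phi>)
      also have "\<dots> \<le> CB * C * Lp_norm 4 \<Omega> ?g * Lp_norm 4 \<Omega> (\<lambda>x. ?Gw m x - ?g\<Phi> x)"
        by (intro mult_right_mono mult_left_mono bnd C_nonneg Lp_norm_nonneg) simp_all
      finally show "\<bar>B (?H m) ?g (?Gw m) - B (?H m) ?g ?g\<Phi>\<bar> \<le> CB * C * Lp_norm 4 \<Omega> ?g * Lp_norm 4 \<Omega> (\<lambda>x. ?Gw m x - ?g\<Phi> x)"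
        by (simp add: Lp_linear_diff [OF B_lin3 [OF Hm g4] Gw g\<Phi>])
    qed (use limG in \<open>simp add: Lp_tendsto_def\<close>)
    have B3: "(\<lambda>m. B (?H m) ?g ?g\<Phi>) \<longlonglongrightarrow> B ?h ?g ?g\<Phi>"
      by (rule weakF [OF B_lin1 [OF g4 g\<Phi>] B_bound1 [OF g4 g\<Phi>]])
    have "(\<lambda>m. (A (?H m) (?Hw m) - A (?H m) ?h\<Phi>) + A (?H m) ?h\<Phi>
        + ((B (?H m) (?G m) (?Gw m) - B (?H m) ?g (?Gw m)) + (B (?H m) ?g (?Gw m) - B (?H m) ?g ?g\<Phi>) + B (?H m) ?g ?g\<Phi>))
      \<longlonglongrightarrow> 0 + A ?h ?h\<Phi> + (0 + 0 + B ?h ?g ?g\<Phi>)"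
      by (intro tendsto_add A1 A2 B1 B2 B3)
    then have "(\<lambda>m. L (?Pw m)) \<longlonglongrightarrow> A ?h ?h\<Phi> + B ?h ?g ?g\<Phi>"
      using eq [OF W] by simp
    moreover have "(\<lambda>m. L (?Pw m)) \<longlonglongrightarrow> L (cwise (\<lambda>u. u) \<Phi>)"
      by (rule Lp_linear_tendsto [OF L_lin L_bound limP])
    ultimately show ?thesis by (rule LIMSEQ_unique)
  qed
  then have "weak_solution \<Omega> A B L \<Psi>" using \<Psi> by (simp add: weak_solution_def)
  moreover have "Lp_tendsto 2 \<Omega> ?H ?h"
  proof -
    \<comment> \<open>(A3) removes \<open>B\<close> from both energy identities. For the limit this
      relies on \<open>g4\<close>, the membership of the weak gradient in
      \<open>Lp 4\<close>.\<close>
    have AHH: "A (?H m) (?H m) = L (?P m)" for m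
      using eq [OF T, of m] B_skew [OF Hm Gm, of m m] by simp
    have Ahh: "A ?h ?h = L ?p"
      using limit_eq [OF \<Psi>] B_skew [OF h2 g4] by simp
    \<comment> \<open>Both mixed terms are kept, since \<open>A\<close> need not be symmetric; in
      each of them only one argument varies, so weak convergence is enough.\<close>
    have le: "(Lp_norm 2 \<Omega> (\<lambda>x. ?H m x - ?h x))\<^sup>2 \<le> (L (?P m) - A (?H m) ?h - A ?h (?H m) + L ?p) / \<alpha>" for m
    proof -
      have "\<alpha> * (Lp_norm 2 \<Omega> (\<lambda>x. ?H m x - ?h x))\<^sup>2 \<le> A (\<lambda>x. ?H m x - ?h x) (\<lambda>x. ?H m x - ?h x)"
        by (intro A_coercive Lp_diff Hm h2)
      also have "\<dots> = (A (?H m) (?H m) - A ?h (?H m)) - (A (?H m) ?h - A ?h ?h)"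
        by (simp only: Lp_linear_diff [OF A_lin2 [OF Lp_diff [OF Hm h2]] Hm h2]
            Lp_linear_diff [OF A_lin1 [OF Hm] Hm h2] Lp_linear_diff [OF A_lin1 [OF h2] Hm h2])
      finally show ?thesis using \<alpha>_pos by (simp add: AHH Ahh le_divide_eq mult.commute algebra_simps)
    qed
    \<comment> \<open>The numerator tends to twice the difference of \<open>L ?p\<close> and
      \<open>A ?h ?h\<close>, which is 0 by the energy identity \<open>Ahh\<close> of the
      limit.\<close>
    have "(\<lambda>m. (L (?P m) - A (?H m) ?h - A ?h (?H m) + L ?p) / \<alpha>) \<longlonglongrightarrow> (L ?p - A ?h ?h - A ?h ?h + L ?p) / \<alpha>"
      by (intro tendsto_intros Lp_linear_tendsto [OF L_lin L_bound P]
          weakF [OF A_lin1 [OF h2] A_bound1 [OF h2]] weakF [OF A_lin2 [OF h2] A_bound [OF h2]])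
        (use \<alpha>_pos in auto)
    then have 0: "(\<lambda>m. (L (?P m) - A (?H m) ?h - A ?h (?H m) + L ?p) / \<alpha>) \<longlonglongrightarrow> 0"
      by (simp add: Ahh)
    have "(\<lambda>m. (Lp_norm 2 \<Omega> (\<lambda>x. ?H m x - ?h x))\<^sup>2) \<longlonglongrightarrow> 0"
      by (rule tendsto_sandwich [OF _ _ tendsto_const 0]) (simp_all add: le)
    then show ?thesis
      using Hm h2 by (simp add: Lp_tendsto_iff Lp_norm_power)
  qed
  ultimately show ?thesis using P G by blast
qed

end

section \<open>Constants of the forms and choice of the subsequence\<close>

lemma hessian_forms_of_assumptions:
  assumes "finite_domain \<Omega>" "form_A1 \<Omega> A" "form_A2 \<Omega> B" "form_A3 \<Omega> B" "form_A4 \<Omega> L"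
  shows "\<exists>\<alpha> CA CB CL. hessian_forms \<Omega> A B L \<alpha> CA CB CL"
proof -
  \<comment> \<open>The assumed bounds come with constants of unknown sign. Absolute values make
    them nonnegative, as is required when the bounds are multiplied by other estimates.\<close>
  have enlarge: "c * a \<le> \<bar>c\<bar> * a" if "0 \<le> a" for a c :: real
    using that by (intro mult_right_mono) auto
  obtain CA where CA: "\<And>\<Xi> X. \<Xi> \<in> Lp 2 \<Omega> \<Longrightarrow> X \<in> Lp 2 \<Omega> \<Longrightarrow> \<bar>A \<Xi> X\<bar> \<le> CA * Lp_norm 2 \<Omega> \<Xi> * Lp_norm 2 \<Omega> X"
    using assms(2) unfolding form_A1_def by blast
  obtain \<alpha> where \<alpha>: "\<alpha> > 0" "\<And>\<Xi>. \<Xi> \<in> Lp 2 \<Omega> \<Longrightarrow> \<alpha> * (Lp_norm 2 \<Omega> \<Xi>)\<^sup>2 \<le> A \<Xi> \<Xi>"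
    using assms(2) unfolding form_A1_def by blast
  obtain CB where CB: "\<And>\<Xi> \<Theta> T. \<Xi> \<in> Lp 2 \<Omega> \<Longrightarrow> \<Theta> \<in> Lp 4 \<Omega> \<Longrightarrow> T \<in> Lp 4 \<Omega> \<Longrightarrow>
      \<bar>B \<Xi> \<Theta> T\<bar> \<le> CB * Lp_norm 2 \<Omega> \<Xi> * Lp_norm 4 \<Omega> \<Theta> * Lp_norm 4 \<Omega> T"
    using assms(3) unfolding form_A2_def by blast
  obtain CL where CL: "\<And>f. f \<in> Lp 2 \<Omega> \<Longrightarrow> \<bar>L f\<bar> \<le> CL * Lp_norm 2 \<Omega> f"
    using assms(5) unfolding form_A4_def by blast
  have "\<bar>A \<Xi> X\<bar> \<le> \<bar>CA\<bar> * Lp_norm 2 \<Omega> \<Xi> * Lp_norm 2 \<Omega> X" if "\<Xi> \<in> Lp 2 \<Omega>" "X \<in> Lp 2 \<Omega>" for \<Xi> X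
    using order_trans [OF CA [OF that]] enlarge [of "Lp_norm 2 \<Omega> \<Xi> * Lp_norm 2 \<Omega> X" CA]
    by (simp add: Lp_norm_nonneg mult.assoc)
  moreover have "\<bar>B \<Xi> \<Theta> T\<bar> \<le> \<bar>CB\<bar> * Lp_norm 2 \<Omega> \<Xi> * Lp_norm 4 \<Omega> \<Theta> * Lp_norm 4 \<Omega> T"
    if "\<Xi> \<in> Lp 2 \<Omega>" "\<Theta> \<in> Lp 4 \<Omega>" "T \<in> Lp 4 \<Omega>" for \<Xi> \<Theta> T
    using order_trans [OF CB [OF that]] enlarge [of "Lp_norm 2 \<Omega> \<Xi> * Lp_norm 4 \<Omega> \<Theta> * Lp_norm 4 \<Omega> T" CB]
    by (simp add: Lp_norm_nonneg mult.assoc)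
  moreover have "\<bar>L f\<bar> \<le> \<bar>CL\<bar> * Lp_norm 2 \<Omega> f" if "f \<in> Lp 2 \<Omega>" for f
    using order_trans [OF CL [OF that]] enlarge [of "Lp_norm 2 \<Omega> f" CL] by (simp add: Lp_norm_nonneg)
  ultimately have "hessian_forms \<Omega> A B L \<alpha> \<bar>CA\<bar> \<bar>CB\<bar> \<bar>CL\<bar>"
    using assms \<alpha> unfolding hessian_forms_def hessian_forms_axioms_def
    by (auto simp: form_A1_def form_A2_def form_A3_def form_A4_def)
  then show ?thesis by blast
qed

theorem theorem5p2:
  fixes \<Omega> :: "(real ^ 'n::finite) set"
    and A :: "(real ^ 'n \<Rightarrow> real ^ 'n ^ 'n ^ 'k::finite) \<Rightarrow> (real ^ 'n \<Rightarrow> real ^ 'n ^ 'n ^ 'k) \<Rightarrow> real"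
    and B :: "(real ^ 'n \<Rightarrow> real ^ 'n ^ 'n ^ 'k) \<Rightarrow> (real ^ 'n \<Rightarrow> real ^ 'n ^ 'k)
                \<Rightarrow> (real ^ 'n \<Rightarrow> real ^ 'n ^ 'k) \<Rightarrow> real"
    and L :: "(real ^ 'n \<Rightarrow> real ^ 'k) \<Rightarrow> real"
    and D :: "nat \<Rightarrow> ('x::real_vector, 'n) hess_disc"
  assumes "open \<Omega>" and "connected \<Omega>" and "\<Omega> \<noteq> {}" and "bounded \<Omega>"
    and "form_A1 \<Omega> A" and "form_A2 \<Omega> B" and "form_A3 \<Omega> B" and "form_A4 \<Omega> L"
    and "\<And>m. hessian_discretisation \<Omega> (D m)"
    and "hd_coercive \<Omega> D" and "hd_consistent \<Omega> D"
    and "hd_limit_conforming \<Omega> D" and "hd_compact \<Omega> D"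
  shows "(\<forall>m. \<exists>\<Psi>. hessian_scheme_solution A B L (D m) \<Psi>) \<and>
    (\<forall>\<Psi>D. (\<forall>m. hessian_scheme_solution A B L (D m) (\<Psi>D m)) \<longrightarrow>
      (\<exists>r \<Psi>. strict_mono (r :: nat \<Rightarrow> nat) \<and> weak_solution \<Omega> A B L \<Psi> \<and>
        Lp_tendsto 2 \<Omega> (\<lambda>m. cwise (hd_Pi (D (r m))) (\<Psi>D (r m))) (cwise (\<lambda>u. u) \<Psi>) \<and>
        Lp_tendsto 4 \<Omega> (\<lambda>m. cwise (hd_grad (D (r m))) (\<Psi>D (r m))) (cwise (weak_gradient \<Omega>) \<Psi>) \<and>
        Lp_tendsto 2 \<Omega> (\<lambda>m. cwise (hd_hess (D (r m))) (\<Psi>D (r m))) (cwise (weak_hessian \<Omega>) \<Psi>)))"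
proof -
  \<comment> \<open>Boundedness of the domain enters as finiteness of its measure.\<close>
  have "finite_measure (lebesgue_on \<Omega>)"
    using assms(1,4) by (intro finite_measure_lebesgue_on bounded_set_imp_lmeasurable) (auto simp: borel_open)
  then have "finite_domain \<Omega>"
    using assms(1) by (intro finite_domain.intro)
  then obtain \<alpha> CA CB CL where "hessian_forms \<Omega> A B L \<alpha> CA CB CL"
    using hessian_forms_of_assumptions assms(5-8) by blast
  then interpret hessian_forms \<Omega> A B L \<alpha> CA CB CL .
  note D = assms(9)
  \<comment> \<open>Coercivity bounds an extended real supremum; from it one real constant valid for
    every \<open>m\<close> is extracted.\<close>
  obtain C where C: "\<And>m. hd_C \<Omega> (D m) \<le> ennreal C" "0 \<le> C"
  proof -
    have "(SUP m. hd_C \<Omega> (D m)) < \<infinity>" using assms(10) by (simp add: hd_coercive_def)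
    then obtain C where "0 \<le> C" "(SUP m. hd_C \<Omega> (D m)) = ennreal C"
      by (cases "SUP m. hd_C \<Omega> (D m)") auto
    then show ?thesis using SUP_upper [of _ UNIV "\<lambda>m. hd_C \<Omega> (D m)"] by (intro that [of C]) auto
  qed
  show ?thesis
  proof (intro conjI allI impI)
    show "\<exists>\<Psi>. hessian_scheme_solution A B L (D m) \<Psi>" for m
      by (rule hessian_scheme_exists [OF D C])
    fix \<Psi>D assume sol: "\<forall>m. hessian_scheme_solution A B L (D m) (\<Psi>D m)"
    have bnd: "Lp_norm 2 \<Omega> (cwise (hd_hess (D m)) (\<Psi>D m)) \<le> CL * C / \<alpha>" for m
      using sol by (intro hessian_scheme_bound [OF D C]) blast
    have comp: "\<Psi>D m $ i \<in> hd_space (D m)" for m i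
      using sol by (intro tuplesD) (simp add: hessian_scheme_solution_def)
    have comp_bnd: "hd_norm \<Omega> (D m) (\<Psi>D m $ i) \<le> CL * C / \<alpha>" for m i
      unfolding hd_norm_def
      by (rule order_trans [OF L2_norm_component_le bnd]) (rule hd_hess_Lp [OF D comp])
    \<comment> \<open>All components have to converge along the same subsequence.\<close>
    have "\<exists>r. strict_mono r \<and> (\<forall>i\<in>UNIV. \<exists>u g. Lp_tendsto 2 \<Omega> (\<lambda>m. hd_Pi (D (r m)) (\<Psi>D (r m) $ i)) u \<and>
      Lp_tendsto 4 \<Omega> (\<lambda>m. hd_grad (D (r m)) (\<Psi>D (r m) $ i)) g)"
    proof (rule common_subsequence)
      fix i and r :: "nat \<Rightarrow> nat" assume "strict_mono r"
      from hd_compact_subsequence [where w = "\<lambda>m. \<Psi>D m $ i", OF assms(13) comp comp_bnd this]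
      show "\<exists>r'. strict_mono r' \<and> (\<exists>u g. Lp_tendsto 2 \<Omega> (\<lambda>m. hd_Pi (D ((r \<circ> r') m)) (\<Psi>D ((r \<circ> r') m) $ i)) u \<and>
        Lp_tendsto 4 \<Omega> (\<lambda>m. hd_grad (D ((r \<circ> r') m)) (\<Psi>D ((r \<circ> r') m) $ i)) g)"
        by (simp add: o_def)
    next
      fix i and r r' :: "nat \<Rightarrow> nat"
      assume "\<exists>u g. Lp_tendsto 2 \<Omega> (\<lambda>m. hd_Pi (D (r m)) (\<Psi>D (r m) $ i)) u \<and>
        Lp_tendsto 4 \<Omega> (\<lambda>m. hd_grad (D (r m)) (\<Psi>D (r m) $ i)) g" and r': "strict_mono r'"
      then obtain u g where "Lp_tendsto 2 \<Omega> (\<lambda>m. hd_Pi (D (r m)) (\<Psi>D (r m) $ i)) u"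
        "Lp_tendsto 4 \<Omega> (\<lambda>m. hd_grad (D (r m)) (\<Psi>D (r m) $ i)) g" by blast
      from this [THEN Lp_tendsto_subseq [OF _ r']]
      show "\<exists>u g. Lp_tendsto 2 \<Omega> (\<lambda>m. hd_Pi (D ((r \<circ> r') m)) (\<Psi>D ((r \<circ> r') m) $ i)) u \<and>
        Lp_tendsto 4 \<Omega> (\<lambda>m. hd_grad (D ((r \<circ> r') m)) (\<Psi>D ((r \<circ> r') m) $ i)) g"
        by (simp add: o_def) blast
    qed simp
    then obtain r where r: "strict_mono r"
      and lim: "\<And>i. \<exists>u g. Lp_tendsto 2 \<Omega> (\<lambda>m. hd_Pi (D (r m)) (\<Psi>D (r m) $ i)) u \<and>
        Lp_tendsto 4 \<Omega> (\<lambda>m. hd_grad (D (r m)) (\<Psi>D (r m) $ i)) g"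
      by auto
    \<comment> \<open>Consistency and limit-conformity are statements about limits in
      \<open>m\<close> and therefore pass to the subsequence, to which
      \<open>hessian_scheme_limit\<close> is applied.\<close>
    have cons: "hd_consistent \<Omega> (\<lambda>m. D (r m))"
      using assms(11) LIMSEQ_subseq_LIMSEQ [OF _ r] unfolding hd_consistent_def o_def by fast
    have conf: "hd_limit_conforming \<Omega> (\<lambda>m. D (r m))"
      using assms(12) LIMSEQ_subseq_LIMSEQ [OF _ r] unfolding hd_limit_conforming_def o_def by fast
    have "\<exists>\<Psi>. weak_solution \<Omega> A B L \<Psi> \<and>
        Lp_tendsto 2 \<Omega> (\<lambda>m. cwise (hd_Pi (D (r m))) (\<Psi>D (r m))) (cwise (\<lambda>u. u) \<Psi>) \<and>
        Lp_tendsto 4 \<Omega> (\<lambda>m. cwise (hd_grad (D (r m))) (\<Psi>D (r m))) (cwise (weak_gradient \<Omega>) \<Psi>) \<and>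
        Lp_tendsto 2 \<Omega> (\<lambda>m. cwise (hd_hess (D (r m))) (\<Psi>D (r m))) (cwise (weak_hessian \<Omega>) \<Psi>)"
      using sol by (intro hessian_scheme_limit [OF D cons conf _ bnd lim]) blast
    with r show "\<exists>r \<Psi>. strict_mono (r :: nat \<Rightarrow> nat) \<and> weak_solution \<Omega> A B L \<Psi> \<and>
        Lp_tendsto 2 \<Omega> (\<lambda>m. cwise (hd_Pi (D (r m))) (\<Psi>D (r m))) (cwise (\<lambda>u. u) \<Psi>) \<and>
        Lp_tendsto 4 \<Omega> (\<lambda>m. cwise (hd_grad (D (r m))) (\<Psi>D (r m))) (cwise (weak_gradient \<Omega>) \<Psi>) \<and>
        Lp_tendsto 2 \<Omega> (\<lambda>m. cwise (hd_hess (D (r m))) (\<Psi>D (r m))) (cwise (weak_hessian \<Omega>) \<Psi>)"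
      by blast
  qed
qed

end
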